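(* Under the $\mathbb Q[a]$-bilinear pairing $\langle\ ,\ \rangle$ between $\Lambda(x\|a)$ and $\widehat\Lambda(y\|a)$ determined by $\langle h_\lambda(x\|a),\widehat m_\mu(y\|a)\rangle=\delta_{\lambda\mu}$, we have for all partitions $\lambda,\mu$ $$\big\langle s_\lambda(x\|a),\widehat s_\mu(y\|a)\big\rangle=\delta_{\lambda\mu}\qquad\text{and}\qquad\big\langle p_\lambda(x\|a),p_\mu(y)\big\rangle=\delta_{\lambda\mu}\,z_\lambda.$$
   Context: Let $a=(a_i)_{i\in\mathbb Z}$ be a sequence of commuting indeterminates and $\mathbb Q[a]$ the polynomial ring in the $a_i$. The ring $\Lambda(x\|a)$: its elements are sequences $P=(P_0,P_1,P_2,\dots)$, where $P_n$ is a symmetric polynomial in $x_1,\dots,x_n$ with coefficients in $\mathbb Q[a]$, the total degrees of the $P_n$ in the $x_i$ are bounded, and $P_n(x_1,\dots,x_{n-1},a_n)=P_{n-1}(x_1,\dots,x_{n-1})$ for all $n\geqslant 1$; multiplication is componentwise. Double symmetric functions: for a partition $\lambda$ with $\ell(\lambda)\leqslant n$, $$s_\lambda(x_1,\dots,x_n\|a)=\frac{\det\big[(x_i\|a)^{\lambda_j+n-j}\big]_{i,j=1}^n}{\prod_{1\leqslant i<j\leqslant n}(x_i-x_j)},\qquad (x_i\|a)^r=(x_i-a_n)(x_i-a_{n-1})\cdots(x_i-a_{n-r+1}),\ (x_i\|a)^0=1,$$ and $0$ if $\ell(\lambda)>n$; this sequence is $s_\lambda(x\|a)\in\Lambda(x\|a)$.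 Put $h_k(x\|a)=s_{(k)}(x\|a)$, $p_k(x\|a)=\sum_{i\geqslant 1}(x_i^k-a_i^k)$, $h_\lambda(x\|a)=\prod_ih_{\lambda_i}(x\|a)$, $p_\lambda(x\|a)=\prod_ip_{\lambda_i}(x\|a)$ (products over nonzero parts). The $h_\lambda(x\|a)$ form a $\mathbb Q[a]$-basis of $\Lambda(x\|a)$. Dual side: $\widehat\Lambda(y\|a)$ is the ring of formal (possibly infinite) sums $\sum_{\lambda}c_\lambda(a)s_\lambda(y)$, $c_\lambda(a)\in\mathbb Q[a]$, with $s_\lambda(y)$ ordinary Schur functions. With $d$ the number of diagonal boxes of $\lambda$ and $n\geqslant\ell(\lambda)$, $\widehat s_\lambda(y_1,\dots,y_n\|a)=\det[A_{ij}]_{i,j=1}^n/\prod_{i<j}(y_i-y_j)$, where $A_{ij}=\dfrac{y_i^{\lambda_j+n-j}}{(1-a_0y_i)(1-a_{-1}y_i)\cdots(1-a_{j-\lambda_j}y_i)}$ for $j\leqslant d$ and $A_{ij}=y_i^{\lambda_j+n-j}(1-a_1y_i)\cdots(1-a_{j-\lambda_j-1}y_i)$ for $d<j\leqslant n$ (and $0$ if $\ell(\lambda)>n$); these are compatible with $y_n=0$ and define $\widehat s_\lambda(y\|a)\in\widehat\Lambda(y\|a)$. The dual monomial symmetric function $\widehat m_\mu(y\|a)$ is obtained from the monomial symmetric function $m_\mu(y)$ by replacing each power $y_i^r$, $r\geqslant 1$, in each monomial by $(y_i,a)^r=\dfrac{y_i^r}{(1-a_0y_i)(1-a_{-1}y_i)\cdots(1-a_{1-r}y_i)}$.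 Every element of $\widehat\Lambda(y\|a)$ is uniquely a formal sum $\sum_\mu c_\mu(a)\widehat m_\mu(y\|a)$, and the pairing is $\big\langle\sum_\lambda b_\lambda(a)h_\lambda(x\|a),\sum_\mu c_\mu(a)\widehat m_\mu(y\|a)\big\rangle=\sum_\lambda b_\lambda(a)c_\lambda(a)$ (first sum finite). $p_\mu(y)$ is the ordinary power sum symmetric function, and $z_\lambda=\prod_{i\geqslant 1}i^{m_i}m_i!$ for $\lambda=(1^{m_1}2^{m_2}\dots)$. *)

theory Defs
  imports
    "HOL-Library.Poly_Mapping"
    "HOL-Library.Multiset"
    "HOL-Combinatorics.Permutations"
    "Jordan_Normal_Form.Determinant"
begin

section \<open>Partitions\<close>

typedef partition = "{xs :: nat list. sorted_wrt (\<ge>) xs \<and> 0 \<notin> set xs}"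
  morphisms parts Partition
  by (rule exI[of _ "[]"]) simp

definition len :: "partition \<Rightarrow> nat" where
  "len lam = length (parts lam)"

text \<open>Parts are numbered from 1, and are 0 beyond the length.\<close>

definition part :: "partition \<Rightarrow> nat \<Rightarrow> nat" where
  "part lam j = (if 1 \<le> j \<and> j \<le> len lam then parts lam ! (j - 1) else 0)"

definition row :: "nat \<Rightarrow> partition" where
  "row k = Partition (if k = 0 then [] else [k])"

definition diag :: "partition \<Rightarrow> nat" where
  "diag lam = card {j. 1 \<le> j \<and> j \<le> part lam j}"

definition zee :: "partition \<Rightarrow> nat" where
  "zee lam = (\<Prod>i\<in>set (parts lam).
     i ^ count_list (parts lam) i * fact (count_list (parts lam) i))"


section \<open>Determinants and quotients\<close>

text \<open>Rows and columns are numbered from 1.\<close>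

definition det1 :: "nat \<Rightarrow> (nat \<Rightarrow> nat \<Rightarrow> 'a::comm_ring_1) \<Rightarrow> 'a" where
  "det1 n A = det (mat n n (\<lambda>(i, j). A (Suc i) (Suc j)))"

definition vandermonde :: "nat \<Rightarrow> (nat \<Rightarrow> 'a::comm_ring_1) \<Rightarrow> 'a" where
  "vandermonde n z = (\<Prod>j\<in>{1..n}. \<Prod>i\<in>{1..<j}. z i - z j)"

text \<open>The fraction p/q inside the ring itself. Every denominator below is a unit or a
  non-zero-divisor dividing the numerator, so the quotient exists and is unique.\<close>

definition quot :: "'a::comm_ring_1 \<Rightarrow> 'a \<Rightarrow> 'a" where
  "quot p q = (THE r. r * q = p)"


section \<open>The coefficient ring and polynomials in the x-variables\<close>

type_synonym coef = "(int \<Rightarrow>\<^sub>0 nat) \<Rightarrow>\<^sub>0 rat"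

type_synonym xpoly = "(nat \<Rightarrow>\<^sub>0 nat) \<Rightarrow>\<^sub>0 coef"

definition avar :: "int \<Rightarrow> coef" where
  "avar i = Poly_Mapping.single (Poly_Mapping.single i 1) 1"

definition xconst :: "coef \<Rightarrow> xpoly" where
  "xconst c = Poly_Mapping.single 0 c"

definition xvar :: "nat \<Rightarrow> xpoly" where
  "xvar i = Poly_Mapping.single (Poly_Mapping.single i 1) 1"

definition xsubst :: "(nat \<Rightarrow> xpoly) \<Rightarrow> xpoly \<Rightarrow> xpoly" where
  "xsubst f p = (\<Sum>m\<in>Poly_Mapping.keys p.
     xconst (Poly_Mapping.lookup p m) * (\<Prod>i\<in>Poly_Mapping.keys m. f i ^ Poly_Mapping.lookup m i))"

definition symmetric_in :: "nat \<Rightarrow> xpoly \<Rightarrow> bool" where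
  "symmetric_in n p \<longleftrightarrow>
     (\<forall>m\<in>Poly_Mapping.keys p. Poly_Mapping.keys m \<subseteq> {1..n}) \<and>
     (\<forall>\<pi>. \<pi> permutes {1..n} \<longrightarrow> xsubst (\<lambda>i. xvar (\<pi> i)) p = p)"

definition mdeg :: "(nat \<Rightarrow>\<^sub>0 nat) \<Rightarrow> nat" where
  "mdeg m = (\<Sum>i\<in>Poly_Mapping.keys m. Poly_Mapping.lookup m i)"

definition Lambda :: "(nat \<Rightarrow> xpoly) set" where
  "Lambda = {P. (\<forall>n. symmetric_in n (P n)) \<and>
                (\<exists>D. \<forall>n. \<forall>m\<in>Poly_Mapping.keys (P n). mdeg m \<le> D) \<and>
                (\<forall>n\<ge>1. xsubst (xvar(n := xconst (avar (int n)))) (P n) = P (n - 1))}"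

text \<open>The factorial power \<open>(x\<^sub>i \<parallel> a)\<^sup>r\<close>, which depends on the number \<open>n\<close> of variables.\<close>

definition xpow :: "nat \<Rightarrow> nat \<Rightarrow> nat \<Rightarrow> xpoly" where
  "xpow n i r = (\<Prod>k<r. xvar i - xconst (avar (int n - int k)))"

definition s_x :: "partition \<Rightarrow> nat \<Rightarrow> xpoly" where
  "s_x lam n = (if len lam \<le> n
     then quot (det1 n (\<lambda>i j. xpow n i (part lam j + n - j))) (vandermonde n xvar)
     else 0)"

definition h_x :: "partition \<Rightarrow> nat \<Rightarrow> xpoly" where
  "h_x lam n = (\<Prod>k\<leftarrow>parts lam. s_x (row k) n)"

definition p_x :: "partition \<Rightarrow> nat \<Rightarrow> xpoly" where
  "p_x lam n = (\<Prod>k\<leftarrow>parts lam. \<Sum>i\<in>{1..n}. xvar i ^ k - xconst (avar (int i)) ^ k)"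


section \<open>Formal power series in the y-variables\<close>

typedef 'a mfps = "UNIV :: ((nat \<Rightarrow>\<^sub>0 nat) \<Rightarrow> 'a) set"
  morphisms mcoeff Mfps by simp

setup_lifting type_definition_mfps

text \<open>Each exponent has only finitely many decompositions, which makes the convolution
  product below a finite sum.\<close>

lemma finite_splits: "finite {(\<alpha>, \<beta>). \<alpha> + \<beta> = (\<gamma> :: nat \<Rightarrow>\<^sub>0 nat)}"
proof -
  define B :: "nat set" where "B = (\<Union>i\<in>Poly_Mapping.keys \<gamma>. {0..Poly_Mapping.lookup \<gamma> i})"
  define F :: "(nat \<Rightarrow> nat) set" where
    "F = {f. \<forall>i. (i \<in> Poly_Mapping.keys \<gamma> \<longrightarrow> f i \<in> B) \<and> (i \<notin> Poly_Mapping.keys \<gamma> \<longrightarrow> f i = 0)}"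
  have "finite F"
    unfolding F_def by (rule finite_set_of_finite_funs) (auto simp: B_def)
  moreover have "Poly_Mapping.lookup ` {\<alpha>. \<exists>\<beta>. \<alpha> + \<beta> = \<gamma>} \<subseteq> F"
  proof
    fix f assume "f \<in> Poly_Mapping.lookup ` {\<alpha>. \<exists>\<beta>. \<alpha> + \<beta> = \<gamma>}"
    then obtain \<alpha> \<beta> where f: "f = Poly_Mapping.lookup \<alpha>" and g: "\<alpha> + \<beta> = \<gamma>" by auto
    have le: "f i \<le> Poly_Mapping.lookup \<gamma> i" for i
      unfolding f g[symmetric] by (simp add: lookup_add)
    have "f i \<in> B" if "i \<in> Poly_Mapping.keys \<gamma>" for i
      using that le[of i] unfolding B_def by auto
    moreover have "f i = 0" if "i \<notin> Poly_Mapping.keys \<gamma>" for i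
      using that le[of i] by (simp add: in_keys_iff)
    ultimately show "f \<in> F" unfolding F_def by simp
  qed
  ultimately have "finite (Poly_Mapping.lookup ` {\<alpha>. \<exists>\<beta>. \<alpha> + \<beta> = \<gamma>})"
    by (rule finite_subset[rotated])
  then have "finite {\<alpha>. \<exists>\<beta>. \<alpha> + \<beta> = \<gamma>}"
    by (rule finite_imageD) (simp add: inj_on_def poly_mapping_eqI)
  moreover have "{(\<alpha>, \<beta>). \<alpha> + \<beta> = \<gamma>} \<subseteq> (\<lambda>\<alpha>. (\<alpha>, \<gamma> - \<alpha>)) ` {\<alpha>. \<exists>\<beta>. \<alpha> + \<beta> = \<gamma>}"
    by (auto simp: image_iff)
  ultimately show ?thesis
    by (meson finite_imageI finite_subset)
qed

instantiation mfps :: (comm_ring_1) comm_ring_1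
begin

lift_definition zero_mfps :: "'a mfps" is "\<lambda>_. 0" .
lift_definition one_mfps :: "'a mfps" is "\<lambda>\<gamma>. if \<gamma> = 0 then 1 else 0" .
lift_definition plus_mfps :: "'a mfps \<Rightarrow> 'a mfps \<Rightarrow> 'a mfps" is "\<lambda>f g \<gamma>. f \<gamma> + g \<gamma>" .
lift_definition minus_mfps :: "'a mfps \<Rightarrow> 'a mfps \<Rightarrow> 'a mfps" is "\<lambda>f g \<gamma>. f \<gamma> - g \<gamma>" .
lift_definition uminus_mfps :: "'a mfps \<Rightarrow> 'a mfps" is "\<lambda>f \<gamma>. - f \<gamma>" .
lift_definition times_mfps :: "'a mfps \<Rightarrow> 'a mfps \<Rightarrow> 'a mfps" is
  "\<lambda>f g \<gamma>. \<Sum>(\<alpha>, \<beta>)\<in>{(\<alpha>, \<beta>). \<alpha> + \<beta> = \<gamma>}. f \<alpha> * g \<beta>" .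

instance
proof
  fix f g h :: "'a mfps"
  show "f * g * h = f * (g * h)"
  proof (transfer, rule ext)
    fix f g h :: "(nat \<Rightarrow>\<^sub>0 nat) \<Rightarrow> 'a" and \<gamma> :: "nat \<Rightarrow>\<^sub>0 nat"
    define S where "S = (\<lambda>\<gamma> :: nat \<Rightarrow>\<^sub>0 nat. {(\<alpha>, \<beta>). \<alpha> + \<beta> = \<gamma>})"
    have fin: "finite (S \<gamma>)" for \<gamma>
      unfolding S_def by (rule finite_splits)
    have "(\<Sum>(\<delta>, \<kappa>)\<in>S \<gamma>. (\<Sum>(\<alpha>, \<beta>)\<in>S \<delta>. f \<alpha> * g \<beta>) * h \<kappa>)
        = (\<Sum>u\<in>S \<gamma>. \<Sum>v\<in>S (fst u). f (fst v) * g (snd v) * h (snd u))"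
      by (simp add: sum_distrib_right case_prod_beta)
    also have "\<dots> = (\<Sum>(u, v)\<in>(SIGMA u:S \<gamma>. S (fst u)). f (fst v) * g (snd v) * h (snd u))"
      by (rule sum.Sigma) (auto intro: fin)
    also have "\<dots> = (\<Sum>(u, v)\<in>(SIGMA u:S \<gamma>. S (snd u)). f (fst u) * (g (fst v) * h (snd v)))"
      by (rule sum.reindex_bij_witness
            [of _ "\<lambda>(u, v). ((fst u + fst v, snd v), (fst u, fst v))"
                  "\<lambda>(u, v). ((fst v, snd v + snd u), (snd v, snd u))"])
         (auto simp: S_def algebra_simps)
    also have "\<dots> = (\<Sum>u\<in>S \<gamma>. \<Sum>v\<in>S (snd u). f (fst u) * (g (fst v) * h (snd v)))"
      by (rule sum.Sigma[symmetric]) (auto intro: fin)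
    also have "\<dots> = (\<Sum>(\<alpha>, \<delta>)\<in>S \<gamma>. f \<alpha> * (\<Sum>(\<beta>, \<kappa>)\<in>S \<delta>. g \<beta> * h \<kappa>))"
      by (simp add: sum_distrib_left case_prod_beta)
    finally show "(\<Sum>(\<delta>, \<kappa>)\<in>{(\<delta>, \<kappa>). \<delta> + \<kappa> = \<gamma>}.
          (\<Sum>(\<alpha>, \<beta>)\<in>{(\<alpha>, \<beta>). \<alpha> + \<beta> = \<delta>}. f \<alpha> * g \<beta>) * h \<kappa>)
        = (\<Sum>(\<alpha>, \<delta>)\<in>{(\<alpha>, \<delta>). \<alpha> + \<delta> = \<gamma>}.
          f \<alpha> * (\<Sum>(\<beta>, \<kappa>)\<in>{(\<beta>, \<kappa>). \<beta> + \<kappa> = \<delta>}. g \<beta> * h \<kappa>))"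
      unfolding S_def .
  qed
  show "f * g = g * f"
  proof (transfer, rule ext)
    fix f g :: "(nat \<Rightarrow>\<^sub>0 nat) \<Rightarrow> 'a" and \<gamma> :: "nat \<Rightarrow>\<^sub>0 nat"
    show "(\<Sum>(\<alpha>, \<beta>)\<in>{(\<alpha>, \<beta>). \<alpha> + \<beta> = \<gamma>}. f \<alpha> * g \<beta>)
        = (\<Sum>(\<alpha>, \<beta>)\<in>{(\<alpha>, \<beta>). \<alpha> + \<beta> = \<gamma>}. g \<alpha> * f \<beta>)"
      by (rule sum.reindex_bij_witness[of _ prod.swap prod.swap])
         (auto simp: algebra_simps)
  qed
  show "1 * f = f"
  proof (transfer, rule ext)
    fix f :: "(nat \<Rightarrow>\<^sub>0 nat) \<Rightarrow> 'a" and \<gamma> :: "nat \<Rightarrow>\<^sub>0 nat"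
    have "(\<Sum>(\<alpha>, \<beta>)\<in>{(\<alpha>, \<beta>). \<alpha> + \<beta> = \<gamma>}. (if \<alpha> = 0 then 1 else 0) * f \<beta>)
        = (\<Sum>(\<alpha>, \<beta>)\<in>{(0 :: nat \<Rightarrow>\<^sub>0 nat, \<gamma>)}. (if \<alpha> = 0 then 1 else 0) * f \<beta>)"
      by (intro sum.mono_neutral_right finite_splits) (auto split: if_splits)
    then show "(\<Sum>(\<alpha>, \<beta>)\<in>{(\<alpha>, \<beta>). \<alpha> + \<beta> = \<gamma>}. (if \<alpha> = 0 then 1 else 0) * f \<beta>) = f \<gamma>"
      by simp
  qed
  show "(f + g) * h = f * h + g * h"
    by transfer (simp add: fun_eq_iff case_prod_beta distrib_right sum.distrib)
  show "(0 :: 'a mfps) \<noteq> 1"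
    by transfer (metis zero_neq_one)
  show "f + g + h = f + (g + h)" by transfer (simp add: fun_eq_iff add.assoc)
  show "f + g = g + f" by transfer (simp add: fun_eq_iff add.commute)
  show "0 + f = f" by transfer simp
  show "- f + f = 0" by transfer simp
  show "f - g = f + - g" by transfer simp
qed

end

type_synonym yser = "coef mfps"

definition yconst :: "coef \<Rightarrow> yser" where
  "yconst c = Mfps (\<lambda>\<gamma>. if \<gamma> = 0 then c else 0)"

definition yvar :: "nat \<Rightarrow> yser" where
  "yvar i = Mfps (\<lambda>\<gamma>. if \<gamma> = Poly_Mapping.single i 1 then 1 else 0)"

text \<open>An element of the completed ring is given by the sequence of its images in the variables
  \<open>y\<^sub>1, \<dots>, y\<^sub>n\<close>. In every use below, each monomial occurs in
  only finitely many members of the family \<open>g\<close>, so the formal infinite sum is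
  computed by finite sums of coefficients.\<close>

definition formal_sum ::
    "(partition \<Rightarrow> coef) \<Rightarrow> (partition \<Rightarrow> nat \<Rightarrow> yser) \<Rightarrow> nat \<Rightarrow> yser" where
  "formal_sum c g n =
     Mfps (\<lambda>\<gamma>. \<Sum>lam | mcoeff (g lam n) \<gamma> \<noteq> 0. c lam * mcoeff (g lam n) \<gamma>)"

definition schur_y :: "partition \<Rightarrow> nat \<Rightarrow> yser" where
  "schur_y lam n = (if len lam \<le> n
     then quot (det1 n (\<lambda>i j. yvar i ^ (part lam j + n - j))) (vandermonde n yvar)
     else 0)"

definition Lambda_hat :: "(nat \<Rightarrow> yser) set" where
  "Lambda_hat = {formal_sum c schur_y | c. True}"

definition s_hat :: "partition \<Rightarrow> nat \<Rightarrow> yser" where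
  "s_hat lam n = (if len lam \<le> n
     then quot
       (det1 n (\<lambda>i j.
          if j \<le> diag lam
          then quot (yvar i ^ (part lam j + n - j))
                 (\<Prod>k\<in>{int j - int (part lam j)..0}. 1 - yconst (avar k) * yvar i)
          else yvar i ^ (part lam j + n - j) *
                 (\<Prod>k\<in>{1..int j - int (part lam j) - 1}. 1 - yconst (avar k) * yvar i)))
       (vandermonde n yvar)
     else 0)"

definition ypow :: "nat \<Rightarrow> nat \<Rightarrow> yser" where
  "ypow i r = quot (yvar i ^ r) (\<Prod>k\<in>{1 - int r..0}. 1 - yconst (avar k) * yvar i)"

text \<open>The set consists of the exponents of the monomials of \<open>m\<^sub>\<mu>(y\<^sub>1, \<dots>, y\<^sub>n)\<close>.\<close>

definition m_hat :: "partition \<Rightarrow> nat \<Rightarrow> yser" where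
  "m_hat mu n =
     (\<Sum>\<gamma> | Poly_Mapping.keys \<gamma> \<subseteq> {1..n} \<and>
            image_mset (Poly_Mapping.lookup \<gamma>) (mset_set (Poly_Mapping.keys \<gamma>)) = mset (parts mu).
        \<Prod>i\<in>Poly_Mapping.keys \<gamma>. ypow i (Poly_Mapping.lookup \<gamma> i))"

definition p_y :: "partition \<Rightarrow> nat \<Rightarrow> yser" where
  "p_y mu n = (\<Prod>k\<leftarrow>parts mu. \<Sum>i\<in>{1..n}. yvar i ^ k)"


section \<open>The pairing\<close>

definition h_coeffs :: "(nat \<Rightarrow> xpoly) \<Rightarrow> partition \<Rightarrow> coef" where
  "h_coeffs P = (THE b. finite {lam. b lam \<noteq> 0} \<and>
     P = (\<lambda>n. \<Sum>lam | b lam \<noteq> 0. xconst (b lam) * h_x lam n))"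

definition m_hat_coeffs :: "(nat \<Rightarrow> yser) \<Rightarrow> partition \<Rightarrow> coef" where
  "m_hat_coeffs F = (THE c. F = formal_sum c m_hat)"

text \<open>The pairing is a map on \<^const>\<open>Lambda\<close> and \<^const>\<open>Lambda_hat\<close> only;
  it is left unspecified elsewhere.\<close>

definition pairing :: "(nat \<Rightarrow> xpoly) \<Rightarrow> (nat \<Rightarrow> yser) \<Rightarrow> coef" where
  "pairing P F = (if P \<in> Lambda \<and> F \<in> Lambda_hat
     then \<Sum>lam | h_coeffs P lam \<noteq> 0. h_coeffs P lam * m_hat_coeffs F lam
     else undefined)"

end

theory Submission
  imports Defs "HOL-Computational_Algebra.Formal_Power_Series"
begin

text \<open>The pairing is computed inside the polynomial ring \<open>\<rat>[a][H\<^sub>1, H\<^sub>2, \<dots>]\<close>. It maps to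
  \<open>\<Lambda>(x\<parallel>a)\<close> by sending \<open>H\<^sub>k\<close> to the coefficient of \<open>y\<^sup>k\<close> in
  \<open>\<Prod>\<^sub>i (1 - a\<^sub>i y) / (1 - x\<^sub>i y)\<close>, and its elements act as linear functionals on symmetric power
  series in \<open>y\<close>, the monomials in the \<open>H\<^sub>k\<close> extracting the coefficients of the \<open>m\<^sub>\<lambda>(y)\<close>. A
  Jacobi--Trudi identity exhibits \<open>s\<^sub>\<lambda>(x\<parallel>a)\<close>, and in particular \<open>h\<^sub>k(x\<parallel>a)\<close>, as the image of an
  element whose functional reads off the coefficient of the dual Schur function: the columns of
  the determinant of a dual Schur function are twisted monomials \<open>y\<^sup>r + \<dots>\<close>, and the entries of
  the Jacobi--Trudi determinant come from the dual coefficient functionals. Hence \<open>\<langle>P, F\<rangle>\<close> is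
  the value at \<open>F\<close> of the functional of any preimage of \<open>P\<close>, and both orthogonality relations
  become statements about series in \<open>y\<close> alone. For power sums, the preimage of \<open>p\<^sub>k(x\<parallel>a)\<close> acts as
  the derivation \<open>k \<partial>/\<partial>p\<^sub>k(y)\<close>.\<close>

text \<open>The pairing is built from two coefficient maps given by \<open>THE\<close>, so besides
  the two orthogonality relations the proof must supply existence and uniqueness of expansions on
  both sides. For series in y this is finite linear algebra below each weight. For x, uniqueness is
  injectivity of the map from polynomials in the H_k, which rests on the vanishing theorem. The
  generators H_k are preferred to h_k(x||a) because their kernel is visibly symmetric and loses its
  last factor at x_n = a_n, whereas factorial powers shift their indices with n. That shift is moved
  into the twisted monomials, in which y^r carries the index n - r. One determinant serves both
  sides. For x, multiplying the kernel by all 1 - x_k y with k different from i leaves 1/(1 - x_i y)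
  times the numerators, whose twisted coefficients are factorial powers. For y, expanding the
  determinant multiplies a symmetric series by the Vandermonde product, as in the bialternant
  formula. Any sequence c may replace a; c = 0 gives the ordinary Schur functions that span the
  completed ring.\<close>

section \<open>Partitions as multisets of positive parts; weight and length\<close>

definition pm :: "partition \<Rightarrow> nat multiset" where
  "pm lam = mset (parts lam)"

definition of_pm :: "nat multiset \<Rightarrow> partition" where
  "of_pm M = Partition (rev (sorted_list_of_multiset (filter_mset (\<lambda>k. k \<noteq> 0) M)))"

lemma parts_of_pm: "parts (of_pm M) = rev (sorted_list_of_multiset (filter_mset (\<lambda>k. k \<noteq> 0) M))"
  unfolding of_pm_def
  by (rule Partition_inverse) (auto simp: sorted_wrt_rev simp flip: set_mset_mset)

lemma pm_of_pm [simp]: "pm (of_pm M) = filter_mset (\<lambda>k. k \<noteq> 0) M"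
  by (simp add: pm_def parts_of_pm)

lemma parts_sorted: "sorted_wrt (\<ge>) (parts lam)" and zero_notin_parts: "0 \<notin> set (parts lam)"
  using parts[of lam] by auto

lemma zero_notin_pm [simp]: "0 \<notin># pm lam"
  using zero_notin_parts[of lam] by (simp add: pm_def)

lemma parts_pm: "parts lam = rev (sorted_list_of_multiset (pm lam))"
proof -
  have "sorted (rev (parts lam))"
    using parts_sorted[of lam] by (simp add: sorted_wrt_rev)
  then have "sort (parts lam) = rev (parts lam)"
    by (intro properties_for_sort) auto
  then show ?thesis by (simp add: pm_def)
qed

lemma pm_inject: "pm lam = pm mu \<longleftrightarrow> lam = mu"
  by (metis parts_pm parts_inject)

lemma filter_pm [simp]: "filter_mset (\<lambda>k. k \<noteq> 0) (pm lam) = pm lam" "filter_mset ((<) 0) (pm lam) = pm lam"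
proof -
  show *: "filter_mset (\<lambda>k. k \<noteq> 0) (pm lam) = pm lam"
    by (rule multiset_eqI) (auto simp: count_eq_zero_iff)
  show "filter_mset ((<) 0) (pm lam) = pm lam"
    using * by (simp add: neq0_conv)
qed

lemma of_pm_pm [simp]: "of_pm (pm lam) = lam"
  by (simp flip: pm_inject del: neq0_conv)

text \<open>Partitions form the free commutative monoid on the rows \<open>row k\<close>, \<open>k > 0\<close>.\<close>

instantiation partition :: comm_monoid_add
begin

definition zero_partition :: partition where "0 = of_pm {#}"
definition plus_partition :: "partition \<Rightarrow> partition \<Rightarrow> partition" where
  "lam + mu = of_pm (pm lam + pm mu)"

lemma pm_zero [simp]: "pm 0 = {#}"
  by (simp add: zero_partition_def)

lemma pm_plus [simp]: "pm (lam + mu) = pm lam + pm mu"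
  by (simp add: plus_partition_def)

instance
  by standard (simp_all flip: pm_inject add: ac_simps)

end

instance partition :: cancel_semigroup_add
  by standard (simp_all flip: pm_inject)

lemma pm_row [simp]: "pm (row k) = (if k = 0 then {#} else {#k#})"
proof -
  have "parts (row k) = (if k = 0 then [] else [k])"
    unfolding row_def by (subst Partition_inverse) auto
  then show ?thesis by (simp add: pm_def)
qed

lemma row_0 [simp]: "row 0 = 0"
  by (simp flip: pm_inject)

lemma pm_eq_empty_iff: "pm lam = {#} \<longleftrightarrow> lam = 0"
  by (metis pm_inject pm_zero)

lemma row_part_split: "v \<in># pm lam \<Longrightarrow> row v + of_pm (pm lam - {#v#}) = lam"
  by (auto simp: filter_diff_mset pm_inject[symmetric])

lemma row_plus_neq_zero [simp]: "k > 0 \<Longrightarrow> row k + lam \<noteq> 0"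
  by (simp flip: pm_inject)

lemma partition_row_induct [case_names zero row]:
  assumes "P 0" "\<And>k mu. k > 0 \<Longrightarrow> P mu \<Longrightarrow> P (row k + mu)"
  shows "P lam"
proof (induction "size (pm lam)" arbitrary: lam)
  case 0
  then show ?case using assms by (simp add: pm_eq_empty_iff)
next
  case (Suc n)
  then obtain v where v: "v \<in># pm lam"
    by (metis Zero_not_Suc multiset_nonemptyE size_empty)
  define mu where "mu = of_pm (pm lam - {#v#})"
  have lam: "lam = row v + mu" using row_part_split[OF v] by (simp add: mu_def)
  have "v > 0" using v by (metis gr0I zero_notin_pm)
  moreover have "n = size (pm mu)" using Suc(2) \<open>v > 0\<close> by (simp add: lam)
  ultimately show ?case unfolding lam using Suc(1) assms(2) by blast
qed

definition wt :: "partition \<Rightarrow> nat" where "wt lam = sum_mset (pm lam)"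

lemma wt_0 [simp]: "wt 0 = 0" and wt_plus [simp]: "wt (lam + mu) = wt lam + wt mu"
  and wt_row [simp]: "wt (row k) = k"
  by (simp_all add: wt_def)

lemma wt_sum: "wt (\<Sum>i\<in>I. f i) = (\<Sum>i\<in>I. wt (f i))"
  by (induction I rule: infinite_finite_induct) auto

text \<open>Weight bounds both the size and the number of the parts. This finiteness allows all
  later expansions to be inverted by finite matrices.\<close>

lemma finite_wt_le: "finite {lam. wt lam \<le> d}"
proof (rule finite_imageD)
  have "set (parts lam) \<subseteq> {..d} \<and> length (parts lam) \<le> d" if "wt lam \<le> d" for lam
    using that
  proof (induction lam arbitrary: d rule: partition_row_induct)
    case zero
    then show ?case using pm_zero by (simp add: pm_def del: pm_zero)
  next
    case (row k mu)
    have *: "set (parts nu) = set_mset (pm nu)" "length (parts nu) = size (pm nu)" for nu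
      by (simp_all add: pm_def)
    have "k + wt mu \<le> d" using row by simp
    then show ?case using row(1) row(2)[of "d - k"] unfolding * by fastforce
  qed
  then show "finite (parts ` {lam. wt lam \<le> d})"
    by (intro finite_subset[OF _ finite_lists_length_le[of "{..d}" d]]) auto
  show "inj_on parts {lam. wt lam \<le> d}" by (simp add: inj_on_def parts_inject)
qed

lemma len_pm: "len lam = size (pm lam)"
  by (simp add: len_def pm_def)

lemma len_0 [simp]: "len 0 = 0" and len_plus: "len (lam + mu) = len lam + len mu"
  by (simp_all add: len_pm)

lemma len_row: "len (row k) = (if k = 0 then 0 else 1)"
  by (simp add: len_pm)

lemma part_beyond [simp]: "len lam < j \<Longrightarrow> part lam j = 0"
  by (simp add: part_def)

lemma part_pos: "1 \<le> j \<Longrightarrow> j \<le> len lam \<Longrightarrow> part lam j > 0"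
proof (rule gr0I)
  assume "1 \<le> j" "j \<le> len lam" "part lam j = 0"
  then have "parts lam ! (j - 1) = 0" "j - 1 < length (parts lam)"
    by (auto simp: part_def len_def)
  then show False using zero_notin_parts[of lam] by (metis nth_mem)
qed

lemma part_antimono:
  assumes "1 \<le> i" "i \<le> j" shows "part lam j \<le> part lam i"
proof (cases "j \<le> len lam \<and> i < j")
  case True
  then have "parts lam ! (i - 1) \<ge> parts lam ! (j - 1)"
    using sorted_wrt_nth_less[OF parts_sorted[of lam], of "i - 1" "j - 1"] assms
    by (auto simp: len_def)
  then show ?thesis using True assms by (simp add: part_def)
next
  case False
  then show ?thesis using assms by (cases "i = j") auto
qed

lemma pm_sum_rows: "pm (\<Sum>i\<in>I. row (g i)) = filter_mset (\<lambda>k. k \<noteq> 0) (image_mset g (mset_set I))"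
  by (induction I rule: infinite_finite_induct) auto

text \<open>Zero parts contribute \<open>row 0 = 0\<close>, so padding to any number n of rows is
  harmless. This is the bridge between products over i = 1..n and products over the parts.\<close>

lemma sum_row_part: 
  assumes "len lam \<le> n" shows "(\<Sum>i\<in>{1..n}. row (part lam i)) = lam"
proof -
  have "(\<Sum>i\<in>{1..n}. row (part lam i)) = (\<Sum>i\<in>{1..len lam}. row (part lam i))"
    using assms by (intro sum.mono_neutral_right) auto
  also have "\<dots> = (\<Sum>i<len lam. row (parts lam ! i))"
    by (rule sum.reindex_bij_witness[of _ Suc "\<lambda>i. i - 1"]) (auto simp: part_def)
  also have "\<dots> = lam"
  proof -
    have "image_mset (\<lambda>i. parts lam ! i) (mset_set {..<len lam}) = pm lam"
      unfolding pm_def len_def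
      by (metis atLeast_upt map_nth mset_map mset_set_set mset_upt lessThan_atLeast0 atLeastLessThan_upt distinct_upt)
    then show ?thesis
      by (simp add: pm_inject[symmetric] pm_sum_rows)
  qed
  finally show ?thesis .
qed

lemmas sum_row_part_Suc = sum_row_part[unfolded One_nat_def]

lemma wt_part: "len lam \<le> n \<Longrightarrow> wt lam = (\<Sum>i\<in>{1..n}. part lam i)"
  using arg_cong[OF sum_row_part[of lam n], of wt] by (simp add: wt_sum)

lemma part_inject: "len lam \<le> n \<Longrightarrow> len mu \<le> n \<Longrightarrow> (\<And>i. i \<in> {1..n} \<Longrightarrow> part lam i = part mu i) \<Longrightarrow> lam = mu"
  using sum_row_part[of lam n] sum_row_part[of mu n] by simp

lemma prod_parts: "(\<Prod>k\<leftarrow>parts lam. g k) = (\<Prod>k\<in>#pm lam. g k)"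
  for g :: "nat \<Rightarrow> 'a::comm_monoid_mult"
  unfolding pm_def by (metis mset_map prod_mset_prod_list)

section \<open>Evaluating finitely supported functions\<close>

text \<open>A common form of the evaluations \<open>theta\<close>, \<open>xsubst\<close> and
  \<open>xeval\<close>: coefficients go through h and exponents through g. It is a ring homomorphism
  as soon as g turns sums into products.\<close>

definition pm_eval :: "('b \<Rightarrow> 'c) \<Rightarrow> ('k \<Rightarrow> 'c) \<Rightarrow> ('k \<Rightarrow>\<^sub>0 'b::comm_ring_1) \<Rightarrow> 'c::comm_ring_1" where
  "pm_eval h g p = (\<Sum>m\<in>Poly_Mapping.keys p. h (Poly_Mapping.lookup p m) * g m)"

lemma pm_eval_superset:
  assumes "comm_ring_hom h" "finite A" "Poly_Mapping.keys p \<subseteq> A"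
  shows "pm_eval h g p = (\<Sum>m\<in>A. h (Poly_Mapping.lookup p m) * g m)"
proof -
  interpret h: comm_ring_hom h by fact
  show ?thesis unfolding pm_eval_def
    using assms by (intro sum.mono_neutral_left) (auto simp: in_keys_iff)
qed

lemma pm_eval_single: "comm_ring_hom h \<Longrightarrow> pm_eval h g (Poly_Mapping.single m c) = h c * g m"
  by (subst pm_eval_superset[of _ "{m}"]) auto

lemma pm_eval_add:
  assumes "comm_ring_hom h"
  shows "pm_eval h g (p + q) = pm_eval h g p + pm_eval h g q"
proof -
  interpret h: comm_ring_hom h by fact
  let ?A = "Poly_Mapping.keys p \<union> Poly_Mapping.keys q"
  have "Poly_Mapping.keys (p + q) \<subseteq> ?A" by (rule keys_add)
  then show ?thesis
    by (simp add: pm_eval_superset[OF assms, of ?A] lookup_add h.hom_add distrib_right sum.distrib)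
qed

lemma pm_eval_0 [simp]: "pm_eval h g 0 = 0"
  by (simp add: pm_eval_def)

lemma poly_mapping_sum_single:
  "(\<Sum>m\<in>Poly_Mapping.keys p. Poly_Mapping.single m (Poly_Mapping.lookup p m)) = p"
proof (rule poly_mapping_eqI)
  fix k
  have "(\<Sum>m\<in>Poly_Mapping.keys p. Poly_Mapping.lookup (Poly_Mapping.single m (Poly_Mapping.lookup p m)) k)
      = (\<Sum>m\<in>Poly_Mapping.keys p. if m = k then Poly_Mapping.lookup p m else 0)"
    by (intro sum.cong) (auto simp: lookup_single)
  then show "Poly_Mapping.lookup (\<Sum>m\<in>Poly_Mapping.keys p. Poly_Mapping.single m (Poly_Mapping.lookup p m)) k = Poly_Mapping.lookup p k"
    by (simp add: lookup_sum in_keys_iff)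
qed

lemma poly_mapping_add_induct [case_names zero single add]:
  assumes "P 0" "\<And>m c. P (Poly_Mapping.single m c)" "\<And>p q. P p \<Longrightarrow> P q \<Longrightarrow> P (p + q)"
  shows "P (p :: 'a \<Rightarrow>\<^sub>0 'b::comm_monoid_add)"
proof -
  have "P (\<Sum>m\<in>A. Poly_Mapping.single m (Poly_Mapping.lookup p m))" for A
    by (induction A rule: infinite_finite_induct) (auto intro: assms)
  then show ?thesis using poly_mapping_sum_single[of p] by metis
qed

lemma pm_eval_hom:
  fixes g :: "'k::comm_monoid_add \<Rightarrow> 'c::comm_ring_1"
  assumes h: "comm_ring_hom h" and "g 0 = 1" "\<And>m k. g (m + k) = g m * g k"
  shows "comm_ring_hom (pm_eval h g)"
proof -
  interpret h: comm_ring_hom h by fact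
  have single_mult: "pm_eval h g (Poly_Mapping.single m c * q) = h c * g m * pm_eval h g q" for m c q
    by (induction q rule: poly_mapping_add_induct)
       (simp_all add: mult_single pm_eval_single[OF h] h.hom_mult assms ring_distribs pm_eval_add[OF h] mult_ac)
  have mult: "pm_eval h g (p * q) = pm_eval h g p * pm_eval h g q" for p q
    by (induction p rule: poly_mapping_add_induct)
       (simp_all add: single_mult ring_distribs pm_eval_add[OF h] pm_eval_single[OF h])
  have one: "pm_eval h g 1 = 1"
    using pm_eval_single[OF h, of g 0 1] assms by simp
  show ?thesis
    by unfold_locales (simp_all add: pm_eval_add[OF h] mult one)
qed

lemma single_hom: "comm_ring_hom (Poly_Mapping.single (0::'k::comm_monoid_add) :: 'b::comm_ring_1 \<Rightarrow> _)"
  by unfold_locales (auto simp: single_add mult_single)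

section \<open>Determinants\<close>

lemma det1_leibniz:
  "det1 n A = (\<Sum>p | p permutes {0..<n}. signof p * (\<Prod>i\<in>{0..<n}. A (Suc i) (Suc (p i))))"
proof -
  have "p i < n" if "p permutes {0..<n}" "i < n" for p i
    using permutes_in_image[OF that(1), of i] that(2) by simp
  then show ?thesis
    unfolding det1_def by (subst det_def'[of _ n]) (auto intro!: sum.cong prod.cong)
qed

lemma det1_cong:
  "(\<And>i j. i \<in> {1..n} \<Longrightarrow> j \<in> {1..n} \<Longrightarrow> A i j = B i j) \<Longrightarrow> det1 n A = det1 n B"
  unfolding det1_def by (intro arg_cong[of _ _ det] cong_mat) auto

lemma det1_0 [simp]: "det1 0 A = 1"
  unfolding det1_def by simp

lemma det1_mult: "det1 n A * det1 n B = det1 n (\<lambda>i j. \<Sum>k\<in>{1..n}. A i k * B k j)"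
proof -
  have "mat n n (\<lambda>(i, j). A (Suc i) (Suc j)) * mat n n (\<lambda>(i, j). B (Suc i) (Suc j))
      = mat n n (\<lambda>(i, j). \<Sum>k\<in>{1..n}. A (Suc i) k * B k (Suc j))"
    by (intro eq_matI)
       (auto simp: scalar_prod_def intro!: sum.reindex_bij_witness[of _ "\<lambda>k. k - 1" Suc])
  then show ?thesis
    unfolding det1_def by (subst det_mult[symmetric, of _ n]) auto
qed

lemma det1_transpose: "det1 n (\<lambda>i j. A j i) = det1 n A"
proof -
  have "mat n n (\<lambda>(i, j). A (Suc j) (Suc i)) = transpose_mat (mat n n (\<lambda>(i, j). A (Suc i) (Suc j)))"
    by (intro eq_matI) auto
  then show ?thesis unfolding det1_def by (simp add: det_transpose[of _ n])
qed

lemma det1_upper_triangular: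
  assumes "\<And>i j. i \<in> {1..n} \<Longrightarrow> j \<in> {1..n} \<Longrightarrow> j < i \<Longrightarrow> A i j = 0"
  shows "det1 n A = (\<Prod>i\<in>{1..n}. A i i)"
proof -
  have "det1 n A = prod_list (diag_mat (mat n n (\<lambda>(i, j). A (Suc i) (Suc j))))"
    unfolding det1_def using assms by (intro det_upper_triangular[of _ n]) auto
  also have "\<dots> = (\<Prod>i\<in>{0..<n}. A (Suc i) (Suc i))"
    by (simp add: diag_mat_def prod.distinct_set_conv_list[symmetric] cong: map_cong)
  also have "\<dots> = (\<Prod>i\<in>{1..n}. A i i)"
    by (rule prod.reindex_bij_witness[of _ "\<lambda>k. k - 1" Suc]) auto
  finally show ?thesis .
qed

lemma det1_zero_row:
  assumes "k \<in> {1..n}" "\<And>j. j \<in> {1..n} \<Longrightarrow> A k j = 0"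
  shows "det1 n A = 0"
proof -
  have "(\<Prod>i\<in>{0..<n}. A (Suc i) (Suc (p i))) = 0" if "p permutes {0..<n}" for p
    using assms permutes_in_image[OF that, of "k - 1"] by (intro prod_zero bexI[of _ "k - 1"]) auto
  then show ?thesis by (simp add: det1_leibniz)
qed

lemma det1_hom:
  assumes "comm_ring_hom h" shows "h (det1 n A) = det1 n (\<lambda>i j. h (A i j))"
proof -
  interpret h: comm_ring_hom h by fact
  show ?thesis
    unfolding det1_def h.hom_det[symmetric]
    by (intro arg_cong[of _ _ det] eq_matI) auto
qed

lemma det1_scale_rows: "det1 n (\<lambda>i j. c i * A i j) = (\<Prod>i\<in>{1..n}. c i) * det1 n A"
proof -
  have "(\<Prod>i\<in>{0..<n}. c (Suc i)) = (\<Prod>i\<in>{1..n}. c i)"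
    by (rule prod.reindex_bij_witness[of _ "\<lambda>k. k - 1" Suc]) auto
  then show ?thesis
    by (simp add: det1_leibniz prod.distrib sum_distrib_left mult_ac)
qed

text \<open>Laplace expansion along a unit row. Both the Jacobi-Trudi determinants and the
  determinants of the dual Schur functions pass from n + 1 to n in this way.\<close>

lemma det1_last_row:
  assumes "\<And>j. j \<in> {1..n} \<Longrightarrow> A (Suc n) j = 0" "A (Suc n) (Suc n) = 1"
  shows "det1 (Suc n) A = det1 n A"
proof -
  let ?M = "mat (Suc n) (Suc n) (\<lambda>(i, j). A (Suc i) (Suc j))"
  have "det ?M = (\<Sum>j<Suc n. ?M $$ (n, j) * cofactor ?M n j)"
    by (rule laplace_expansion_row) auto
  also have "\<dots> = (\<Sum>j\<in>{n}. ?M $$ (n, j) * cofactor ?M n j)"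
    using assms(1) by (intro sum.mono_neutral_right) auto
  also have "\<dots> = det (mat_delete ?M n n)"
    using assms(2) by (simp add: cofactor_def)
  also have "mat_delete ?M n n = mat n n (\<lambda>(i, j). A (Suc i) (Suc j))"
    by (intro eq_matI) (auto simp: mat_delete_def)
  finally show ?thesis by (simp add: det1_def)
qed

section \<open>Expansion in twisted monomials\<close>

definition lin :: "'a::comm_ring_1 \<Rightarrow> 'a fps" where "lin c = 1 - fps_const c * fps_X"
definition geo :: "'a::comm_ring_1 \<Rightarrow> 'a fps" where "geo c = Abs_fps (\<lambda>n. c ^ n)"

lemma lin_geo: "lin c * geo c = 1"
proof (rule fps_ext)
  show "fps_nth (lin c * geo c) n = fps_nth 1 n" for n
    by (cases n) (simp_all add: lin_def geo_def left_diff_distrib mult.assoc)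
qed

lemma lin_nth_0 [simp]: "fps_nth (lin c) 0 = 1" and geo_nth_0 [simp]: "fps_nth (geo c) 0 = 1"
  by (simp_all add: lin_def geo_def)

lemma lin_0 [simp]: "lin 0 = 1" and geo_0 [simp]: "geo 0 = 1"
  by (auto simp: lin_def geo_def power_0_left intro!: fps_ext)

lemma geo_lin: "geo c * lin c = 1"
  using lin_geo[of c] by (simp only: mult.commute)

text \<open>The twisted monomials \<open>X^s * efac c (n - s)\<close> are the columns of the determinants
  defining the dual Schur functions, and \<open>tau c n r\<close> extracts the coefficient of the \<open>r\<close>-th one.\<close>

definition efac :: "(int \<Rightarrow> 'a::comm_ring_1) \<Rightarrow> int \<Rightarrow> 'a fps" where
  "efac c n = (if n \<ge> 1 then \<Prod>k\<in>{1..n - 1}. lin (c k) else \<Prod>k\<in>{n..0}. geo (c k))"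

lemma efac_plus_1: "efac c (n + 1) = lin (c n) * efac c n"
proof (cases "n \<ge> 1")
  case True
  then have "{1..n} = insert n {1..n - 1}" by auto
  then show ?thesis using True by (simp add: efac_def)
next
  case False
  then have *: "{n..0} = insert n {n + 1..0}" by auto
  have "efac c n = geo (c n) * efac c (n + 1)"
    using False by (cases "n = 0") (simp_all add: efac_def *)
  then show ?thesis
    by (metis lin_geo mult.assoc mult_1)
qed

lemma fps_prod_nth_0: "fps_nth (\<Prod>k\<in>A. f k) 0 = (\<Prod>k\<in>A. fps_nth (f k) 0)"
  for f :: "_ \<Rightarrow> 'a::comm_ring_1 fps"
  by (induction A rule: infinite_finite_induct) auto

lemma efac_nth_0 [simp]: "fps_nth (efac c n) 0 = 1"
  by (simp add: efac_def fps_prod_nth_0)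

lemma efac_0 [simp]: "efac (\<lambda>_. 0) n = 1"
  by (simp add: efac_def)

text \<open>Triangular elimination: subtracting the constant term times the 0-th twisted monomial
  leaves a multiple of X, and division by X carries the remaining twisted monomials for n to those
  for n - 1.\<close>

fun tau :: "(int \<Rightarrow> 'a::comm_ring_1) \<Rightarrow> int \<Rightarrow> nat \<Rightarrow> 'a fps \<Rightarrow> 'a" where
  "tau c n 0 F = fps_nth F 0"
| "tau c n (Suc r) F = tau c (n - 1) r (fps_shift 1 (F - fps_const (fps_nth F 0) * efac c n))"

lemma tau_0 [simp]: "tau c n r 0 = 0"
  by (induction r arbitrary: n) auto

lemma tau_add: "tau c n r (F + G) = tau c n r F + tau c n r G"
proof (induction r arbitrary: n F G)
  case (Suc r)
  have "fps_shift 1 (F + G - fps_const (fps_nth (F + G) 0) * efac c n)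
      = fps_shift 1 (F - fps_const (fps_nth F 0) * efac c n)
      + fps_shift 1 (G - fps_const (fps_nth G 0) * efac c n)"
    by (rule fps_ext) (simp add: algebra_simps)
  then show ?case by (simp add: Suc)
qed auto

lemma tau_const_mult: "tau c n r (fps_const a * F) = a * tau c n r F"
proof (induction r arbitrary: n F)
  case (Suc r)
  have "fps_shift 1 (fps_const a * F - fps_const (fps_nth (fps_const a * F) 0) * efac c n)
      = fps_const a * fps_shift 1 (F - fps_const (fps_nth F 0) * efac c n)"
    by (rule fps_ext) (simp add: algebra_simps)
  then show ?case by (simp add: Suc)
qed auto

lemma tau_sum: "tau c n r (\<Sum>k\<in>A. F k) = (\<Sum>k\<in>A. tau c n r (F k))"
  by (induction A rule: infinite_finite_induct) (auto simp: tau_add)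

lemma tau_X_mult: "tau c n (Suc r) (fps_X * F) = tau c (n - 1) r F"
proof -
  have "fps_shift 1 (fps_X * F - fps_const (fps_nth (fps_X * F) 0) * efac c n) = F"
    by (rule fps_ext) simp
  then show ?thesis by simp
qed

lemma tau_X_power_mult:
  "tau c n r (fps_X ^ s * F) = (if s \<le> r then tau c (n - int s) (r - s) F else 0)"
proof (induction s arbitrary: n r)
  case (Suc s)
  show ?case
  proof (cases r)
    case (Suc r')
    then show ?thesis
      using tau_X_mult[of c n r' "fps_X ^ s * F"] Suc.IH[of "n - 1" r']
      by (simp add: mult.assoc algebra_simps)
  qed (simp add: mult.assoc)
qed auto

lemma tau_efac: "tau c n r (efac c n) = (if r = 0 then 1 else 0)"
  by (cases r) simp_all

lemma tau_twisted_monomial: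
  "tau c n r (fps_X ^ s * efac c (n - int s)) = (if r = s then 1 else 0)"
  by (auto simp: tau_X_power_mult tau_efac)

text \<open>One elimination step splits off one factor:
  \<open>efac c (n + 1) = (1 - c n X) efac c n\<close>, so subtracting \<open>efac c n\<close>
  leaves X (x - c n) \<open>efac c n * geo x\<close>, which is the same problem at n - 1.\<close>

lemma tau_geo: "tau c n r (efac c (n + 1) * geo x) = (\<Prod>k<r. x - c (n - int k))"
proof (induction r arbitrary: n)
  case (Suc r)
  have geo: "geo x = 1 + fps_const x * (fps_X * geo x)"
    using lin_geo[of x] by (simp add: lin_def algebra_simps)
  have "efac c (n + 1) * geo x - efac c n
      = efac c n * (geo x - fps_const (c n) * (fps_X * geo x) - 1)"
    unfolding efac_plus_1 lin_def by (simp add: algebra_simps)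
  also have "geo x - fps_const (c n) * (fps_X * geo x) - 1 = fps_const (x - c n) * (fps_X * geo x)"
    using geo by (simp add: algebra_simps flip: fps_const_sub)
  finally have "fps_shift 1 (efac c (n + 1) * geo x - efac c n)
      = fps_shift 1 (fps_X * (fps_const (x - c n) * (efac c n * geo x)))"
    by (simp add: mult_ac)
  also have "\<dots> = fps_const (x - c n) * (efac c n * geo x)"
    by (rule fps_ext) simp
  finally have "tau c n (Suc r) (efac c (n + 1) * geo x)
      = (x - c n) * tau c (n - 1) r (efac c (n - 1 + 1) * geo x)"
    by (simp add: tau_const_mult)
  then show ?case
    unfolding Suc prod.lessThan_Suc_shift by (simp add: diff_diff_eq add.commute)
qed auto

text \<open>\<open>tau\<close> sees only the coefficients up to X^r, with weights independent of F.
  As a finite linear combination it can be applied one variable at a time and compared across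
  different coefficient rings.\<close>

lemma tau_expand: "tau c n r F = (\<Sum>k\<le>r. tau c n r (fps_X ^ k) * fps_nth F k)"
proof (induction r arbitrary: n F)
  case (Suc r)
  let ?t = "\<lambda>k. tau c (n - 1) r (fps_X ^ k)"
  have t0: "tau c n (Suc r) (fps_X ^ 0) = - (\<Sum>k\<le>r. ?t k * fps_nth (efac c n) (Suc k))"
    by (simp add: Suc[of "n - 1" "fps_shift (Suc 0) (1 - efac c n)"] sum_negf)
  have tS: "tau c n (Suc r) (fps_X ^ Suc k) = ?t k" for k
    using tau_X_mult[of c n r "fps_X ^ k"] by simp
  have "tau c n (Suc r) F
      = (\<Sum>k\<le>r. ?t k * (fps_nth F (Suc k) - fps_nth F 0 * fps_nth (efac c n) (Suc k)))"
    by (simp add: Suc[of "n - 1" "fps_shift (Suc 0) (F - fps_const (fps_nth F 0) * efac c n)"])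
  also have "\<dots> = tau c n (Suc r) (fps_X ^ 0) * fps_nth F 0 + (\<Sum>k\<le>r. ?t k * fps_nth F (Suc k))"
    unfolding t0 by (simp add: algebra_simps sum_subtractf sum_distrib_left)
  also have "\<dots> = (\<Sum>k\<le>Suc r. tau c n (Suc r) (fps_X ^ k) * fps_nth F k)"
    unfolding sum.atMost_Suc_shift tS ..
  finally show ?case .
qed auto

definition fps_hom :: "('a \<Rightarrow> 'b) \<Rightarrow> 'a::comm_ring_1 fps \<Rightarrow> 'b::comm_ring_1 fps" where
  "fps_hom h F = Abs_fps (\<lambda>k. h (fps_nth F k))"

lemma fps_hom_nth [simp]: "fps_nth (fps_hom h F) k = h (fps_nth F k)"
  by (simp add: fps_hom_def)

lemma fps_hom_hom: assumes "comm_ring_hom h" shows "comm_ring_hom (fps_hom h)"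
proof -
  interpret h: comm_ring_hom h by fact
  show ?thesis
    by unfold_locales (auto intro!: fps_ext simp: fps_mult_nth h.hom_add h.hom_mult h.hom_sum)
qed

lemma fps_hom_lin_geo:
  assumes "comm_ring_hom h"
  shows "fps_hom h (lin c) = lin (h c)" "fps_hom h (geo c) = geo (h c)" "fps_hom h fps_X = fps_X"
proof -
  interpret h: comm_ring_hom h by fact
  show "fps_hom h (lin c) = lin (h c)" "fps_hom h fps_X = fps_X"
    by (auto intro!: fps_ext simp: lin_def fps_X_nth h.hom_minus)
  show "fps_hom h (geo c) = geo (h c)"
    by (auto intro!: fps_ext simp: geo_def h.hom_power)
qed

lemma fps_hom_efac:
  assumes "comm_ring_hom h" shows "fps_hom h (efac c n) = efac (\<lambda>k. h (c k)) n"
proof -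
  interpret H: comm_ring_hom "fps_hom h" by (rule fps_hom_hom) fact
  show ?thesis by (simp add: efac_def H.hom_prod fps_hom_lin_geo[OF assms])
qed

lemma tau_hom:
  assumes "comm_ring_hom h" shows "h (tau c n r F) = tau (\<lambda>k. h (c k)) n r (fps_hom h F)"
proof (induction r arbitrary: n F)
  case (Suc r)
  interpret h: comm_ring_hom h by fact
  have "fps_hom h (fps_shift 1 (F - fps_const (fps_nth F 0) * efac c n))
    = fps_shift 1 (fps_hom h F - fps_const (h (fps_nth F 0)) * fps_hom h (efac c n))"
    by (rule fps_ext) (simp add: h.hom_minus h.hom_mult)
  then show ?case by (simp add: Suc fps_hom_efac[OF assms])
qed auto

section \<open>A Jacobi-Trudi identity in an arbitrary commutative ring\<close>

lemma prod_lin_nth_eq_0: "card A < l \<Longrightarrow> fps_nth (\<Prod>k\<in>A. lin (z k)) l = 0"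
proof (induction A arbitrary: l rule: infinite_finite_induct)
  case (insert x A)
  then obtain l' where l: "l = Suc l'" by (cases l) auto
  show ?case using insert by (simp add: lin_def left_diff_distrib mult.assoc l)
qed auto

lemma fps_eq_sum_X_power:
  assumes "\<And>l. l \<ge> m \<Longrightarrow> fps_nth P l = 0"
  shows "P = (\<Sum>l<m. fps_const (fps_nth P l) * fps_X ^ l)"
proof (rule fps_ext)
  fix n
  have "(\<Sum>l<m. fps_nth P l * fps_nth (fps_X ^ l) n) = (\<Sum>l<m. if l = n then fps_nth P l else 0)"
    by (intro sum.cong) (auto simp: fps_X_power_nth)
  then show "fps_nth P n = fps_nth (\<Sum>l<m. fps_const (fps_nth P l) * fps_X ^ l) n"
    using assms[of n] by (auto simp: fps_sum_nth not_less)
qed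

text \<open>The coefficients of \<open>others m z i\<close> are the signed elementary symmetric polynomials in
  the \<open>z k\<close> with \<open>k \<noteq> i\<close>.\<close>

definition others :: "nat \<Rightarrow> (nat \<Rightarrow> 'a::comm_ring_1) \<Rightarrow> nat \<Rightarrow> 'a fps" where
  "others m z i = (\<Prod>k\<in>{1..m} - {i}. lin (z k))"

lemma others_nth_eq_0: "i \<in> {1..m} \<Longrightarrow> l \<ge> m \<Longrightarrow> fps_nth (others m z i) l = 0"
  unfolding others_def by (rule prod_lin_nth_eq_0) auto

lemma sum_reverse_upto: "(\<Sum>l<m. f l) = (\<Sum>l\<in>{1..m}. f (m - l))" for f :: "nat \<Rightarrow> 'a::comm_monoid_add"
  by (rule sum.reindex_bij_witness[of _ "\<lambda>l. m - l" "\<lambda>l. m - l"]) auto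

text \<open>The generating series of the H_k, truncated to m variables:
  \<open>efac c (m + 1)\<close> is the product of the numerators 1 - c_k X for k = 1..m, see
  \<open>kern_prod\<close>.\<close>

definition kern :: "(int \<Rightarrow> 'a::comm_ring_1) \<Rightarrow> nat \<Rightarrow> (nat \<Rightarrow> 'a) \<Rightarrow> 'a fps" where
  "kern c m z = efac c (int m + 1) * (\<Prod>k\<in>{1..m}. geo (z k))"

lemma kern_others:
  assumes "i \<in> {1..m}"
  shows "kern c m z * others m z i = efac c (int m + 1) * geo (z i)"
proof -
  have "(\<Prod>k\<in>{1..m}. geo (z k)) = geo (z i) * (\<Prod>k\<in>{1..m} - {i}. geo (z k))"
    using assms by (subst prod.remove[of _ i]) auto
  moreover have "(\<Prod>k\<in>{1..m} - {i}. geo (z k)) * others m z i = 1"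
    by (simp add: others_def geo_lin flip: prod.distrib)
  ultimately show ?thesis by (simp add: kern_def mult.assoc)
qed

text \<open>By \<open>tau_geo\<close> and \<open>kern_others\<close> a factorial power of z_i is
  \<open>tau\<close> applied to the kernel times \<open>others m z i\<close>. The latter is a
  polynomial of degree below m in X, so linearity of \<open>tau\<close> gives a matrix product: the
  first factor does not involve the exponents r, the second involves z only through the
  kernel.\<close>

lemma det_factorial_powers_aux:
  "det1 m (\<lambda>i j. \<Prod>k<r j. z i - c (int m - int k))
     = det1 m (\<lambda>i l. fps_nth (others m z i) (m - l))
     * det1 m (\<lambda>i l. tau c (int m) (r i) (fps_X ^ (m - l) * kern c m z))"
proof -
  have entry: "(\<Prod>k<r j. z i - c (int m - int k))
      = (\<Sum>l\<in>{1..m}. fps_nth (others m z i) (m - l) * tau c (int m) (r j) (fps_X ^ (m - l) * kern c m z))"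
    if "i \<in> {1..m}" for i j
  proof -
    have "(\<Prod>k<r j. z i - c (int m - int k)) = tau c (int m) (r j) (kern c m z * others m z i)"
      using that by (simp add: kern_others tau_geo)
    also have "kern c m z * others m z i
        = (\<Sum>l<m. fps_const (fps_nth (others m z i) l) * (fps_X ^ l * kern c m z))"
      by (subst (1) fps_eq_sum_X_power[of m "others m z i"])
         (auto simp: others_nth_eq_0[OF that] sum_distrib_left mult_ac)
    finally show ?thesis
      by (simp add: tau_sum tau_const_mult sum_reverse_upto)
  qed
  have "det1 m (\<lambda>i j. \<Prod>k<r j. z i - c (int m - int k))
      = det1 m (\<lambda>i l. fps_nth (others m z i) (m - l))
      * det1 m (\<lambda>l j. tau c (int m) (r j) (fps_X ^ (m - l) * kern c m z))"
    unfolding det1_mult by (rule det1_cong) (use entry in auto)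
  then show ?thesis
    using det1_transpose[of m "\<lambda>i l. tau c (int m) (r i) (fps_X ^ (m - l) * kern c m z)"] by simp
qed

text \<open>The Newton basis with nodes \<open>z\<close> makes the matrix on the left triangular.\<close>

lemma det_others: "det1 m (\<lambda>i l. fps_nth (others m z i) (m - l)) = vandermonde m z"
proof -
  \<comment> \<open>The factorisation holds for every c. With c_k = z_k the entry (i, j) is the
    product of z_i - z_l over l = j + 1..m, which vanishes for j < i.\<close>
  let ?c = "\<lambda>k. z (nat k)"
  have "det1 m (\<lambda>i j. \<Prod>k<m - j. z i - ?c (int m - int k)) = (\<Prod>i\<in>{1..m}. \<Prod>k<m - i. z i - ?c (int m - int k))"
  proof (rule det1_upper_triangular)
    fix i j assume ij: "i \<in> {1..m}" "j \<in> {1..m}" "j < i"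
    then have "m - i \<in> {..<m - j}" "z i - ?c (int m - int (m - i)) = 0"
      by (auto simp: of_nat_diff)
    then show "(\<Prod>k<m - j. z i - ?c (int m - int k)) = 0"
      by (intro prod_zero) blast+
  qed
  also have "\<dots> = (\<Prod>i\<in>{1..m}. \<Prod>j | j \<in> {1..m} \<and> i < j. z i - z j)"
  proof (rule prod.cong[OF refl])
    fix i assume "i \<in> {1..m}"
    then show "(\<Prod>k<m - i. z i - ?c (int m - int k)) = (\<Prod>j | j \<in> {1..m} \<and> i < j. z i - z j)"
      by (intro prod.reindex_bij_witness[of _ "\<lambda>j. m - j" "\<lambda>k. m - k"])
         (auto simp: nat_diff_distrib')
  qed
  also have "\<dots> = (\<Prod>j\<in>{1..m}. \<Prod>i | i \<in> {1..m} \<and> i < j. z i - z j)"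
    by (rule prod.swap_restrict) auto
  also have "\<dots> = vandermonde m z"
    unfolding vandermonde_def by (intro prod.cong refl) auto
  finally have "vandermonde m z = det1 m (\<lambda>i l. fps_nth (others m z i) (m - l))
     * det1 m (\<lambda>i l. tau ?c (int m) (m - i) (fps_X ^ (m - l) * kern ?c m z))"
    by (subst (asm) det_factorial_powers_aux) simp
  \<comment> \<open>For the exponents m - i the power X^(m - l) exceeds the reach of
    \<open>tau\<close> below the diagonal, and on the diagonal only the constant term 1 of the
    kernel remains.\<close>
  also have "det1 m (\<lambda>i l. tau ?c (int m) (m - i) (fps_X ^ (m - l) * kern ?c m z)) = 1"
  proof -
    have "fps_nth (kern ?c m z) 0 = 1" by (simp add: kern_def fps_prod_nth_0)
    then show ?thesis
      by (subst det1_upper_triangular) (auto simp: tau_X_power_mult)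
  qed
  finally show ?thesis by simp
qed

theorem det_factorial_powers:
  "det1 m (\<lambda>i j. \<Prod>k<r j. z i - c (int m - int k))
     = vandermonde m z * det1 m (\<lambda>i l. tau c (int m) (r i) (fps_X ^ (m - l) * kern c m z))"
  by (simp add: det_factorial_powers_aux det_others)

text \<open>For c = 0 factorial powers are ordinary powers, and the second determinant is again
  unitriangular.\<close>

lemma vandermonde_det: "det1 m (\<lambda>i j. z i ^ (m - j)) = vandermonde m z"
proof -
  have "det1 m (\<lambda>i j. z i ^ (m - j)) = det1 m (\<lambda>i j. \<Prod>k<m - j. z i - (\<lambda>_. 0) (int m - int k))"
    by simp
  also have "\<dots> = vandermonde m z * det1 m (\<lambda>i l. tau (\<lambda>_. 0) (int m) (m - i) (fps_X ^ (m - l) * kern (\<lambda>_. 0) m z))"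
    by (rule det_factorial_powers)
  also have "det1 m (\<lambda>i l. tau (\<lambda>_. 0) (int m) (m - i) (fps_X ^ (m - l) * kern (\<lambda>_. 0) m z)) = 1"
    by (subst det1_upper_triangular) (auto simp: tau_X_power_mult kern_def fps_prod_nth_0)
  finally show ?thesis by simp
qed

section \<open>Power series in the y-variables\<close>

abbreviation (input) expt :: "(nat \<Rightarrow>\<^sub>0 nat) \<Rightarrow> nat \<Rightarrow> nat" where
  "expt \<equiv> Poly_Mapping.lookup"

lemma mcoeff_Mfps [simp]: "mcoeff (Mfps f) = f"
  by (simp add: Mfps_inverse)

lemma mfps_eqI: "(\<And>\<gamma>. mcoeff f \<gamma> = mcoeff g \<gamma>) \<Longrightarrow> f = g"
  by (simp add: mcoeff_inject[symmetric] fun_eq_iff)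

lemma mcoeff_0 [simp]: "mcoeff 0 \<gamma> = 0" and mcoeff_add [simp]: "mcoeff (f + g) \<gamma> = mcoeff f \<gamma> + mcoeff g \<gamma>"
  and mcoeff_diff [simp]: "mcoeff (f - g) \<gamma> = mcoeff f \<gamma> - mcoeff g \<gamma>"
  and mcoeff_uminus [simp]: "mcoeff (- f) \<gamma> = - mcoeff f \<gamma>"
  and mcoeff_1: "mcoeff 1 \<gamma> = (if \<gamma> = 0 then 1 else 0)"
  by (simp_all add: zero_mfps.rep_eq plus_mfps.rep_eq minus_mfps.rep_eq uminus_mfps.rep_eq one_mfps.rep_eq)

lemma mcoeff_sum: "mcoeff (\<Sum>i\<in>A. f i) \<gamma> = (\<Sum>i\<in>A. mcoeff (f i) \<gamma>)"
  by (induction A rule: infinite_finite_induct) auto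

lemma mcoeff_mult: "mcoeff (f * g) \<gamma> = (\<Sum>(\<alpha>, \<beta>) | \<alpha> + \<beta> = \<gamma>. mcoeff f \<alpha> * mcoeff g \<beta>)"
  by (simp add: times_mfps.rep_eq)

definition ymono :: "(nat \<Rightarrow>\<^sub>0 nat) \<Rightarrow> 'a::comm_ring_1 mfps" where
  "ymono \<alpha> = Mfps (\<lambda>\<gamma>. if \<gamma> = \<alpha> then 1 else 0)"

lemma mcoeff_mono_mult_add: "mcoeff (ymono \<alpha> * f) (\<alpha> + \<beta>) = mcoeff f \<beta>"
proof -
  have "mcoeff (ymono \<alpha> * f) (\<alpha> + \<beta>) = (\<Sum>(\<alpha>', \<beta>')\<in>{(\<alpha>, \<beta>)}. mcoeff (ymono \<alpha>) \<alpha>' * mcoeff f \<beta>')"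
    unfolding mcoeff_mult
    by (rule sum.mono_neutral_right) (auto simp: ymono_def finite_splits split: if_splits)
  then show ?thesis by (simp add: ymono_def)
qed

lemma mcoeff_mono_mult_0: "(\<And>\<beta>. \<gamma> \<noteq> \<alpha> + \<beta>) \<Longrightarrow> mcoeff (ymono \<alpha> * f) \<gamma> = 0"
  unfolding mcoeff_mult by (rule sum.neutral) (auto simp: ymono_def)

lemma ymono_0 [simp]: "ymono 0 = 1"
  by (rule mfps_eqI) (simp add: ymono_def mcoeff_1)

lemma ymono_add: "ymono (\<alpha> + \<beta>) = ymono \<alpha> * ymono \<beta>"
proof (rule mfps_eqI)
  fix \<gamma>
  show "mcoeff (ymono (\<alpha> + \<beta>)) \<gamma> = (mcoeff (ymono \<alpha> * ymono \<beta>) \<gamma> :: 'a)"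
  proof (cases "\<exists>\<delta>. \<gamma> = \<alpha> + \<delta>")
    case True
    then show ?thesis by (auto simp: mcoeff_mono_mult_add) (auto simp: ymono_def)
  next
    case False
    then have "mcoeff (ymono \<alpha> * ymono \<beta>) \<gamma> = (0 :: 'a)" by (intro mcoeff_mono_mult_0) auto
    then show ?thesis using False by (auto simp: ymono_def)
  qed
qed

lemma ymono_sum: "ymono (\<Sum>i\<in>A. f i) = (\<Prod>i\<in>A. ymono (f i))"
  by (induction A rule: infinite_finite_induct) (auto simp: ymono_add)

lemma yvar_mono: "yvar i = ymono (Poly_Mapping.single i 1)"
  by (simp add: yvar_def ymono_def)

lemma yvar_power_mono: "yvar i ^ k = ymono (Poly_Mapping.single i k)"
proof (induction k)
  case (Suc k)
  have "Poly_Mapping.single i (Suc k) = Poly_Mapping.single i 1 + Poly_Mapping.single i k"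
    by (simp flip: single_add)
  then show ?case by (simp only: power_Suc Suc ymono_add) (simp only: yvar_mono)
qed simp

lemma mcoeff_mono_single_mult:
  "mcoeff (ymono (Poly_Mapping.single i k) * f) \<gamma>
     = (if k \<le> expt \<gamma> i then mcoeff f (\<gamma> - Poly_Mapping.single i k) else 0)"
proof (cases "k \<le> expt \<gamma> i")
  case True
  then have "\<gamma> = Poly_Mapping.single i k + (\<gamma> - Poly_Mapping.single i k)"
    by (intro poly_mapping_eqI) (auto simp: lookup_add lookup_minus lookup_single when_def)
  then show ?thesis using True by (metis mcoeff_mono_mult_add)
next
  case False
  then have "\<gamma> \<noteq> Poly_Mapping.single i k + \<beta>" for \<beta>
    by (auto simp: lookup_add)
  then show ?thesis using False by (simp add: mcoeff_mono_mult_0)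
qed

text \<open>Comparing coefficients equates the coefficient of f at a monomial with the one where a
  factor y_j has been traded for y_i, and gives 0 when y_j does not occur; so the exponent of y_j
  can be run down to 0.\<close>

lemma yvar_diff_cancel:
  assumes "(yvar i - yvar j) * f = 0" "i \<noteq> j"
  shows "f = 0"
proof (rule mfps_eqI)
  fix \<gamma>
  show "mcoeff f \<gamma> = mcoeff 0 \<gamma>"
  proof (induction "expt \<gamma> j" arbitrary: \<gamma> rule: less_induct)
    case less
    let ?\<delta> = "Poly_Mapping.single i 1 + \<gamma>"
    have "mcoeff (ymono (Poly_Mapping.single i 1) * f) ?\<delta> = mcoeff (ymono (Poly_Mapping.single j 1) * f) ?\<delta>"
      using assms(1) by (simp only: left_diff_distrib right_minus_eq yvar_mono)
    then have "mcoeff f \<gamma> = (if 1 \<le> expt \<gamma> j then mcoeff f (?\<delta> - Poly_Mapping.single j 1) else 0)"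
      using assms(2) by (simp add: mcoeff_mono_mult_add mcoeff_mono_single_mult lookup_add lookup_single)
    also have "\<dots> = 0"
      using less[of "?\<delta> - Poly_Mapping.single j 1"] assms(2)
      by (auto simp: lookup_minus lookup_add lookup_single)
    finally show ?case by simp
  qed
qed

lemma vandermonde_yvar_cancel:
  assumes "vandermonde n yvar * f = 0" shows "f = 0"
proof -
  have aux: "(\<Prod>i\<in>A. yvar i - yvar j) * g = 0 \<Longrightarrow> g = 0" if "j \<notin> A" for A j g
    using that
  proof (induction A arbitrary: g rule: infinite_finite_induct)
    case (insert i A)
    then have "(yvar i - yvar j) * ((\<Prod>i\<in>A. yvar i - yvar j) * g) = 0"
      by (simp add: mult.assoc)
    then show ?case using insert yvar_diff_cancel[of i j] by (metis insertCI)
  qed auto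
  have "(\<Prod>j\<in>B. \<Prod>i\<in>{1..<j}. yvar i - yvar j) * g = 0 \<Longrightarrow> g = 0" for B g
  proof (induction B arbitrary: g rule: infinite_finite_induct)
    case (insert j B)
    then have "(\<Prod>i\<in>{1..<j}. yvar i - yvar j) * ((\<Prod>j\<in>B. \<Prod>i\<in>{1..<j}. yvar i - yvar j) * g) = 0"
      by (simp add: mult.assoc)
    then have "(\<Prod>j\<in>B. \<Prod>i\<in>{1..<j}. yvar i - yvar j) * g = 0" by (rule aux[rotated]) simp
    then show ?case by (rule insert.IH)
  qed auto
  then show ?thesis using assms unfolding vandermonde_def by blast
qed

lemma quotI:
  assumes "p = q * r" "\<And>f. q * f = 0 \<Longrightarrow> f = 0"
  shows "quot p q = r"
  unfolding quot_def
proof (rule the_equality)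
  show "r * q = p" using assms by (simp add: mult.commute)
  fix r' assume "r' * q = p"
  then have "q * (r' - r) = 0" using assms(1) by (simp add: algebra_simps)
  then show "r' = r" using assms(2) by fastforce
qed

lemma quot_unit: assumes "q * u = 1" shows "quot p q = p * u"
proof (rule quotI)
  show "p = q * (p * u)" using assms by (metis mult.left_commute mult_1_right)
  fix f assume "q * f = 0"
  then have "q * u * f = 0" by (simp add: mult.assoc mult.left_commute[of q])
  then show "f = 0" using assms by simp
qed

section \<open>Series in a single variable\<close>

definition yev :: "nat \<Rightarrow> coef fps \<Rightarrow> yser" where
  "yev i F = Mfps (\<lambda>\<gamma>. if Poly_Mapping.keys \<gamma> \<subseteq> {i} then fps_nth F (expt \<gamma> i) else 0)"

lemma keys_add_nat: "Poly_Mapping.keys (\<alpha> + \<beta>) = Poly_Mapping.keys \<alpha> \<union> Poly_Mapping.keys (\<beta> :: nat \<Rightarrow>\<^sub>0 nat)"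
  by (auto simp: in_keys_iff lookup_add)

lemma keys_subset_singleton: "Poly_Mapping.keys \<gamma> \<subseteq> {i} \<longleftrightarrow> (\<exists>k. \<gamma> = Poly_Mapping.single i k)"
proof
  assume "Poly_Mapping.keys \<gamma> \<subseteq> {i}"
  then have "\<gamma> = Poly_Mapping.single i (Poly_Mapping.lookup \<gamma> i)"
    by (intro poly_mapping_eqI) (auto simp: lookup_single when_def in_keys_iff)
  then show "\<exists>k. \<gamma> = Poly_Mapping.single i k" ..
qed (auto split: if_splits)

lemma keys_subset_singleton_0: "Poly_Mapping.keys \<gamma> \<subseteq> {i} \<Longrightarrow> expt \<gamma> i = 0 \<longleftrightarrow> \<gamma> = 0"
  by (auto simp: keys_subset_singleton)

lemma mcoeff_yev_mult:
  assumes "\<And>\<gamma>. mcoeff G \<gamma> \<noteq> 0 \<Longrightarrow> i \<notin> Poly_Mapping.keys \<gamma>"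
  shows "mcoeff (yev i F * G) \<gamma> = fps_nth F (expt \<gamma> i) * mcoeff G (\<gamma> - Poly_Mapping.single i (expt \<gamma> i))"
proof -
  let ?\<alpha> = "Poly_Mapping.single i (expt \<gamma> i)"
  have split: "?\<alpha> + (\<gamma> - ?\<alpha>) = \<gamma>"
    by (intro poly_mapping_eqI) (auto simp: lookup_add lookup_minus lookup_single when_def)
  have "mcoeff (yev i F * G) \<gamma> = (\<Sum>(\<alpha>, \<beta>)\<in>{(?\<alpha>, \<gamma> - ?\<alpha>)}. mcoeff (yev i F) \<alpha> * mcoeff G \<beta>)"
    unfolding mcoeff_mult
  proof (rule sum.mono_neutral_right)
    show "\<forall>x\<in>{(\<alpha>, \<beta>). \<alpha> + \<beta> = \<gamma>} - {(?\<alpha>, \<gamma> - ?\<alpha>)}.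
        (case x of (\<alpha>, \<beta>) \<Rightarrow> mcoeff (yev i F) \<alpha> * mcoeff G \<beta>) = 0"
    proof (clarify, rule ccontr)
      fix \<alpha> \<beta>
      assume neq: "\<not> (\<alpha> = Poly_Mapping.single i (expt (\<alpha> + \<beta>) i) \<and>
           \<beta> = \<alpha> + \<beta> - Poly_Mapping.single i (expt (\<alpha> + \<beta>) i))" and nz: "mcoeff (yev i F) \<alpha> * mcoeff G \<beta> \<noteq> 0"
      then have "Poly_Mapping.keys \<alpha> \<subseteq> {i}" "i \<notin> Poly_Mapping.keys \<beta>"
        using assms[of \<beta>] by (auto simp: yev_def split: if_splits)
      then have "\<alpha> = Poly_Mapping.single i (expt (\<alpha> + \<beta>) i)"
        by (auto simp: keys_subset_singleton lookup_add in_keys_iff)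
      then show False using neq by (metis add_diff_cancel_left')
    qed
  qed (use split in \<open>auto simp: finite_splits\<close>)
  then show ?thesis by (simp add: yev_def lookup_single)
qed

lemma mcoeff_prod_yev:
  assumes "finite I"
  shows "mcoeff (\<Prod>i\<in>I. yev i (F i)) \<gamma>
     = (if Poly_Mapping.keys \<gamma> \<subseteq> I then \<Prod>i\<in>I. fps_nth (F i) (expt \<gamma> i) else 0)"
  using assms
proof (induction I arbitrary: \<gamma>)
  case empty
  then show ?case by (auto simp: mcoeff_1)
next
  case (insert i I)
  let ?\<beta> = "\<gamma> - Poly_Mapping.single i (expt \<gamma> i)"
  have \<beta>: "expt ?\<beta> k = (if k = i then 0 else expt \<gamma> k)" for k
    by (simp add: lookup_minus lookup_single)
  have keys: "Poly_Mapping.keys ?\<beta> \<subseteq> I \<longleftrightarrow> Poly_Mapping.keys \<gamma> \<subseteq> insert i I"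
    using insert(2) by (auto simp: in_keys_iff \<beta> subset_iff)
  have "mcoeff (yev i (F i) * (\<Prod>i\<in>I. yev i (F i))) \<gamma>
      = fps_nth (F i) (expt \<gamma> i) * mcoeff (\<Prod>i\<in>I. yev i (F i)) ?\<beta>"
    using insert(2) by (intro mcoeff_yev_mult) (auto simp: insert.IH split: if_splits)
  also have "\<dots> = (if Poly_Mapping.keys \<gamma> \<subseteq> insert i I then \<Prod>i\<in>insert i I. fps_nth (F i) (expt \<gamma> i) else 0)"
    unfolding insert.IH keys using insert(1,2) by (auto simp: \<beta> intro!: prod.cong)
  finally show ?case using insert(1,2) by simp
qed

lemma yev_hom: "comm_ring_hom (yev i)"
proof
  show "yev i 0 = 0" "yev i 1 = 1"
    by (auto intro!: mfps_eqI simp: yev_def mcoeff_1 keys_subset_singleton_0)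
  fix F G
  show "yev i (F + G) = yev i F + yev i G"
    by (auto intro!: mfps_eqI simp: yev_def)
  show "yev i (F * G) = yev i F * yev i G"
  proof (rule mfps_eqI)
    fix \<gamma>
    show "mcoeff (yev i (F * G)) \<gamma> = mcoeff (yev i F * yev i G) \<gamma>"
    proof (cases "Poly_Mapping.keys \<gamma> \<subseteq> {i}")
      case True
      then obtain k where \<gamma>: "\<gamma> = Poly_Mapping.single i k" by (auto simp: keys_subset_singleton)
      have S: "\<exists>j\<le>k. \<alpha> = Poly_Mapping.single i j \<and> \<beta> = Poly_Mapping.single i (k - j)"
        if "\<alpha> + \<beta> = \<gamma>" for \<alpha> \<beta>
      proof -
        have "Poly_Mapping.keys \<alpha> \<subseteq> {i}" "Poly_Mapping.keys \<beta> \<subseteq> {i}"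
          using that True keys_add_nat[of \<alpha> \<beta>] by auto
        then obtain j l where jl: "\<alpha> = Poly_Mapping.single i j" "\<beta> = Poly_Mapping.single i l"
          by (auto simp: keys_subset_singleton)
        then have "j + l = k" using that by (metis \<gamma> lookup_single_eq single_add)
        then show ?thesis using jl by (intro exI[of _ j]) auto
      qed
      have "mcoeff (yev i F * yev i G) \<gamma> = (\<Sum>j\<in>{0..k}. fps_nth F j * fps_nth G (k - j))"
        unfolding mcoeff_mult
      proof (rule sum.reindex_bij_witness[of _ "\<lambda>j. (Poly_Mapping.single i j, Poly_Mapping.single i (k - j))" "\<lambda>(\<alpha>, \<beta>). expt \<alpha> i"])
        fix x assume "x \<in> {(\<alpha>, \<beta>). \<alpha> + \<beta> = \<gamma>}"
        then obtain j where "j \<le> k" "x = (Poly_Mapping.single i j, Poly_Mapping.single i (k - j))"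
          using S by blast
        then show "(Poly_Mapping.single i ((\<lambda>(\<alpha>, \<beta>). expt \<alpha> i) x), Poly_Mapping.single i (k - (\<lambda>(\<alpha>, \<beta>). expt \<alpha> i) x)) = x"
          "(\<lambda>(\<alpha>, \<beta>). expt \<alpha> i) x \<in> {0..k}"
          "fps_nth F ((\<lambda>(\<alpha>, \<beta>). expt \<alpha> i) x) * fps_nth G (k - (\<lambda>(\<alpha>, \<beta>). expt \<alpha> i) x)
            = (case x of (\<alpha>, \<beta>) \<Rightarrow> mcoeff (yev i F) \<alpha> * mcoeff (yev i G) \<beta>)"
          by (auto simp: yev_def)
      qed (auto simp: \<gamma> simp flip: single_add)
      then show ?thesis using True by (simp add: yev_def fps_mult_nth \<gamma>)
    next
      case False
      have "mcoeff (yev i F * yev i G) \<gamma> = 0"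
        unfolding mcoeff_mult
      proof (rule sum.neutral, clarify)
        fix \<alpha> \<beta> assume "\<gamma> = \<alpha> + \<beta>"
        then have "\<not> (Poly_Mapping.keys \<alpha> \<subseteq> {i} \<and> Poly_Mapping.keys \<beta> \<subseteq> {i})"
          using False keys_add_nat[of \<alpha> \<beta>] by auto
        then show "mcoeff (yev i F) \<alpha> * mcoeff (yev i G) \<beta> = 0" by (auto simp: yev_def)
      qed
      then show ?thesis using False by (simp add: yev_def)
    qed
  qed
qed

lemma yev_X: "yev i fps_X = yvar i"
  by (rule mfps_eqI) (auto simp: yev_def yvar_def fps_X_nth keys_subset_singleton)

lemma yev_const: "yev i (fps_const c) = yconst c"
  by (rule mfps_eqI) (auto simp: yev_def yconst_def keys_subset_singleton_0)

lemma yev_lin: "yev i (lin c) = 1 - yconst c * yvar i"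
proof -
  interpret y: comm_ring_hom "yev i" by (rule yev_hom)
  show ?thesis by (simp add: lin_def y.hom_minus y.hom_mult yev_X yev_const)
qed

lemma quot_yvar_power:
  "quot (yvar i ^ r) (\<Prod>k\<in>A. 1 - yconst (c k) * yvar i) = yev i (fps_X ^ r * (\<Prod>k\<in>A. geo (c k)))"
proof -
  interpret y: comm_ring_hom "yev i" by (rule yev_hom)
  have "(\<Prod>k\<in>A. 1 - yconst (c k) * yvar i) * yev i (\<Prod>k\<in>A. geo (c k)) = yev i (\<Prod>k\<in>A. lin (c k) * geo (c k))"
    by (simp add: prod.distrib y.hom_mult y.hom_prod yev_lin)
  then show ?thesis by (simp add: lin_geo quot_unit y.hom_mult y.hom_power yev_X)
qed

lemma mdeg_superset: "finite A \<Longrightarrow> Poly_Mapping.keys \<gamma> \<subseteq> A \<Longrightarrow> mdeg \<gamma> = (\<Sum>i\<in>A. expt \<gamma> i)"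
  unfolding mdeg_def by (rule sum.mono_neutral_left) (auto simp: in_keys_iff)

lemma mdeg_add: "mdeg (\<alpha> + \<beta>) = mdeg \<alpha> + mdeg \<beta>"
proof -
  let ?A = "Poly_Mapping.keys \<alpha> \<union> Poly_Mapping.keys \<beta>"
  show ?thesis
    by (simp add: mdeg_superset[of ?A] keys_add_nat lookup_add sum.distrib)
qed

lemma mdeg_single [simp]: "mdeg (Poly_Mapping.single i k) = k"
  by (simp add: mdeg_def)

section \<open>Divisibility of alternants by the Vandermonde product\<close>

text \<open>With \<open>q = \<Sum>\<^sub>k q\<^sub>k X\<^sup>k\<close> this is \<open>\<Sum>\<^sub>k q\<^sub>k h\<^bsub>k - l\<^esub>\<close>, where \<open>h\<close> denotes the complete symmetric
  polynomials in the variables indexed by \<open>I\<close>.\<close>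

definition wser :: "nat set \<Rightarrow> coef fps \<Rightarrow> nat \<Rightarrow> yser" where
  "wser I q l = Mfps (\<lambda>\<gamma>. if Poly_Mapping.keys \<gamma> \<subseteq> I then fps_nth q (mdeg \<gamma> + l) else 0)"

lemma mcoeff_wser:
  "mcoeff (wser I q l) \<gamma> = (if Poly_Mapping.keys \<gamma> \<subseteq> I then fps_nth q (mdeg \<gamma> + l) else 0)"
  by (simp add: wser_def)

lemma yev_wser: "yev i q = wser {i} q 0"
  by (rule mfps_eqI) (simp add: yev_def wser_def mdeg_superset[of "{i}"])

text \<open>Weighted by the coefficients of q, this is h_k(I) = h_k(I, j) - y_j h_{k-1}(I, j), which
  says that adding the variable y_j divides the generating series by 1 - y_j X.\<close>

lemma wser_insert:
  assumes "j \<notin> I"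
  shows "wser I q l = wser (insert j I) q l - yvar j * wser (insert j I) q (Suc l)"
proof (rule mfps_eqI)
  fix \<gamma> :: "nat \<Rightarrow>\<^sub>0 nat"
  let ?\<beta> = "\<gamma> - Poly_Mapping.single j 1"
  have shift: "mcoeff (yvar j * wser (insert j I) q (Suc l)) \<gamma>
      = (if 1 \<le> expt \<gamma> j then mcoeff (wser (insert j I) q (Suc l)) ?\<beta> else 0)"
    unfolding yvar_mono by (rule mcoeff_mono_single_mult)
  show "mcoeff (wser I q l) \<gamma> = mcoeff (wser (insert j I) q l - yvar j * wser (insert j I) q (Suc l)) \<gamma>"
  proof (cases "1 \<le> expt \<gamma> j")
    case True
    have \<gamma>: "\<gamma> = Poly_Mapping.single j 1 + ?\<beta>"
      using True by (intro poly_mapping_eqI) (auto simp: lookup_add lookup_minus lookup_single when_def)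
    have "mdeg \<gamma> = Suc (mdeg ?\<beta>)"
      using arg_cong[OF \<gamma>, of mdeg] by (simp add: mdeg_add)
    moreover have "Poly_Mapping.keys \<gamma> = insert j (Poly_Mapping.keys ?\<beta>)"
      using arg_cong[OF \<gamma>, of Poly_Mapping.keys] by (simp add: keys_add_nat)
    ultimately show ?thesis using True assms by (auto simp: shift mcoeff_wser)
  next
    case False
    then have "j \<notin> Poly_Mapping.keys \<gamma>" by (simp add: in_keys_iff)
    then show ?thesis using False by (auto simp: shift mcoeff_wser subset_insert)
  qed
qed

text \<open>Iterating \<open>wser_insert\<close> over J collects the coefficients of the product of
  the 1 - y_k X. For I = {i} it writes q(y_i) through complete symmetric polynomials in all the
  variables.\<close>

lemma wser_expand:
  assumes "finite J" "I \<inter> J = {}" "card J \<le> N"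
  shows "wser I q l = (\<Sum>s\<le>N. fps_nth (\<Prod>k\<in>J. lin (yvar k)) s * wser (I \<union> J) q (l + s))"
  using assms
proof (induction J)
  case empty
  then show ?case by (subst sum.remove[of _ 0]) (auto intro!: sum.neutral)
next
  case (insert j J)
  let ?E = "\<Prod>k\<in>J. lin (yvar k)" and ?U = "wser (I \<union> insert j J) q"
  obtain N' where N: "N = Suc N'" using insert by (cases N) auto
  have E: "fps_nth ?E N = 0" using insert by (intro prod_lin_nth_eq_0) auto
  have "wser I q l = (\<Sum>s\<le>N. fps_nth ?E s * wser (I \<union> J) q (l + s))"
    using insert by auto
  also have "\<dots> = (\<Sum>s\<le>N. fps_nth ?E s * ?U (l + s)) - (\<Sum>s\<le>N. yvar j * fps_nth ?E s * ?U (Suc (l + s)))"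
    using insert by (subst wser_insert[of j]) (auto simp: algebra_simps sum_subtractf)
  also have "(\<Sum>s\<le>N. yvar j * fps_nth ?E s * ?U (Suc (l + s))) = (\<Sum>s\<le>N'. yvar j * fps_nth ?E s * ?U (Suc (l + s)))"
    using E by (simp add: N)
  also have "(\<Sum>s\<le>N. fps_nth ?E s * ?U (l + s)) - \<dots> = (\<Sum>s\<le>N. fps_nth (lin (yvar j) * ?E) s * ?U (l + s))"
    unfolding N sum.atMost_Suc_shift
    by (simp add: lin_def left_diff_distrib mult.assoc sum_subtractf algebra_simps)
  finally show ?case using insert by simp
qed

text \<open>\<open>wser_expand\<close> factors the alternant as the matrix of \<open>others\<close>,
  whose determinant is the Vandermonde product, times a matrix in which the row variable y_i no
  longer occurs. The cofactor is thereby symmetric entry by entry.\<close>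

lemma det_yev:
  "det1 n (\<lambda>i j. yev i (Q j)) = vandermonde n yvar * det1 n (\<lambda>l j. wser {1..n} (Q j) (n - l))"
proof -
  have "det1 n (\<lambda>i l. fps_nth (others n yvar i) (n - l)) * det1 n (\<lambda>l j. wser {1..n} (Q j) (n - l))
      = det1 n (\<lambda>i j. yev i (Q j))"
    unfolding det1_mult
  proof (rule det1_cong)
    fix i j assume i: "i \<in> {1..n}"
    then have U: "insert i {Suc 0..n} = {Suc 0..n}" by auto
    have "yev i (Q j) = (\<Sum>s\<le>n-1. fps_nth (others n yvar i) s * wser {1..n} (Q j) s)"
      using i by (simp add: yev_wser wser_expand[of "{1..n} - {i}" "{i}" "n-1"] U others_def)
    also have "\<dots> = (\<Sum>s<n. fps_nth (others n yvar i) s * wser {1..n} (Q j) s)"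
      using i by (intro sum.cong) auto
    finally show "(\<Sum>k\<in>{1..n}. fps_nth (others n yvar i) (n - k) * wser {1..n} (Q j) (n - k)) = yev i (Q j)"
      by (simp add: sum_reverse_upto)
  qed
  then show ?thesis by (simp add: det_others)
qed

section \<open>Symmetric power series\<close>

definition symser :: "nat \<Rightarrow> yser \<Rightarrow> bool" where
  "symser n F \<longleftrightarrow> (\<forall>\<gamma>. \<not> Poly_Mapping.keys \<gamma> \<subseteq> {1..n} \<longrightarrow> mcoeff F \<gamma> = 0) \<and>
     (\<forall>\<pi> \<gamma>. \<pi> permutes {1..n} \<longrightarrow> mcoeff F (Poly_Mapping.map_key \<pi> \<gamma>) = mcoeff F \<gamma>)"

lemma lookup_map_key: "inj \<pi> \<Longrightarrow> Poly_Mapping.lookup (Poly_Mapping.map_key \<pi> \<gamma>) k = Poly_Mapping.lookup \<gamma> (\<pi> k)"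
  by (simp add: map_key.rep_eq)

lemma symser_0: "symser n 0" and symser_add: "symser n F \<Longrightarrow> symser n G \<Longrightarrow> symser n (F + G)"
  and symser_uminus: "symser n F \<Longrightarrow> symser n (- F)"
  by (simp_all add: symser_def)

lemma map_key_inv:
  assumes "\<pi> permutes A"
  shows "Poly_Mapping.map_key (inv_into UNIV \<pi>) (Poly_Mapping.map_key \<pi> \<gamma>) = \<gamma>"
    "Poly_Mapping.map_key \<pi> (Poly_Mapping.map_key (inv_into UNIV \<pi>) \<gamma>) = \<gamma>"
proof -
  have "inj \<pi>" "inj (inv_into UNIV \<pi>)"
    using assms permutes_inv[OF assms] by (auto simp: permutes_inj)
  then show "Poly_Mapping.map_key (inv_into UNIV \<pi>) (Poly_Mapping.map_key \<pi> \<gamma>) = \<gamma>"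
    "Poly_Mapping.map_key \<pi> (Poly_Mapping.map_key (inv_into UNIV \<pi>) \<gamma>) = \<gamma>"
    by (intro poly_mapping_eqI; simp add: lookup_map_key permutes_inverses[OF assms])+
qed

lemma symser_1: "symser n 1"
proof -
  have "Poly_Mapping.map_key \<pi> \<gamma> = 0 \<longleftrightarrow> \<gamma> = 0" if "\<pi> permutes {1..n}" for \<pi> and \<gamma> :: "nat \<Rightarrow>\<^sub>0 nat"
    using map_key_inv(1)[OF that, of \<gamma>] that permutes_inv[OF that]
    by (metis map_key_zero permutes_inj)
  then show ?thesis by (simp add: symser_def mcoeff_1)
qed

lemma symser_mult: assumes "symser n F" "symser n G" shows "symser n (F * G)"
  unfolding symser_def
proof (intro conjI allI impI)
  fix \<gamma> :: "nat \<Rightarrow>\<^sub>0 nat" assume \<gamma>: "\<not> Poly_Mapping.keys \<gamma> \<subseteq> {1..n}"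
  have "mcoeff F \<alpha> * mcoeff G \<beta> = 0" if "\<alpha> + \<beta> = \<gamma>" for \<alpha> \<beta>
  proof -
    have "\<not> Poly_Mapping.keys \<alpha> \<subseteq> {1..n} \<or> \<not> Poly_Mapping.keys \<beta> \<subseteq> {1..n}"
      using \<gamma> that keys_add_nat[of \<alpha> \<beta>] by auto
    then show ?thesis using assms by (auto simp: symser_def)
  qed
  then show "mcoeff (F * G) \<gamma> = 0"
    unfolding mcoeff_mult by (intro sum.neutral) auto
next
  fix \<pi> and \<gamma> :: "nat \<Rightarrow>\<^sub>0 nat" assume \<pi>: "\<pi> permutes {1..n}"
  have inj: "inj \<pi>" "inj (inv_into UNIV \<pi>)"
    using \<pi> permutes_inv[OF \<pi>] by (auto simp: permutes_inj)
  let ?m = "Poly_Mapping.map_key \<pi>" and ?m' = "Poly_Mapping.map_key (inv_into UNIV \<pi>)"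
  have eq: "mcoeff F (?m \<alpha>) = mcoeff F \<alpha>" "mcoeff G (?m \<alpha>) = mcoeff G \<alpha>" for \<alpha>
    using assms \<pi> by (auto simp: symser_def)
  show "mcoeff (F * G) (?m \<gamma>) = mcoeff (F * G) \<gamma>"
    unfolding mcoeff_mult
  proof (rule sum.reindex_bij_witness[of _ "\<lambda>(\<alpha>, \<beta>). (?m \<alpha>, ?m \<beta>)" "\<lambda>(\<alpha>, \<beta>). (?m' \<alpha>, ?m' \<beta>)"], goal_cases)
    case (5 a)
    then show ?case using eq map_key_inv(2)[OF \<pi>] by (metis (no_types, lifting) case_prod_conv surj_pair)
  qed (auto simp: map_key_inv[OF \<pi>] map_key_plus[OF inj(1), symmetric] map_key_plus[OF inj(2), symmetric])
qed

lemma symser_sum: "(\<And>i. i \<in> A \<Longrightarrow> symser n (F i)) \<Longrightarrow> symser n (\<Sum>i\<in>A. F i)"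
  by (induction A rule: infinite_finite_induct) (auto simp: symser_0 symser_add)

lemma symser_prod: "(\<And>i. i \<in> A \<Longrightarrow> symser n (F i)) \<Longrightarrow> symser n (\<Prod>i\<in>A. F i)"
  by (induction A rule: infinite_finite_induct) (auto simp: symser_1 symser_mult)

lemma symser_det1: assumes "\<And>i j. symser n (A i j)" shows "symser n (det1 m A)"
proof -
  have sg: "symser n (signof p * F)" if "symser n F" for p :: "nat \<Rightarrow> nat" and F
    using that by (simp add: sign_def symser_uminus)
  then show ?thesis
    unfolding det1_leibniz by (intro symser_sum sg symser_prod assms)
qed

lemma keys_map_key_subset:
  assumes "\<pi> permutes A" shows "Poly_Mapping.keys (Poly_Mapping.map_key \<pi> \<gamma>) \<subseteq> A \<longleftrightarrow> Poly_Mapping.keys \<gamma> \<subseteq> A"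
proof -
  have inj: "inj \<pi>" using assms by (rule permutes_inj)
  have "\<pi> x \<in> A \<longleftrightarrow> x \<in> A" for x by (rule permutes_in_image) fact
  moreover have "\<exists>y. \<pi> y = x" for x using permutes_surj[OF assms] by (metis surjD)
  ultimately show ?thesis
    unfolding keys_map_key[OF inj] subset_iff vimage_eq by metis
qed

lemma symser_wser: "symser n (wser {1..n} q l)"
proof -
  have "mdeg (Poly_Mapping.map_key \<pi> \<gamma>) = mdeg \<gamma>"
    if \<pi>: "\<pi> permutes {1..n}" and \<gamma>: "Poly_Mapping.keys \<gamma> \<subseteq> {1..n}" for \<pi> \<gamma>
  proof -
    have "mdeg (Poly_Mapping.map_key \<pi> \<gamma>) = (\<Sum>i\<in>{1..n}. expt \<gamma> (\<pi> i))"
      using keys_map_key_subset[OF \<pi>] \<gamma> permutes_inj[OF \<pi>]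
      by (subst mdeg_superset[of "{1..n}"]) (auto simp: lookup_map_key)
    also have "\<dots> = (\<Sum>i\<in>{1..n}. expt \<gamma> i)"
      using sum.permute[OF \<pi>, of "expt \<gamma>"] by (simp add: o_def)
    finally show ?thesis using \<gamma> by (simp add: mdeg_superset[of "{1..n}"])
  qed
  then show ?thesis
    by (auto simp: symser_def wser_def keys_map_key_subset)
qed

section \<open>Shapes of monomials\<close>

definition shape :: "(nat \<Rightarrow>\<^sub>0 nat) \<Rightarrow> partition" where
  "shape \<gamma> = (\<Sum>i\<in>Poly_Mapping.keys \<gamma>. row (expt \<gamma> i))"

lemma shape_superset: "finite A \<Longrightarrow> Poly_Mapping.keys \<gamma> \<subseteq> A \<Longrightarrow> shape \<gamma> = (\<Sum>i\<in>A. row (expt \<gamma> i))"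
  unfolding shape_def by (rule sum.mono_neutral_left) (auto simp: in_keys_iff)

lemma pm_shape: "pm (shape \<gamma>) = image_mset (expt \<gamma>) (mset_set (Poly_Mapping.keys \<gamma>))"
proof -
  have "filter_mset (\<lambda>k. k \<noteq> 0) (image_mset (expt \<gamma>) (mset_set (Poly_Mapping.keys \<gamma>)))
     = image_mset (expt \<gamma>) (mset_set (Poly_Mapping.keys \<gamma>))"
    unfolding filter_mset_image_mset
    by (intro arg_cong[of _ _ "image_mset (expt \<gamma>)"] filter_mset_cong[THEN trans, OF refl _ filter_mset_True])
       (auto simp: in_keys_iff)
  then show ?thesis by (simp add: shape_def pm_sum_rows del: neq0_conv)
qed

definition expo :: "nat \<Rightarrow> (nat \<Rightarrow> nat) \<Rightarrow> (nat \<Rightarrow>\<^sub>0 nat)" where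
  "expo n k = (\<Sum>i\<in>{1..n}. Poly_Mapping.single i (k i))"

lemma lookup_expo: "expt (expo n k) i = (if i \<in> {1..n} then k i else 0)"
proof -
  have "expt (expo n k) i = (\<Sum>j\<in>{1..n}. if j = i then k j else 0)"
    by (auto simp: expo_def lookup_sum lookup_single when_def intro!: sum.cong)
  then show ?thesis by simp
qed

lemma keys_expo: "Poly_Mapping.keys (expo n k) \<subseteq> {1..n}"
  by (auto simp: in_keys_iff lookup_expo split: if_splits)

lemma shape_expo: "shape (expo n k) = (\<Sum>i\<in>{1..n}. row (k i))"
  by (subst shape_superset[OF _ keys_expo]) (auto simp: lookup_expo)

lemma len_shape: "Poly_Mapping.keys \<gamma> \<subseteq> {1..n} \<Longrightarrow> len (shape \<gamma>) \<le> n"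
proof -
  assume "Poly_Mapping.keys \<gamma> \<subseteq> {1..n}"
  then have "card (Poly_Mapping.keys \<gamma>) \<le> n" using card_mono[of "{1..n}"] by fastforce
  then show ?thesis by (simp add: len_pm pm_shape)
qed

lemma wt_shape: "wt (shape \<gamma>) = mdeg \<gamma>"
  by (simp add: shape_def wt_sum mdeg_def)

text \<open>Equal multisets of nonzero exponents become equal multisets over {1..n} after padding
  with the same number of zeros, so the two monomials differ by a permutation of the
  variables.\<close>

lemma symser_shape:
  assumes "symser n F" "Poly_Mapping.keys \<alpha> \<subseteq> {1..n}" "Poly_Mapping.keys \<beta> \<subseteq> {1..n}" "shape \<alpha> = shape \<beta>"
  shows "mcoeff F \<alpha> = mcoeff F \<beta>"
proof -
  let ?I = "\<lambda>\<gamma>. image_mset (expt \<gamma>) (mset_set {1..n})"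
  have eq: "?I \<gamma> = pm (shape \<gamma>) + replicate_mset (n - size (pm (shape \<gamma>))) 0"
    if "Poly_Mapping.keys \<gamma> \<subseteq> {1..n}" for \<gamma>
  proof -
    let ?K = "Poly_Mapping.keys \<gamma>"
    have "mset_set {1..n} = mset_set ?K + mset_set ({1..n} - ?K)"
      using that by (subst mset_set_Union[symmetric]) (auto intro!: arg_cong[of _ _ mset_set])
    moreover have "image_mset (expt \<gamma>) (mset_set ({1..n} - ?K)) = replicate_mset (card ({1..n} - ?K)) 0"
    proof -
      have "image_mset (expt \<gamma>) (mset_set ({1..n} - ?K)) = image_mset (\<lambda>_. 0) (mset_set ({1..n} - ?K))"
        by (intro image_mset_cong) (auto simp: in_keys_iff)
      then show ?thesis by (simp add: image_mset_const_eq)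
    qed
    moreover have "card ({1..n} - ?K) = n - size (pm (shape \<gamma>))"
      using that by (simp add: card_Diff_subset pm_shape)
    ultimately show ?thesis by (simp add: pm_shape)
  qed
  have "?I \<alpha> = ?I \<beta>"
    unfolding eq[OF assms(2)] eq[OF assms(3)] assms(4) ..
  then obtain p where p: "p permutes {1..n}" "\<forall>x\<in>{1..n}. expt \<alpha> x = expt \<beta> (p x)"
    by (rule image_mset_eq_implies_permutes[rotated]) auto
  have "\<alpha> = Poly_Mapping.map_key p \<beta>"
  proof (rule poly_mapping_eqI)
    fix x
    show "expt \<alpha> x = expt (Poly_Mapping.map_key p \<beta>) x"
    proof (cases "x \<in> {1..n}")
      case False
      then have "p x = x" using p(1) by (simp add: permutes_not_in)
      moreover have "x \<notin> Poly_Mapping.keys \<alpha>" "x \<notin> Poly_Mapping.keys \<beta>"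
        using False assms(2,3) by blast+
      ultimately show ?thesis using permutes_inj[OF p(1)]
        by (simp add: lookup_map_key in_keys_iff)
    qed (use p permutes_inj[OF p(1)] in \<open>auto simp: lookup_map_key\<close>)
  qed
  then show ?thesis using assms(1) p(1) by (simp add: symser_def)
qed

text \<open>A stable family of symmetric series is recorded by its coefficients, indexed by the
  shapes of the monomials.\<close>

definition repr :: "(nat \<Rightarrow> yser) \<Rightarrow> (partition \<Rightarrow> coef) \<Rightarrow> bool" where
  "repr F f \<longleftrightarrow> (\<forall>n \<gamma>. mcoeff (F n) \<gamma> = (if Poly_Mapping.keys \<gamma> \<subseteq> {1..n} then f (shape \<gamma>) else 0))"

lemma repr_unique: assumes "repr F f" "repr F g" shows "f = g"
proof
  fix lam
  let ?\<gamma> = "expo (len lam) (part lam)"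
  have "shape ?\<gamma> = lam" by (simp add: shape_expo sum_row_part_Suc)
  then show "f lam = g lam"
    using assms keys_expo[of "len lam" "part lam"] unfolding repr_def by metis
qed

lemma repr_exists:
  assumes sym: "\<And>n. symser n (F n)"
    and stable: "\<And>n \<gamma>. Poly_Mapping.keys \<gamma> \<subseteq> {1..n} \<Longrightarrow> mcoeff (F (Suc n)) \<gamma> = mcoeff (F n) \<gamma>"
  shows "\<exists>f. repr F f"
proof -
  define f where "f lam = mcoeff (F (len lam)) (expo (len lam) (part lam))" for lam
  have "mcoeff (F n) \<gamma> = f (shape \<gamma>)" if \<gamma>: "Poly_Mapping.keys \<gamma> \<subseteq> {1..n}" for n \<gamma>
  proof -
    let ?l = "len (shape \<gamma>)"
    let ?\<alpha> = "expo ?l (part (shape \<gamma>))"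
    have "?l \<le> n" using \<gamma> by (rule len_shape)
    then have keys: "Poly_Mapping.keys ?\<alpha> \<subseteq> {1..n}" using keys_expo[of ?l] by fastforce
    have "mcoeff (F n) \<gamma> = mcoeff (F n) ?\<alpha>"
      by (rule symser_shape[OF sym \<gamma> keys]) (simp add: shape_expo sum_row_part_Suc)
    also have "mcoeff (F n) ?\<alpha> = mcoeff (F ?l) ?\<alpha>"
      using \<open>?l \<le> n\<close>
    proof (induction n rule: dec_induct)
      case (step m)
      have "Poly_Mapping.keys ?\<alpha> \<subseteq> {1..m}" using keys_expo[of ?l] step(1) by fastforce
      then show ?case using stable step by metis
    qed simp
    finally show ?thesis by (simp add: f_def)
  qed
  moreover have "mcoeff (F n) \<gamma> = 0" if "\<not> Poly_Mapping.keys \<gamma> \<subseteq> {1..n}" for n \<gamma>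
    using sym that by (auto simp: symser_def)
  ultimately show ?thesis unfolding repr_def by auto
qed

section \<open>The algebra of complete symmetric functions\<close>

text \<open>The polynomial ring \<open>\<rat>[a][H\<^sub>1, H\<^sub>2, \<dots>]\<close>: the basis element of a partition is the product
  of the \<open>H\<^sub>k\<close> over its parts. An element acts on the coefficient functions of symmetric series
  as the operator adjoint to multiplication.\<close>

type_synonym alg = "partition \<Rightarrow>\<^sub>0 coef"

definition aconst :: "coef \<Rightarrow> alg" where "aconst = Poly_Mapping.single 0"
definition Hgen :: "nat \<Rightarrow> alg" where "Hgen k = Poly_Mapping.single (row k) 1"
definition Hser :: "alg fps" where "Hser = Abs_fps Hgen"

lemma Hgen_0 [simp]: "Hgen 0 = 1" by (simp add: Hgen_def)

lemma Hser_nth [simp]: "fps_nth Hser k = Hgen k" by (simp add: Hser_def)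

lemma aconst_hom: "comm_ring_hom aconst"
  unfolding aconst_def by (rule single_hom)

definition act :: "alg \<Rightarrow> (partition \<Rightarrow> coef) \<Rightarrow> partition \<Rightarrow> coef" where
  "act b f nu = (\<Sum>lam\<in>Poly_Mapping.keys b. Poly_Mapping.lookup b lam * f (lam + nu))"

abbreviation pair :: "alg \<Rightarrow> (partition \<Rightarrow> coef) \<Rightarrow> coef" where
  "pair b f \<equiv> act b f 0"

lemma act_superset:
  "finite A \<Longrightarrow> Poly_Mapping.keys b \<subseteq> A \<Longrightarrow> act b f nu = (\<Sum>lam\<in>A. Poly_Mapping.lookup b lam * f (lam + nu))"
  unfolding act_def by (rule sum.mono_neutral_left) (auto simp: in_keys_iff)

lemma act_0 [simp]: "act 0 f nu = 0"
  by (simp add: act_def)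

lemma act_add: "act (b + c) f nu = act b f nu + act c f nu"
proof -
  let ?A = "Poly_Mapping.keys b \<union> Poly_Mapping.keys c"
  have "Poly_Mapping.keys (b + c) \<subseteq> ?A" by (rule keys_add)
  then show ?thesis
    by (simp add: act_superset[of ?A] lookup_add distrib_right sum.distrib)
qed

lemma act_uminus: "act (- b) f nu = - act b f nu"
  using act_add[of b "- b" f nu] by (simp add: eq_neg_iff_add_eq_0 add.commute)

lemma act_diff: "act (b - c) f nu = act b f nu - act c f nu"
  using act_add[of b "- c" f nu] by (simp add: act_uminus)

lemma act_sum: "act (\<Sum>i\<in>A. b i) f nu = (\<Sum>i\<in>A. act (b i) f nu)"
  by (induction A rule: infinite_finite_induct) (auto simp: act_add)

lemma act_single: "act (Poly_Mapping.single lam c) f nu = c * f (lam + nu)"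
  by (subst act_superset[of "{lam}"]) auto

lemma act_single_mult: "act (Poly_Mapping.single lam c * b) f nu = c * act b f (lam + nu)"
  by (induction b rule: poly_mapping_add_induct)
     (simp_all add: mult_single act_single distrib_left act_add add_ac mult.assoc)

text \<open>Products act by composition. This is the reason for an operator on coefficient functions
  where the pairing itself is only its value at the empty partition: the factors of
  \<open>Pprod\<close> can be peeled off one at a time.\<close>

lemma act_mult: "act (b * c) f nu = act b (act c f) nu"
  by (induction b rule: poly_mapping_add_induct)
     (simp_all add: act_single_mult act_single distrib_right act_add)

lemma act_aconst_mult: "act (aconst c * b) f nu = c * act b f nu"
  by (simp add: aconst_def act_single_mult)

lemma act_1 [simp]: "act 1 f nu = f nu"
  using act_single[of 0 1 f nu] by simp

lemma act_Hgen: "act (Hgen k) f nu = f (row k + nu)"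
  by (simp add: Hgen_def act_single)

lemma act_of_nat: "act (of_nat k) f nu = of_nat k * f nu"
  by (induction k) (simp_all add: distrib_right act_add)

lemma act_fun_add: "act b (\<lambda>nu. f nu + g nu) nu = act b f nu + act b g nu"
  by (simp add: act_def distrib_left sum.distrib)

lemma act_fun_scale: "act b (\<lambda>nu. c * f nu) nu = c * act b f nu"
  by (simp add: act_def sum_distrib_left mult_ac)

text \<open>A filtration and not a grading: coefficients in the a_i have weight 0, and
  \<open>tau\<close> mixes all weights up to r.\<close>

definition wle :: "nat \<Rightarrow> alg \<Rightarrow> bool" where
  "wle d b \<longleftrightarrow> (\<forall>lam\<in>Poly_Mapping.keys b. wt lam \<le> d)"

lemma wle_0 [simp]: "wle d 0" by (simp add: wle_def)

lemma wle_mono: "wle d b \<Longrightarrow> d \<le> e \<Longrightarrow> wle e b" by (auto simp: wle_def)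

lemma wle_add: "wle d b \<Longrightarrow> wle d c \<Longrightarrow> wle d (b + c)"
  unfolding wle_def using keys_add[of b c] by blast

lemma wle_uminus: "wle d b \<Longrightarrow> wle d (- b)"
  by (simp add: wle_def in_keys_iff)

lemma wle_mult: "wle d b \<Longrightarrow> wle e c \<Longrightarrow> wle (d + e) (b * c)"
proof -
  assume *: "wle d b" "wle e c"
  show ?thesis unfolding wle_def
  proof
    fix lam assume "lam \<in> Poly_Mapping.keys (b * c)"
    then obtain x y where "lam = x + y" "x \<in> Poly_Mapping.keys b" "y \<in> Poly_Mapping.keys c"
      using keys_mult[of b c] by blast
    then show "wt lam \<le> d + e" using * by (auto simp: wle_def intro: add_mono)
  qed
qed

lemma wle_1 [simp]: "wle d 1" by (simp add: wle_def)

lemma wle_aconst [simp]: "wle d (aconst c)" by (simp add: wle_def aconst_def)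

lemma wle_Hgen: "wle k (Hgen k)" by (simp add: wle_def Hgen_def)

lemma wle_sum: "(\<And>i. i \<in> A \<Longrightarrow> wle d (b i)) \<Longrightarrow> wle d (\<Sum>i\<in>A. b i)"
  by (induction A rule: infinite_finite_induct) (auto intro: wle_add)

lemma wle_prod: "(\<And>i. i \<in> A \<Longrightarrow> wle (d i) (b i)) \<Longrightarrow> wle (\<Sum>i\<in>A. d i) (\<Prod>i\<in>A. b i)"
  by (induction A rule: infinite_finite_induct) (auto intro: wle_mult)

section \<open>Dual families\<close>

text \<open>From AC = 1 the determinant of C inverts that of A, and the adjugate gives det A (CA) =
  adj(A) A C A = det A. It turns duality into an expansion formula.\<close>

lemma square_inverse:
  fixes A C :: "'i \<Rightarrow> 'i \<Rightarrow> 'a::comm_ring_1"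
  assumes "finite I" and AC: "\<And>i j. i \<in> I \<Longrightarrow> j \<in> I \<Longrightarrow> (\<Sum>k\<in>I. A i k * C k j) = (if i = j then 1 else 0)"
    and "i \<in> I" "j \<in> I"
  shows "(\<Sum>k\<in>I. C i k * A k j) = (if i = j then 1 else 0)"
proof -
  define n where "n = card I"
  obtain e where e: "bij_betw e {0..<n} I"
    using ex_bij_betw_nat_finite[OF \<open>finite I\<close>] unfolding n_def by blast
  have eI: "e k \<in> I" if "k < n" for k using e that by (auto simp: bij_betw_def)
  have e_eq: "e k = e l \<longleftrightarrow> k = l" if "k < n" "l < n" for k l
    using e that by (auto simp: bij_betw_def inj_on_def)
  have sum_e: "(\<Sum>k\<in>I. f k) = (\<Sum>k\<in>{0..<n}. f (e k))" for f :: "'i \<Rightarrow> 'a"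
    by (rule sum.reindex_bij_betw[OF e, symmetric])
  define MA where "MA = mat n n (\<lambda>(k, l). A (e k) (e l))"
  define MC where "MC = mat n n (\<lambda>(k, l). C (e k) (e l))"
  have carr [simp]: "MA \<in> carrier_mat n n" "MC \<in> carrier_mat n n"
    by (simp_all add: MA_def MC_def)
  have dims [simp]: "dim_row MC = n" "dim_col MA = n"
    by (simp_all add: MA_def MC_def)
  note adj = adj_mat[OF carr(1)]
  have 1: "MA * MC = 1\<^sub>m n"
    by (intro eq_matI) (auto simp: MA_def MC_def scalar_prod_def AC[OF eI eI, unfolded sum_e] e_eq)
  then have det: "det MC * det MA = 1"
    using det_mult[OF carr] by (simp add: mult.commute)
  have [simp]: "MC * MA \<in> carrier_mat n n" by (rule mult_carrier_mat[of _ n n]) auto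
  have "det MA \<cdot>\<^sub>m (MC * MA) = (det MA \<cdot>\<^sub>m 1\<^sub>m n) * (MC * MA)"
    by (subst mult_smult_assoc_mat[of "1\<^sub>m n" n n "MC * MA" n]) (simp_all add: left_mult_one_mat[of _ n n])
  also have "\<dots> = adj_mat MA * MA * (MC * MA)" by (simp add: adj)
  also have "\<dots> = adj_mat MA * (MA * (MC * MA))"
    by (rule assoc_mult_mat[of _ n n _ n _ n]) (simp_all add: adj)
  also have "MA * (MC * MA) = MA * MC * MA"
    by (rule assoc_mult_mat[of _ n n _ n _ n, symmetric]) simp_all
  also have "adj_mat MA * (MA * MC * MA) = det MA \<cdot>\<^sub>m 1\<^sub>m n"
    using adj by (simp add: 1 left_mult_one_mat[of _ n n])
  finally have *: "det MA \<cdot>\<^sub>m (MC * MA) = det MA \<cdot>\<^sub>m 1\<^sub>m n" .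
  have CA: "MC * MA = 1\<^sub>m n"
  proof (rule eq_matI)
    fix k l assume kl: "k < dim_row (1\<^sub>m n :: 'a mat)" "l < dim_col (1\<^sub>m n :: 'a mat)"
    let ?x = "(MC * MA) $$ (k, l)" and ?y = "(1\<^sub>m n :: 'a mat) $$ (k, l)"
    have "det MA * ?x = det MA * ?y"
      using kl arg_cong[OF *, of "\<lambda>M. M $$ (k, l)"] by simp
    then have "det MC * det MA * ?x = det MC * det MA * ?y" by (simp only: mult.assoc)
    then show "?x = ?y" by (simp only: det mult_1_left)
  qed auto
  obtain k l where kl: "k < n" "l < n" "i = e k" "j = e l"
    using e assms(3,4) by (auto simp: bij_betw_def)
  have "(\<Sum>k\<in>I. C i k * A k j) = (MC * MA) $$ (k, l)"
    using kl by (simp add: sum_e MA_def MC_def scalar_prod_def)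
  then show ?thesis using kl by (simp add: CA e_eq)
qed

text \<open>Triangularity is assumed of B alone: up to any weight d, the coefficients of the B and
  the values of the g then form square matrices of the same size. The locale is used for dual Schur
  functions, ordinary Schur functions (c = 0) and dual monomial functions.\<close>

locale dual_family =
  fixes B :: "partition \<Rightarrow> alg" and g :: "partition \<Rightarrow> partition \<Rightarrow> coef"
  assumes wle_B: "wle (wt lam) (B lam)"
    and dual: "pair (B lam) (g mu) = (if lam = mu then 1 else 0)"
begin

lemma pair_B:
  assumes "wt lam \<le> d"
  shows "pair (B lam) f = (\<Sum>nu | wt nu \<le> d. Poly_Mapping.lookup (B lam) nu * f nu)"
  using wle_B[of lam] assms
  by (subst act_superset[OF finite_wt_le[of d]]) (auto simp: wle_def)

lemma dual': 
  assumes "wt nu \<le> d" "wt nu' \<le> d"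
  shows "(\<Sum>lam | wt lam \<le> d. g lam nu * Poly_Mapping.lookup (B lam) nu') = (if nu = nu' then 1 else 0)"
proof (rule square_inverse[OF finite_wt_le[of d], where A = "\<lambda>lam nu. Poly_Mapping.lookup (B lam) nu" and C = "\<lambda>nu lam. g lam nu"])
  fix i j assume "i \<in> {lam. wt lam \<le> d}"
  then show "(\<Sum>nu | wt nu \<le> d. Poly_Mapping.lookup (B i) nu * g j nu) = (if i = j then 1 else 0)"
    using dual[of i j] pair_B[of i d "g j"] by simp
qed (use assms in auto)

lemma expand_upto:
  assumes "wt nu \<le> d" shows "f nu = (\<Sum>lam | wt lam \<le> d. pair (B lam) f * g lam nu)"
proof -
  have "(\<Sum>lam | wt lam \<le> d. pair (B lam) f * g lam nu)
      = (\<Sum>lam | wt lam \<le> d. \<Sum>nu' | wt nu' \<le> d. g lam nu * Poly_Mapping.lookup (B lam) nu' * f nu')"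
    by (intro sum.cong) (auto simp: pair_B[of _ d] sum_distrib_left sum_distrib_right mult_ac)
  also have "\<dots> = (\<Sum>nu' | wt nu' \<le> d. (\<Sum>lam | wt lam \<le> d. g lam nu * Poly_Mapping.lookup (B lam) nu') * f nu')"
    by (subst sum.swap) (simp add: sum_distrib_right)
  also have "\<dots> = (\<Sum>nu' | wt nu' \<le> d. if nu' = nu then f nu' else 0)"
    by (intro sum.cong refl) (use assms in \<open>auto simp: dual'\<close>)
  also have "\<dots> = f nu" using assms finite_wt_le[of d] by simp
  finally show ?thesis by simp
qed

text \<open>Expanding \<open>g lam\<close> in the family itself, only members of weight below that
  of lam could contribute at nu, and their functionals vanish on \<open>g lam\<close>. So
  \<open>g lam\<close> starts in degree \<open>wt lam\<close> and infinite sums of the g make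
  sense.\<close>

lemma locality: assumes "wt nu < wt lam" shows "g lam nu = 0"
proof -
  have "g lam nu = (\<Sum>mu | wt mu \<le> wt nu. pair (B mu) (g lam) * g mu nu)"
    by (rule expand_upto) simp
  also have "\<dots> = 0"
    by (rule sum.neutral) (use assms in \<open>auto simp: dual\<close>)
  finally show ?thesis .
qed

lemma expand_alg:
  assumes "wle d b"
  shows "b = (\<Sum>lam | wt lam \<le> d. aconst (pair b (g lam)) * B lam)"
proof (rule poly_mapping_eqI)
  fix nu
  have pb: "pair b f = (\<Sum>nu | wt nu \<le> d. Poly_Mapping.lookup b nu * f nu)" for f
    using assms by (subst act_superset[OF finite_wt_le[of d]]) (auto simp: wle_def)
  have lk: "Poly_Mapping.lookup (aconst c * B') nu = c * Poly_Mapping.lookup B' nu" for c B'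
  proof -
    have "pair b (\<lambda>mu. if mu = nu then 1 else 0) = Poly_Mapping.lookup b nu" for b
      by (subst act_superset[of "insert nu (Poly_Mapping.keys b)"]) (auto simp: if_distrib sum.delta cong: if_cong)
    from this[of "aconst c * B'"] this[of B'] show ?thesis by (simp add: act_aconst_mult)
  qed
  have "Poly_Mapping.lookup (\<Sum>lam | wt lam \<le> d. aconst (pair b (g lam)) * B lam) nu
     = (\<Sum>lam | wt lam \<le> d. \<Sum>nu' | wt nu' \<le> d. Poly_Mapping.lookup b nu' * (g lam nu' * Poly_Mapping.lookup (B lam) nu))"
    by (simp add: lookup_sum lk pb sum_distrib_right mult.assoc)
  also have "\<dots> = (\<Sum>nu' | wt nu' \<le> d. Poly_Mapping.lookup b nu' * (\<Sum>lam | wt lam \<le> d. g lam nu' * Poly_Mapping.lookup (B lam) nu))"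
    by (subst sum.swap) (simp add: sum_distrib_left)
  also have "\<dots> = Poly_Mapping.lookup b nu"
  proof (cases "wt nu \<le> d")
    case True
    then have "(\<Sum>nu' | wt nu' \<le> d. Poly_Mapping.lookup b nu' * (\<Sum>lam | wt lam \<le> d. g lam nu' * Poly_Mapping.lookup (B lam) nu))
      = (\<Sum>nu' | wt nu' \<le> d. if nu' = nu then Poly_Mapping.lookup b nu' else 0)"
      by (intro sum.cong refl) (auto simp: dual')
    then show ?thesis using True finite_wt_le[of d] by simp
  next
    case False
    have "Poly_Mapping.lookup (B lam) nu = 0" if "wt lam \<le> d" for lam
    proof -
      have "nu \<notin> Poly_Mapping.keys (B lam)"
        using wle_B[of lam] that False unfolding wle_def by (auto dest!: bspec)
      then show ?thesis by (simp add: in_keys_iff)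
    qed
    moreover have "Poly_Mapping.lookup b nu = 0"
      using assms False by (auto simp: wle_def in_keys_iff)
    ultimately show ?thesis by simp
  qed
  finally show "Poly_Mapping.lookup b nu = Poly_Mapping.lookup (\<Sum>lam | wt lam \<le> d. aconst (pair b (g lam)) * B lam) nu" ..
qed

end

section \<open>Schur determinants\<close>

definition Sdet :: "(int \<Rightarrow> coef) \<Rightarrow> nat \<Rightarrow> partition \<Rightarrow> alg" where
  "Sdet c n lam = det1 n (\<lambda>i l. tau (\<lambda>k. aconst (c k)) (int n) (part lam i + n - i) (fps_X ^ (n - l) * Hser))"

text \<open>Row n + 1 has exponent 0 and is a unit row; in the other entries the additional factor X
  is absorbed by lowering the index of \<open>tau\<close> from n + 1 to n.\<close>

lemma Sdet_Suc:
  assumes "len lam \<le> n" shows "Sdet c (Suc n) lam = Sdet c n lam"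
proof -
  let ?A = "\<lambda>i l. tau (\<lambda>k. aconst (c k)) (int (Suc n)) (part lam i + Suc n - i) (fps_X ^ (Suc n - l) * Hser)"
  have "det1 (Suc n) ?A = det1 n ?A"
  proof (rule det1_last_row)
    fix j assume "j \<in> {1..n}"
    then show "?A (Suc n) j = 0" using assms by (simp add: Suc_diff_le)
  qed (use assms in simp)
  also have "\<dots> = Sdet c n lam"
    unfolding Sdet_def
  proof (rule det1_cong)
    fix i l assume "i \<in> {1..n}" "l \<in> {1..n}"
    then have "part lam i + Suc n - i = Suc (part lam i + n - i)" "Suc n - l = Suc (n - l)" by auto
    then show "?A i l = tau (\<lambda>k. aconst (c k)) (int n) (part lam i + n - i) (fps_X ^ (n - l) * Hser)"
      by (simp only: power_Suc mult.assoc tau_X_mult) simp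
  qed
  finally show ?thesis by (simp only: Sdet_def)
qed

lemma Sdet_stable: "len lam \<le> n \<Longrightarrow> Sdet c n lam = Sdet c (len lam) lam"
  by (induction n rule: dec_induct) (simp_all add: Sdet_Suc)

lemma tau_aconst_expand:
  "tau (\<lambda>k. aconst (c k)) m r F = (\<Sum>k\<le>r. aconst (tau c m r (fps_X ^ k)) * fps_nth F k)"
proof -
  interpret f: comm_ring_hom "fps_hom aconst" by (rule fps_hom_hom[OF aconst_hom])
  have "aconst (tau c m r (fps_X ^ k)) = tau (\<lambda>k. aconst (c k)) m r (fps_X ^ k)" for k
    by (simp add: tau_hom[OF aconst_hom] f.hom_power fps_hom_lin_geo[OF aconst_hom])
  then show ?thesis by (subst tau_expand) simp
qed

lemma wle_tau_Hser: "wle r (tau (\<lambda>k. aconst (c k)) n r Hser)"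
  unfolding tau_aconst_expand
  using wle_mult[OF wle_aconst[of 0] wle_mono[OF wle_Hgen]] by (intro wle_sum) auto

lemma sum_shifted_parts:
  "len lam \<le> n \<Longrightarrow> (\<Sum>i\<in>{0..<n}. part lam (Suc i) + n - Suc i) = wt lam + (\<Sum>i\<in>{0..<n}. n - Suc i)"
proof -
  assume len: "len lam \<le> n"
  have "(\<Sum>i\<in>{0..<n}. part lam (Suc i)) = wt lam"
    unfolding wt_part[OF len] by (rule sum.reindex_bij_witness[of _ "\<lambda>k. k - 1" Suc]) auto
  moreover have "(\<Sum>i\<in>{0..<n}. part lam (Suc i) + n - Suc i) = (\<Sum>i\<in>{0..<n}. part lam (Suc i)) + (\<Sum>i\<in>{0..<n}. n - Suc i)"
    unfolding sum.distrib[symmetric] by (intro sum.cong) auto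
  ultimately show ?thesis by simp
qed

text \<open>Entry (i, l) has weight at most r_i - (n - l), with r_i the shifted part, and is 0 if
  this is negative. Along a permutation the shifts cancel and the bounds add up to the weight of
  lam.\<close>

lemma wle_Sdet:
  assumes "len lam \<le> n" shows "wle (wt lam) (Sdet c n lam)"
proof -
  let ?C = "\<lambda>k. aconst (c k)"
  let ?r = "\<lambda>i. part lam i + n - i"
  let ?A = "\<lambda>i l. tau ?C (int n) (?r i) (fps_X ^ (n - l) * Hser)"
  have entry: "wle (?r i - (n - l)) (?A i l)" "n - l > ?r i \<Longrightarrow> ?A i l = 0" for i l
    using wle_tau_Hser by (auto simp: tau_X_power_mult)
  have "wle (wt lam) (\<Prod>i\<in>{0..<n}. ?A (Suc i) (Suc (p i)))" if p: "p permutes {0..<n}" for p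
  proof (cases "\<exists>i\<in>{0..<n}. n - Suc (p i) > ?r (Suc i)")
    case True
    then obtain i where "i \<in> {0..<n}" "?A (Suc i) (Suc (p i)) = 0" using entry(2) by blast
    then have "(\<Prod>i\<in>{0..<n}. ?A (Suc i) (Suc (p i))) = 0" by (intro prod_zero) auto
    then show ?thesis by simp
  next
    case False
    \<comment> \<open>The case distinction rules out truncated subtraction, so the sum of
      differences may be split.\<close>
    then have "(\<Sum>i\<in>{0..<n}. ?r (Suc i) - (n - Suc (p i))) = (\<Sum>i\<in>{0..<n}. ?r (Suc i)) - (\<Sum>i\<in>{0..<n}. n - Suc (p i))"
      by (intro sum_subtractf_nat) (auto simp: not_less)
    also have "(\<Sum>i\<in>{0..<n}. n - Suc (p i)) = (\<Sum>i\<in>{0..<n}. n - Suc i)"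
      using sum.permute[OF p, of "\<lambda>i. n - Suc i"] by (simp add: o_def)
    also have "(\<Sum>i\<in>{0..<n}. ?r (Suc i)) = wt lam + (\<Sum>i\<in>{0..<n}. n - Suc i)"
      by (rule sum_shifted_parts) fact
    finally have "(\<Sum>i\<in>{0..<n}. ?r (Suc i) - (n - Suc (p i))) = wt lam" by (simp only: add_diff_cancel_right')
    moreover have "wle (\<Sum>i\<in>{0..<n}. ?r (Suc i) - (n - Suc (p i))) (\<Prod>i\<in>{0..<n}. ?A (Suc i) (Suc (p i)))"
      by (rule wle_prod) (rule entry(1))
    ultimately show ?thesis by simp
  qed
  moreover have "wle d (signof p * b)" if "wle d b" for d p b
    using that by (simp add: sign_def wle_uminus)
  ultimately show ?thesis
    unfolding Sdet_def det1_leibniz by (intro wle_sum) simp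
qed

section \<open>Power sums\<close>

text \<open>Newton's identities between power sums and complete symmetric functions, solved for the
  k-th power sum.\<close>

function Pgen :: "nat \<Rightarrow> alg" where
  "Pgen k = of_nat k * Hgen k - (\<Sum>i\<in>{1..<k}. Pgen i * Hgen (k - i))"
  by auto
termination by (relation "measure id") auto

declare Pgen.simps [simp del]

lemma Newton_Pgen: "(\<Sum>i\<in>{1..k}. Pgen i * Hgen (k - i)) = of_nat k * Hgen k"
proof (cases "k = 0")
  case False
  then have "{1..k} = insert k {1..<k}" by auto
  then show ?thesis by (simp add: Pgen.simps[of k])
qed simp

text \<open>Multiplication by \<open>p\<^sub>j(y)\<close>, in terms of coefficients.\<close>

definition Pop :: "nat \<Rightarrow> (partition \<Rightarrow> coef) \<Rightarrow> partition \<Rightarrow> coef" where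
  "Pop j f lam = (\<Sum>v\<in>#pm lam. if j \<le> v then f (of_pm (pm lam - {#v#}) + row (v - j)) else 0)"

lemma Pop_add: "Pop j (\<lambda>nu. f nu + g nu) nu = Pop j f nu + Pop j g nu"
  unfolding Pop_def sum_mset.distrib[symmetric]
  by (intro arg_cong[of _ _ sum_mset] image_mset_cong) simp

lemma Pop_scale: "Pop j (\<lambda>nu. c * f nu) nu = c * Pop j f nu"
  unfolding Pop_def sum_mset_distrib_left
  by (intro arg_cong[of _ _ sum_mset] image_mset_cong) simp

lemma Pop_sum: "Pop j (\<lambda>nu. \<Sum>i\<in>A. f i nu) nu = (\<Sum>i\<in>A. Pop j (f i) nu)"
proof (induction A rule: infinite_finite_induct)
  case (insert x A)
  then show ?case by (simp add: Pop_add)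
qed (simp_all add: Pop_def)

text \<open>A part of \<open>row r + nu\<close> that is lowered by j is either a part of nu or the
  new part r, which accounts for the second term. For r = 0 there is no new part, and j > 0 makes
  that term vanish.\<close>

lemma Pop_row:
  assumes "j > 0"
  shows "Pop j f (row r + nu) = Pop j (\<lambda>nu. f (row r + nu)) nu + (if j \<le> r then f (row (r - j) + nu) else 0)"
proof (cases "r = 0")
  case False
  have eq: "(\<Sum>v\<in>#pm nu. if j \<le> v then f (of_pm (add_mset r (pm nu) - {#v#}) + row (v - j)) else 0)
      = (\<Sum>v\<in>#pm nu. if j \<le> v then f (row r + (of_pm (pm nu - {#v#}) + row (v - j))) else 0)"
  proof (intro arg_cong[of _ _ sum_mset] image_mset_cong)
    fix v assume v: "v \<in># pm nu"
    have "of_pm (add_mset r (pm nu) - {#v#}) = row r + of_pm (pm nu - {#v#})"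
      using False v by (simp add: pm_inject[symmetric] filter_diff_mset)
    then show "(if j \<le> v then f (of_pm (add_mset r (pm nu) - {#v#}) + row (v - j)) else 0)
      = (if j \<le> v then f (row r + (of_pm (pm nu - {#v#}) + row (v - j))) else 0)" by (simp add: add.assoc)
  qed
  have pm: "pm (row r + nu) = add_mset r (pm nu)" using False by simp
  show ?thesis unfolding Pop_def pm by (simp add: eq add.commute[of nu])
qed (use assms in simp)

text \<open>The Heisenberg relation: P_k commutes with multiplication by p_j up to k when j = k.
  Pushing \<open>Pop j\<close> through Newton's recursion, the term k H_k leaves k H_{k-j}; for j <
  k this cancels against j H_{k-j}, from the induction hypothesis at i = j, and (k - j) H_{k-j}, to
  which the terms of \<open>Pop_row\<close> collapse by Newton's identity.\<close>

lemma act_Pgen_Pop: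
  assumes "j > 0" "k > 0"
  shows "act (Pgen k) (Pop j f) nu = Pop j (act (Pgen k) f) nu + (if k = j then of_nat k * f nu else 0)"
  using assms(2)
proof (induction k arbitrary: f nu rule: less_induct)
  case (less k)
  let ?h = "\<lambda>r f nu. f (row r + nu)"
  have act_P: "act (Pgen k) F = (\<lambda>nu. of_nat k * ?h k F nu + (\<Sum>i\<in>{1..<k}. - 1 * act (Pgen i) (?h (k - i) F) nu))" for F
    by (rule ext, subst Pgen.simps)
       (simp add: act_diff act_sum act_of_nat act_mult sum_negf act_Hgen[abs_def])
  have trm: "act (Pgen i) (?h (k - i) (Pop j f)) nu
      = Pop j (act (Pgen i) (?h (k - i) f)) nu + (if i = j then of_nat j * f (row (k - i) + nu) else 0)
        + (if i + j \<le> k then act (Pgen i) (?h (k - j - i) f) nu else 0)" if "i \<in> {1..<k}" for i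
  proof -
    have arith: "k - i - j = k - j - i" "j \<le> k - i \<longleftrightarrow> i + j \<le> k"
      using that by auto
    have h: "?h (k - i) (Pop j f) = (\<lambda>nu. Pop j (?h (k - i) f) nu + (if i + j \<le> k then f (row (k - j - i) + nu) else 0))"
      by (rule ext, subst Pop_row[OF assms(1)]) (simp only: arith)
    have IH: "act (Pgen i) (Pop j (?h (k - i) f)) nu
        = Pop j (act (Pgen i) (?h (k - i) f)) nu + (if i = j then of_nat i * f (row (k - i) + nu) else 0)"
      using that by (intro less.IH) auto
    have zero: "act (Pgen i) (\<lambda>nu. 0) nu = 0" by (simp add: act_def)
    show ?thesis
      unfolding h act_fun_add IH by (cases "i + j \<le> k") (simp_all only: zero if_True if_False simp_thms if_cancel cong: if_cong)
  qed
  have s1: "(\<Sum>i\<in>{1..<k}. if i = j then of_nat j * f (row (k - i) + nu) else 0) = (if j < k then of_nat j * f (row (k - j) + nu) else 0)"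
    using assms(1) by (simp add: sum.delta)
  have s2: "(\<Sum>i\<in>{1..<k}. if i + j \<le> k then act (Pgen i) (?h (k - j - i) f) nu else 0)
      = (if j < k then of_nat (k - j) * f (row (k - j) + nu) else 0)"
  proof -
    have "(\<Sum>i\<in>{1..<k}. if i + j \<le> k then act (Pgen i) (?h (k - j - i) f) nu else 0)
      = (\<Sum>i\<in>{1..k - j}. act (Pgen i) (?h (k - j - i) f) nu)"
      using assms(1) by (intro sum.mono_neutral_cong_right) auto
    also have "\<dots> = act (\<Sum>i\<in>{1..k - j}. Pgen i * Hgen (k - j - i)) f nu"
      by (simp add: act_sum act_mult act_Hgen[abs_def])
    also have "\<dots> = of_nat (k - j) * f (row (k - j) + nu)"
      by (simp only: Newton_Pgen act_mult act_of_nat act_Hgen)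
    finally show ?thesis by simp
  qed
  have "act (Pgen k) (Pop j f) nu = of_nat k * Pop j f (row k + nu) - (\<Sum>i\<in>{1..<k}. act (Pgen i) (?h (k - i) (Pop j f)) nu)"
    by (simp only: act_P mult_minus1 sum_negf add_uminus_conv_diff)
  also have "(\<Sum>i\<in>{1..<k}. act (Pgen i) (?h (k - i) (Pop j f)) nu)
     = (\<Sum>i\<in>{1..<k}. Pop j (act (Pgen i) (?h (k - i) f)) nu)
      + (if j < k then of_nat j * f (row (k - j) + nu) else 0)
      + (if j < k then of_nat (k - j) * f (row (k - j) + nu) else 0)"
    unfolding s1[symmetric] s2[symmetric] sum.distrib[symmetric] by (rule sum.cong) (simp_all add: trm)
  also have "Pop j f (row k + nu) = Pop j (?h k f) nu + (if j \<le> k then f (row (k - j) + nu) else 0)"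
    by (rule Pop_row) fact
  finally have "act (Pgen k) (Pop j f) nu = of_nat k * Pop j (?h k f) nu
      - (\<Sum>i\<in>{1..<k}. Pop j (act (Pgen i) (?h (k - i) f)) nu) + (if k = j then of_nat k * f nu else 0)"
    using assms(1) by (cases k j rule: linorder_cases) (simp_all add: algebra_simps of_nat_diff)
  also have "of_nat k * Pop j (?h k f) nu - (\<Sum>i\<in>{1..<k}. Pop j (act (Pgen i) (?h (k - i) f)) nu) = Pop j (act (Pgen k) f) nu"
    by (simp only: act_P Pop_add Pop_scale Pop_sum) (simp only: mult_minus1 sum_negf add_uminus_conv_diff)
  finally show ?case .
qed

section \<open>Coefficient extraction in several variables\<close>

text \<open>\<open>tau\<close> in each of the n variables at once: the coefficient of the product of
  the r_i-th twisted monomials in the y_i. By \<open>tau_expand\<close> the box of exponents bounded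
  by the r_i suffices.\<close>

definition extr :: "(int \<Rightarrow> coef) \<Rightarrow> int \<Rightarrow> nat \<Rightarrow> (nat \<Rightarrow> nat) \<Rightarrow> yser \<Rightarrow> coef" where
  "extr c m n r F = (\<Sum>\<kappa>\<in>PiE {1..n} (\<lambda>i. {..r i}).
     (\<Prod>i\<in>{1..n}. tau c m (r i) (fps_X ^ \<kappa> i)) * mcoeff F (expo n \<kappa>))"

lemma extr_0 [simp]: "extr c m n r 0 = 0"
  by (simp add: extr_def)

lemma extr_add: "extr c m n r (F + G) = extr c m n r F + extr c m n r G"
  by (simp add: extr_def distrib_left sum.distrib)

lemma extr_uminus: "extr c m n r (- F) = - extr c m n r F"
  by (simp add: extr_def sum_negf)

lemma extr_sum: "extr c m n r (\<Sum>i\<in>A. F i) = (\<Sum>i\<in>A. extr c m n r (F i))"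
  by (induction A rule: infinite_finite_induct) (auto simp: extr_add)

lemma extr_signof: "extr c m n r (signof p * F) = signof p * extr c m n r F"
  by (simp add: sign_def extr_uminus)

lemma act_signof: "act (signof p * b) f nu = signof p * act b f nu"
  by (simp add: sign_def act_uminus)

lemma extr_prod: "extr c m n r (\<Prod>i\<in>{1..n}. yev i (G i)) = (\<Prod>i\<in>{1..n}. tau c m (r i) (G i))"
proof -
  have "(\<Prod>i\<in>{1..n}. tau c m (r i) (G i)) = (\<Prod>i\<in>{1..n}. \<Sum>k\<le>r i. tau c m (r i) (fps_X ^ k) * fps_nth (G i) k)"
    by (intro prod.cong refl) (rule tau_expand)
  also have "\<dots> = (\<Sum>\<kappa>\<in>PiE {1..n} (\<lambda>i. {..r i}). \<Prod>i\<in>{1..n}. tau c m (r i) (fps_X ^ \<kappa> i) * fps_nth (G i) (\<kappa> i))"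
    by (rule prod_sum_PiE) auto
  also have "\<dots> = extr c m n r (\<Prod>i\<in>{1..n}. yev i (G i))"
    unfolding extr_def
    by (intro sum.cong refl, subst mcoeff_prod_yev) (use keys_expo in \<open>auto simp: prod.distrib lookup_expo\<close>)
  finally show ?thesis ..
qed

lemma prod_Suc_shift: "(\<Prod>i\<in>{0..<n}. f (Suc i)) = (\<Prod>i\<in>{1..n}. f i)"
  by (rule prod.reindex_bij_witness[of _ "\<lambda>k. k - 1" Suc]) auto

lemma extr_det:
  "extr c m n r (det1 n (\<lambda>i j. yev i (G j))) = det1 n (\<lambda>i j. tau c m (r i) (G j))"
proof -
  have *: "extr c m n r (\<Prod>i\<in>{0..<n}. yev (Suc i) (G (Suc (p i)))) = (\<Prod>i\<in>{0..<n}. tau c m (r (Suc i)) (G (Suc (p i))))" for p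
    using extr_prod[of c m n r "\<lambda>i. G (Suc (p (i - 1)))"]
      prod_Suc_shift[of "\<lambda>i. yev i (G (Suc (p (i - 1))))" n]
      prod_Suc_shift[of "\<lambda>i. tau c m (r i) (G (Suc (p (i - 1))))" n] by simp
  show ?thesis
    by (simp only: det1_leibniz extr_sum extr_signof *)
qed

lemma prod_yvar_power: "(\<Prod>i\<in>{1..n}. yvar i ^ s i) = ymono (expo n s)"
  by (simp add: expo_def ymono_sum yvar_power_mono)

lemma mcoeff_expo_mult:
  "mcoeff (ymono (expo n s) * F) (expo n \<kappa>)
     = (if \<forall>i\<in>{1..n}. s i \<le> \<kappa> i then mcoeff F (expo n (\<lambda>i. \<kappa> i - s i)) else 0)"
proof (cases "\<forall>i\<in>{1..n}. s i \<le> \<kappa> i")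
  case True
  then have "expo n \<kappa> = expo n s + expo n (\<lambda>i. \<kappa> i - s i)"
    by (intro poly_mapping_eqI) (auto simp: lookup_add lookup_expo)
  then show ?thesis using True by (simp add: mcoeff_mono_mult_add)
next
  case False
  then obtain i where i: "i \<in> {1..n}" "\<not> s i \<le> \<kappa> i" by blast
  have "expo n \<kappa> \<noteq> expo n s + \<beta>" for \<beta>
  proof
    assume "expo n \<kappa> = expo n s + \<beta>"
    from arg_cong[OF this, of "\<lambda>\<gamma>. expt \<gamma> i"] show False using i by (simp add: lookup_add lookup_expo)
  qed
  then show ?thesis unfolding if_not_P[OF False] by (rule mcoeff_mono_mult_0)
qed

lemma Hser_power_nth: "fps_nth (fps_X ^ s * Hser) k = (if s \<le> k then Hgen (k - s) else 0)"
  by (simp add: fps_X_power_mult_nth)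

lemma prod_Hgen: "(\<Prod>i\<in>A. Hgen (k i)) = Poly_Mapping.single (\<Sum>i\<in>A. row (k i)) 1"
  by (induction A rule: infinite_finite_induct) (auto simp: Hgen_def mult_single)

text \<open>A product of generators H indexed by kappa reads off the coefficient of y^kappa. Hence
  the copy of \<open>Hser\<close> in the i-th factor plays the role of the series in y_i, and a
  power of X beside it becomes a power of y_i multiplying F.\<close>

lemma pair_prod_tau:
  assumes "repr F f"
  shows "pair (\<Prod>i\<in>{1..n}. tau (\<lambda>k. aconst (c k)) m (r i) (fps_X ^ s i * Hser)) f
     = extr c m n r ((\<Prod>i\<in>{1..n}. yvar i ^ s i) * F n)"
proof -
  interpret a: comm_ring_hom aconst by (rule aconst_hom)
  let ?t = "\<lambda>\<kappa>. \<Prod>i\<in>{1..n}. tau c m (r i) (fps_X ^ \<kappa> i)"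
  have "(\<Prod>i\<in>{1..n}. tau (\<lambda>k. aconst (c k)) m (r i) (fps_X ^ s i * Hser))
     = (\<Sum>\<kappa>\<in>PiE {1..n} (\<lambda>i. {..r i}). \<Prod>i\<in>{1..n}. aconst (tau c m (r i) (fps_X ^ \<kappa> i)) * fps_nth (fps_X ^ s i * Hser) (\<kappa> i))"
    unfolding tau_aconst_expand by (rule prod_sum_PiE) auto
  also have "\<dots> = (\<Sum>\<kappa>\<in>PiE {1..n} (\<lambda>i. {..r i}). aconst (?t \<kappa>) * (\<Prod>i\<in>{1..n}. fps_nth (fps_X ^ s i * Hser) (\<kappa> i)))"
    by (simp add: prod.distrib a.hom_prod)
  finally have sum: "pair (\<Prod>i\<in>{1..n}. tau (\<lambda>k. aconst (c k)) m (r i) (fps_X ^ s i * Hser)) f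
     = (\<Sum>\<kappa>\<in>PiE {1..n} (\<lambda>i. {..r i}). ?t \<kappa> * pair (\<Prod>i\<in>{1..n}. fps_nth (fps_X ^ s i * Hser) (\<kappa> i)) f)"
    by (simp add: act_sum act_aconst_mult)
  have eq: "pair (\<Prod>i\<in>{1..n}. fps_nth (fps_X ^ s i * Hser) (\<kappa> i)) f
     = mcoeff (ymono (expo n s) * F n) (expo n \<kappa>)" for \<kappa>
  proof (cases "\<forall>i\<in>{1..n}. s i \<le> \<kappa> i")
    case True
    then have "(\<Prod>i\<in>{1..n}. fps_nth (fps_X ^ s i * Hser) (\<kappa> i)) = (\<Prod>i\<in>{1..n}. Hgen (\<kappa> i - s i))"
      by (intro prod.cong) (auto simp: Hser_power_nth)
    then show ?thesis
      using True assms keys_expo[of n "\<lambda>i. \<kappa> i - s i"]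
      by (simp add: mcoeff_expo_mult prod_Hgen act_single repr_def shape_expo)
  next
    case False
    then have "(\<Prod>i\<in>{1..n}. fps_nth (fps_X ^ s i * Hser) (\<kappa> i)) = 0"
      by (intro prod_zero) (auto simp: Hser_power_nth)
    then show ?thesis unfolding mcoeff_expo_mult if_not_P[OF False] by simp
  qed
  show ?thesis unfolding sum eq by (simp only: extr_def prod_yvar_power)
qed

text \<open>Expanding the determinant, the signed powers of the y_i assemble to the Vandermonde
  product. With c = 0 this is the classical recipe: the Schur coefficient of F at lam is the
  coefficient of y^(lam + rho) in Vandermonde times F, where rho = (n - 1, ..., 0).\<close>

lemma pair_Sdet:
  assumes "repr F f"
  shows "pair (Sdet c n lam) f = extr c (int n) n (\<lambda>i. part lam i + n - i) (vandermonde n yvar * F n)"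
proof -
  let ?r = "\<lambda>i. part lam i + n - i"
  have *: "pair (\<Prod>i\<in>{0..<n}. tau (\<lambda>k. aconst (c k)) (int n) (?r (Suc i)) (fps_X ^ (n - Suc (p i)) * Hser)) f
     = extr c (int n) n ?r ((\<Prod>i\<in>{0..<n}. yvar (Suc i) ^ (n - Suc (p i))) * F n)" for p
    using pair_prod_tau[OF assms, where n = n and c = c and m = "int n" and r = ?r and s = "\<lambda>i. n - Suc (p (i - 1))"]
      prod_Suc_shift[of "\<lambda>i. tau (\<lambda>k. aconst (c k)) (int n) (?r i) (fps_X ^ (n - Suc (p (i - 1))) * Hser)" n]
      prod_Suc_shift[of "\<lambda>i. yvar i ^ (n - Suc (p (i - 1)))" n] by simp
  show ?thesis
    unfolding Sdet_def vandermonde_det[symmetric] det1_leibniz sum_distrib_right act_sum extr_sum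
    by (simp only: act_signof extr_signof mult.assoc *)
qed

section \<open>Dual Schur functions\<close>

text \<open>The twisted monomial for n variables. At the shifted part r = mu_j + n - j the index n -
  r equals j - mu_j, the bound in the products that define the dual Schur functions.\<close>

definition psi :: "(int \<Rightarrow> coef) \<Rightarrow> nat \<Rightarrow> nat \<Rightarrow> coef fps" where
  "psi c n r = fps_X ^ r * efac c (int n - int r)"

lemma psi_Suc: "psi c (Suc n) (Suc r) = fps_X * psi c n r"
  by (simp add: psi_def mult.assoc)

lemma psi_nth_0: "fps_nth (psi c n r) 0 = (if r = 0 then 1 else 0)"
  by (simp add: psi_def)

lemma tau_psi: "tau c (int n) r (psi c n s) = (if r = s then 1 else 0)"
  unfolding psi_def by (rule tau_twisted_monomial)

text \<open>Simultaneous definition of the dual Schur functions (\<open>c = a\<close>) and the Schur functions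
  (\<open>c = 0\<close>).\<close>

definition sgen :: "(int \<Rightarrow> coef) \<Rightarrow> partition \<Rightarrow> nat \<Rightarrow> yser" where
  "sgen c mu n = (if len mu \<le> n
     then det1 n (\<lambda>l j. wser {1..n} (psi c n (part mu j + n - j)) (n - l)) else 0)"

lemma vandermonde_sgen:
  "len mu \<le> n \<Longrightarrow> vandermonde n yvar * sgen c mu n = det1 n (\<lambda>i j. yev i (psi c n (part mu j + n - j)))"
  by (simp add: sgen_def det_yev)

lemma quot_sgen:
  assumes "len mu \<le> n" "\<And>i j. i \<in> {1..n} \<Longrightarrow> j \<in> {1..n} \<Longrightarrow> A i j = yev i (psi c n (part mu j + n - j))"
  shows "quot (det1 n A) (vandermonde n yvar) = sgen c mu n"
proof (rule quotI)
  show "det1 n A = vandermonde n yvar * sgen c mu n"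
    unfolding vandermonde_sgen[OF assms(1)] by (rule det1_cong) (rule assms(2))
qed (rule vandermonde_yvar_cancel)

lemma schur_y_sgen: "schur_y mu = sgen (\<lambda>_. 0) mu"
proof
  fix n
  have "schur_y mu n = sgen (\<lambda>_. 0) mu n" if "len mu \<le> n"
  proof -
    have "quot (det1 n (\<lambda>i j. yvar i ^ (part mu j + n - j))) (vandermonde n yvar) = sgen (\<lambda>_. 0) mu n"
    proof (rule quot_sgen[OF that])
      fix i j
      interpret y: comm_ring_hom "yev i" by (rule yev_hom)
      show "yvar i ^ (part mu j + n - j) = yev i (psi (\<lambda>_. 0) n (part mu j + n - j))"
        by (simp add: psi_def y.hom_power yev_X)
    qed
    then show ?thesis using that by (simp add: schur_y_def)
  qed
  then show "schur_y mu n = sgen (\<lambda>_. 0) mu n"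
    by (cases "len mu \<le> n") (simp_all add: schur_y_def sgen_def)
qed

text \<open>Parts decrease while j grows, so the set counted by \<open>diag\<close> is an initial
  segment of the row numbers.\<close>

lemma le_diag_iff: assumes "1 \<le> j" shows "j \<le> diag mu \<longleftrightarrow> j \<le> part mu j"
proof -
  let ?D = "{j. 1 \<le> j \<and> j \<le> part mu j}"
  have D: "?D \<subseteq> {1..len mu}"
  proof
    fix i assume "i \<in> ?D"
    then show "i \<in> {1..len mu}" using part_beyond[of mu i] by (cases "i \<le> len mu") auto
  qed
  then have fin: "finite ?D" by (rule finite_subset) simp
  show ?thesis
  proof
    assume "j \<le> part mu j"
    have "{1..j} \<subseteq> ?D"
    proof
      fix i assume i: "i \<in> {1..j}"
      then have "part mu j \<le> part mu i" by (intro part_antimono) auto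
      then show "i \<in> ?D" using i \<open>j \<le> part mu j\<close> by auto
    qed
    then show "j \<le> diag mu" unfolding diag_def using card_mono[OF fin, of "{1..j}"] by simp
  next
    assume *: "j \<le> diag mu"
    show "j \<le> part mu j"
    proof (rule ccontr)
      assume n: "\<not> j \<le> part mu j"
      have "?D \<subseteq> {1..<j}"
      proof
        fix i assume i: "i \<in> ?D"
        have "i < j"
        proof (rule ccontr)
          assume "\<not> i < j"
          then have "part mu i \<le> part mu j" using assms by (intro part_antimono) auto
          then show False using i n \<open>\<not> i < j\<close> by auto
        qed
        then show "i \<in> {1..<j}" using i by simp
      qed
      then have "card ?D \<le> j - 1" using card_mono[of "{1..<j}" ?D] by simp
      then show False using * assms by (simp add: diag_def)
    qed
  qed
qed

text \<open>The distinction between columns up to d and beyond d is the sign of j - mu_j, which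
  \<open>efac\<close> already distinguishes.\<close>

lemma s_hat_sgen: "s_hat mu = sgen avar mu"
proof
  fix n
  have "s_hat mu n = sgen avar mu n" if len: "len mu \<le> n"
  proof -
    let ?A = "\<lambda>i j. if j \<le> diag mu
          then quot (yvar i ^ (part mu j + n - j))
                 (\<Prod>k\<in>{int j - int (part mu j)..0}. 1 - yconst (avar k) * yvar i)
          else yvar i ^ (part mu j + n - j) *
                 (\<Prod>k\<in>{1..int j - int (part mu j) - 1}. 1 - yconst (avar k) * yvar i)"
    have "quot (det1 n ?A) (vandermonde n yvar) = sgen avar mu n"
    proof (rule quot_sgen[OF len])
      fix i j assume j: "j \<in> {1..n}"
      interpret y: comm_ring_hom "yev i" by (rule yev_hom)
      have arith: "int n - int (part mu j + n - j) = int j - int (part mu j)"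
        using j by (simp add: of_nat_diff)
      show "?A i j = yev i (psi avar n (part mu j + n - j))"
      proof (cases "j \<le> part mu j")
        case True
        then show ?thesis using j le_diag_iff[of j mu]
          unfolding psi_def arith by (simp add: quot_yvar_power efac_def)
      next
        case False
        then show ?thesis using j le_diag_iff[of j mu]
          unfolding psi_def arith by (simp add: efac_def y.hom_mult y.hom_power y.hom_prod yev_X yev_lin)
      qed
    qed
    then show ?thesis using len by (simp add: s_hat_def)
  qed
  then show "s_hat mu n = sgen avar mu n"
    by (cases "len mu \<le> n") (simp_all add: s_hat_def sgen_def)
qed

section \<open>Setting variables to zero, and stability of the dual Schur functions\<close>

definition yrestr :: "nat set \<Rightarrow> yser \<Rightarrow> yser" where
  "yrestr A F = Mfps (\<lambda>\<gamma>. if Poly_Mapping.keys \<gamma> \<subseteq> A then mcoeff F \<gamma> else 0)"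

lemma mcoeff_yrestr: "mcoeff (yrestr A F) \<gamma> = (if Poly_Mapping.keys \<gamma> \<subseteq> A then mcoeff F \<gamma> else 0)"
  by (simp add: yrestr_def)

lemma yrestr_hom: "comm_ring_hom (yrestr A)"
proof
  show "yrestr A 0 = 0" "yrestr A 1 = 1" "yrestr A (F + G) = yrestr A F + yrestr A G" for F G
    by (auto intro!: mfps_eqI simp: mcoeff_yrestr mcoeff_1)
  fix F G
  show "yrestr A (F * G) = yrestr A F * yrestr A G"
  proof (rule mfps_eqI)
    fix \<gamma> :: "nat \<Rightarrow>\<^sub>0 nat"
    show "mcoeff (yrestr A (F * G)) \<gamma> = mcoeff (yrestr A F * yrestr A G) \<gamma>"
    proof (cases "Poly_Mapping.keys \<gamma> \<subseteq> A")
      case True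
      then have "mcoeff (yrestr A F * yrestr A G) \<gamma> = mcoeff (F * G) \<gamma>"
        unfolding mcoeff_mult by (intro sum.cong refl) (auto simp: mcoeff_yrestr keys_add_nat)
      then show ?thesis using True by (simp add: mcoeff_yrestr)
    next
      case False
      then have "mcoeff (yrestr A F * yrestr A G) \<gamma> = 0"
        unfolding mcoeff_mult by (intro sum.neutral) (auto simp: mcoeff_yrestr keys_add_nat)
      then show ?thesis using False by (simp add: mcoeff_yrestr)
    qed
  qed
qed

lemma yrestr_yev: "yrestr A (yev i F) = (if i \<in> A then yev i F else yconst (fps_nth F 0))"
proof (rule mfps_eqI)
  fix \<gamma> :: "nat \<Rightarrow>\<^sub>0 nat"
  show "mcoeff (yrestr A (yev i F)) \<gamma> = mcoeff (if i \<in> A then yev i F else yconst (fps_nth F 0)) \<gamma>"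
  proof (cases "Poly_Mapping.keys \<gamma> \<subseteq> {i}")
    case True
    then obtain k where "\<gamma> = Poly_Mapping.single i k" by (auto simp: keys_subset_singleton)
    moreover have "Poly_Mapping.single i k = 0 \<longleftrightarrow> k = 0" by (metis lookup_single_eq lookup_zero single_zero)
    ultimately show ?thesis by (auto simp: mcoeff_yrestr yev_def yconst_def)
  next
    case False
    then show ?thesis by (auto simp: mcoeff_yrestr yev_def yconst_def)
  qed
qed

lemma yvar_cancel: "yvar i * f = 0 \<Longrightarrow> f = 0"
proof (rule mfps_eqI)
  fix \<gamma> assume "yvar i * f = 0"
  then have "mcoeff (yvar i * f) (Poly_Mapping.single i 1 + \<gamma>) = 0" by simp
  then show "mcoeff f \<gamma> = mcoeff 0 \<gamma>" by (simp only: yvar_mono mcoeff_mono_mult_add mcoeff_0)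
qed

lemma prod_yvar_cancel: "(\<Prod>i\<in>A. yvar i) * f = 0 \<Longrightarrow> f = 0"
proof (induction A arbitrary: f rule: infinite_finite_induct)
  case (insert x A)
  then have "yvar x * ((\<Prod>i\<in>A. yvar i) * f) = 0" by (simp add: mult.assoc)
  then show ?case by (rule insert.IH[OF yvar_cancel])
qed auto

text \<open>At y_{n+1} = 0 the Vandermonde product gains the factor y_1...y_n. If mu has n + 1
  parts, all exponents are positive and the last row vanishes. If it has fewer, the last row is a
  unit row and each remaining row releases a factor y_i, which cancels the gain.\<close>

lemma yrestr_sgen: "yrestr {1..n} (sgen c mu (Suc n)) = sgen c mu n"
proof (cases "len mu \<le> Suc n")
  case False
  interpret R: comm_ring_hom "yrestr {1..n}" by (rule yrestr_hom)
  show ?thesis using False by (simp add: sgen_def R.hom_zero del: One_nat_def)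
next
  case True
  interpret R: comm_ring_hom "yrestr {1..n}" by (rule yrestr_hom)
  let ?R = "yrestr {1..n}" and ?Y = "\<Prod>i\<in>{1..n}. yvar i"
  let ?A = "\<lambda>i j. ?R (yev i (psi c (Suc n) (part mu j + Suc n - j)))"
  have yv: "?R (yvar i) = (if i \<in> {1..n} then yvar i else 0)" for i
    by (auto simp: yev_X[symmetric] yrestr_yev yconst_def intro!: mfps_eqI)
  note yv' = yv[unfolded One_nat_def]
  have "vandermonde (Suc n) yvar = (\<Prod>i\<in>{1..n}. yvar i - yvar (Suc n)) * (vandermonde n yvar :: yser)"
    unfolding vandermonde_def by (subst prod.nat_ivl_Suc') (simp_all only: atLeastLessThanSuc_atLeastAtMost)
  moreover have "?R (\<Prod>i\<in>{1..n}. yvar i - yvar (Suc n)) = ?Y"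
    unfolding R.hom_prod R.hom_minus by (rule prod.cong) (auto simp: yv')
  moreover have "?R (vandermonde n yvar) = vandermonde n yvar"
    unfolding vandermonde_def R.hom_prod R.hom_minus by (intro prod.cong refl) (auto simp: yv')
  ultimately have van: "?R (vandermonde (Suc n) yvar) = ?Y * vandermonde n yvar"
    by (simp only: R.hom_mult)
  have eq: "?Y * vandermonde n yvar * ?R (sgen c mu (Suc n)) = det1 (Suc n) ?A"
    using arg_cong[OF vandermonde_sgen[OF True, of c], of ?R]
    by (simp only: R.hom_mult van det1_hom[OF yrestr_hom])
  have cancel: "f = 0" if "?Y * vandermonde n yvar * f = 0" for f
  proof -
    have "?Y * (vandermonde n yvar * f) = 0" using that by (simp only: mult.assoc)
    then have "vandermonde n yvar * f = 0" by (rule prod_yvar_cancel)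
    then show ?thesis by (rule vandermonde_yvar_cancel)
  qed
  show ?thesis
  proof (cases "len mu \<le> n")
    case False
    have "det1 (Suc n) ?A = 0"
    proof (rule det1_zero_row[of "Suc n"])
      fix j assume "j \<in> {1..Suc n}"
      then have "part mu j + Suc n - j \<noteq> 0" using part_pos[of j mu] False by auto
      then show "?A (Suc n) j = 0"
        by (auto simp: yrestr_yev psi_nth_0 yconst_def intro!: mfps_eqI)
    qed simp
    then have "?R (sgen c mu (Suc n)) = 0" using eq cancel by simp
    then show ?thesis using False by (simp add: sgen_def)
  next
    case len: True
    have "det1 (Suc n) ?A = det1 n ?A"
    proof (rule det1_last_row)
      fix j assume "j \<in> {1..n}"
      then show "?A (Suc n) j = 0"
        by (auto simp: yrestr_yev psi_nth_0 yconst_def Suc_diff_le intro!: mfps_eqI)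
    next
      show "?A (Suc n) (Suc n) = 1"
        using len by (auto simp: yrestr_yev psi_nth_0 yconst_def mcoeff_1 intro!: mfps_eqI)
    qed
    also have "\<dots> = det1 n (\<lambda>i j. yvar i * yev i (psi c n (part mu j + n - j)))"
    proof (rule det1_cong)
      fix i j assume ij: "i \<in> {1..n}" "j \<in> {1..n}"
      interpret y: comm_ring_hom "yev i" by (rule yev_hom)
      have "part mu j + Suc n - j = Suc (part mu j + n - j)" using ij by auto
      then have "?A i j = yev i (psi c (Suc n) (Suc (part mu j + n - j)))"
        using ij by (simp only: yrestr_yev if_True)
      then show "?A i j = yvar i * yev i (psi c n (part mu j + n - j))"
        by (simp only: psi_Suc y.hom_mult yev_X)
    qed
    also have "\<dots> = ?Y * (vandermonde n yvar * sgen c mu n)"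
      by (simp add: det1_scale_rows vandermonde_sgen[OF len])
    finally have "?Y * vandermonde n yvar * (?R (sgen c mu (Suc n)) - sgen c mu n) = 0"
      using eq by (simp add: right_diff_distrib mult.assoc)
    then show ?thesis using cancel by fastforce
  qed
qed

definition sfun :: "(int \<Rightarrow> coef) \<Rightarrow> partition \<Rightarrow> partition \<Rightarrow> coef" where
  "sfun c mu = (SOME f. repr (sgen c mu) f)"

lemma repr_sgen: "repr (sgen c mu) (sfun c mu)"
proof -
  have "\<exists>f. repr (sgen c mu) f"
  proof (rule repr_exists)
    show "symser n (sgen c mu n)" for n
      by (simp add: sgen_def symser_0 symser_det1 symser_wser del: One_nat_def)
    show "mcoeff (sgen c mu (Suc n)) \<gamma> = mcoeff (sgen c mu n) \<gamma>" if "Poly_Mapping.keys \<gamma> \<subseteq> {1..n}" for n \<gamma>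
      using arg_cong[OF yrestr_sgen[of n c mu], of "\<lambda>F. mcoeff F \<gamma>"] that
      by (simp only: mcoeff_yrestr if_True simp_thms)
  qed
  then show ?thesis unfolding sfun_def by (rule someI_ex)
qed

lemma shifted_part_less:
  assumes "1 \<le> i" "i < j" "j \<le> n"
  shows "part lam j + n - j < part lam i + n - i"
  using part_antimono[of i j lam] assms by linarith

lemma shifted_part_eq:
  assumes "i \<in> {1..n}" "j \<in> {1..n}"
  shows "part lam i + n - i = part lam j + n - j \<longleftrightarrow> i = j"
  using assms shifted_part_less[of i j n lam] shifted_part_less[of j i n lam]
  by (cases i j rule: linorder_cases) auto

text \<open>Shifted parts are strictly decreasing, so the two sets of n values, one inside the
  other, coincide; the position of a value is then recovered from the number of larger ones.\<close>

lemma shifted_parts_determine: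
  assumes len: "len lam \<le> n" "len mu \<le> n"
    and sub: "\<And>i. i \<in> {1..n} \<Longrightarrow> \<exists>j\<in>{1..n}. part lam i + n - i = part mu j + n - j"
  shows "lam = mu"
proof -
  let ?r = "\<lambda>lam i. part lam i + n - i"
  have inj: "inj_on (?r nu) {1..n}" for nu
    by (rule inj_onI) (simp add: shifted_part_eq)
  have "?r lam ` {1..n} \<subseteq> ?r mu ` {1..n}" using sub by (auto simp only: image_iff)
  moreover have "card (?r lam ` {1..n}) = card (?r mu ` {1..n})" by (simp only: card_image[OF inj])
  ultimately have img: "?r lam ` {1..n} = ?r mu ` {1..n}" by (intro card_subset_eq) auto
  have above: "card {v \<in> ?r nu ` {1..n}. v > ?r nu i} = i - 1" if "i \<in> {1..n}" for nu i
  proof -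
    have "{v \<in> ?r nu ` {1..n}. v > ?r nu i} = ?r nu ` {1..<i}"
    proof (intro equalityI subsetI)
      fix v assume "v \<in> {v \<in> ?r nu ` {1..n}. v > ?r nu i}"
      then obtain k where k: "k \<in> {1..n}" "v = ?r nu k" "?r nu k > ?r nu i" by auto
      have "k < i"
        using k that shifted_part_less[of i k n nu] by (cases i k rule: linorder_cases) auto
      then show "v \<in> ?r nu ` {1..<i}" using k by auto
    next
      fix v assume "v \<in> ?r nu ` {1..<i}"
      then obtain k where k: "k \<in> {1..<i}" "v = ?r nu k" by blast
      then have "?r nu i < ?r nu k" "k \<in> {1..n}" using that by (auto intro!: shifted_part_less)
      then show "v \<in> {v \<in> ?r nu ` {1..n}. v > ?r nu i}" using k by auto
    qed
    moreover have "inj_on (?r nu) {1..<i}" by (rule inj_on_subset[OF inj]) (use that in auto)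
    ultimately show ?thesis by (simp add: card_image)
  qed
  show ?thesis
  proof (rule part_inject[OF len])
    fix i assume i: "i \<in> {1..n}"
    then obtain j where j: "j \<in> {1..n}" "?r lam i = ?r mu j" using sub by blast
    have "i - 1 = j - 1" using above[OF i, of lam] above[OF j(1), of mu] img j by simp
    then have "i = j" using i j by auto
    then show "part lam i = part mu i" using j i by auto
  qed
qed

text \<open>The Vandermonde product of \<open>pair_Sdet\<close> clears the denominator of the dual
  Schur function, leaving the 0-1 determinant that compares shifted parts. It is the identity for
  lam = mu and otherwise has a zero row. If mu has more than n parts, its function in n variables is
  0.\<close>

lemma pair_Sdet_sfun:
  assumes "len lam \<le> n"
  shows "pair (Sdet c n lam) (sfun c mu) = (if lam = mu then 1 else 0)"
proof (cases "len mu \<le> n")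
  case False
  then have "pair (Sdet c n lam) (sfun c mu) = 0"
    by (simp add: pair_Sdet[OF repr_sgen] sgen_def)
  then show ?thesis using False assms by auto
next
  case True
  let ?r = "\<lambda>lam i. part lam i + n - i"
  have *: "pair (Sdet c n lam) (sfun c mu) = det1 n (\<lambda>i j. if ?r lam i = ?r mu j then 1 else 0)"
    by (simp add: pair_Sdet[OF repr_sgen] vandermonde_sgen[OF True] extr_det tau_psi)
  show ?thesis
  proof (cases "lam = mu")
    case True
    have "det1 n (\<lambda>i j. if ?r mu i = ?r mu j then 1 else 0 :: coef) = 1"
      by (subst det1_upper_triangular) (auto simp: shifted_part_eq)
    then show ?thesis using * True by simp
  next
    case False
    then obtain i where "i \<in> {1..n}" "\<And>j. j \<in> {1..n} \<Longrightarrow> ?r lam i \<noteq> ?r mu j"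
      using shifted_parts_determine[OF assms True] by blast
    then show ?thesis unfolding * using False by (subst det1_zero_row[of i]) auto
  qed
qed

definition Sgen :: "(int \<Rightarrow> coef) \<Rightarrow> partition \<Rightarrow> alg" where
  "Sgen c lam = Sdet c (len lam) lam"

lemma dual_family_S: "dual_family (Sgen c) (sfun c)"
  by standard (simp_all add: Sgen_def wle_Sdet pair_Sdet_sfun)

section \<open>Dual monomial symmetric functions\<close>

lemma prod_part:
  fixes g :: "nat \<Rightarrow> 'a::comm_monoid_mult"
  assumes "len lam \<le> n" "g 0 = 1"
  shows "(\<Prod>i\<in>{1..n}. g (part lam i)) = (\<Prod>k\<in>#pm lam. g k)"
proof -
  have "(\<Prod>i\<in>{1..n}. g (part lam i)) = (\<Prod>k\<in>#image_mset (part lam) (mset_set {1..n}). g k)"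
    by (simp add: prod_unfold_prod_mset image_mset.compositionality o_def)
  also have "\<dots> = (\<Prod>k\<in>#filter_mset (\<lambda>k. k \<noteq> 0) (image_mset (part lam) (mset_set {1..n})). g k)"
  proof -
    have "(\<Prod>k\<in>#M. g k) = (\<Prod>k\<in>#filter_mset (\<lambda>k. k \<noteq> 0) M. g k)" for M
      by (induction M) (use assms(2) in auto)
    then show ?thesis .
  qed
  also have "filter_mset (\<lambda>k. k \<noteq> 0) (image_mset (part lam) (mset_set {1..n})) = pm lam"
    using sum_row_part[OF assms(1)] pm_sum_rows[of "part lam" "{1..n}"] by metis
  finally show ?thesis .
qed

text \<open>Index 1 is that of a one-row Jacobi-Trudi determinant of size one, so each factor is the
  preimage of some h_k(x||a). It also fits the dual side, since \<open>psi avar 1 r\<close> is the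
  twisted power in \<open>ypow_psi\<close>.\<close>

definition Hhat :: "partition \<Rightarrow> alg" where
  "Hhat lam = (\<Prod>k\<in>#pm lam. tau (\<lambda>k. aconst (avar k)) 1 k Hser)"

lemma Hhat_prod: 
  assumes "len lam \<le> n" shows "Hhat lam = (\<Prod>i\<in>{1..n}. tau (\<lambda>k. aconst (avar k)) 1 (part lam i) Hser)"
  unfolding Hhat_def by (rule prod_part[OF assms, symmetric]) simp

lemma pair_Hhat:
  assumes "repr F f" "len lam \<le> n" shows "pair (Hhat lam) f = extr avar 1 n (part lam) (F n)"
  using pair_prod_tau[OF assms(1), where n = n and c = avar and m = 1 and r = "part lam" and s = "\<lambda>_. 0"]
  by (simp add: Hhat_prod[OF assms(2)])

lemma wle_Hhat: "wle (wt lam) (Hhat lam)"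
proof -
  have "wle (\<Sum>i\<in>{1..len lam}. part lam i) (\<Prod>i\<in>{1..len lam}. tau (\<lambda>k. aconst (avar k)) 1 (part lam i) Hser)"
    by (intro wle_prod wle_tau_Hser)
  then show ?thesis by (simp only: Hhat_prod[OF order_refl] wt_part[OF order_refl])
qed

lemma yev_1 [simp]: "yev i 1 = 1"
proof -
  interpret y: comm_ring_hom "yev i" by (rule yev_hom)
  show ?thesis by simp
qed

lemma ypow_psi: "ypow i r = yev i (psi avar 1 r)"
  by (cases "r = 0") (simp_all add: ypow_def quot_yvar_power psi_def efac_def quot_unit[of 1 1])

lemma psi_1_0: "psi avar (Suc 0) 0 = 1"
  by (simp add: psi_def efac_def)

definition mexps :: "partition \<Rightarrow> nat \<Rightarrow> (nat \<Rightarrow>\<^sub>0 nat) set" where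
  "mexps mu n = {\<gamma>. Poly_Mapping.keys \<gamma> \<subseteq> {1..n} \<and> shape \<gamma> = mu}"

lemma finite_mexps: "finite (mexps mu n)"
proof -
  have "mexps mu n \<subseteq> expo n ` PiE {1..n} (\<lambda>_. {..wt mu})"
  proof
    fix \<gamma> assume \<gamma>: "\<gamma> \<in> mexps mu n"
    then have mdeg: "mdeg \<gamma> = wt mu" by (auto simp: mexps_def wt_shape)
    have "expt \<gamma> i \<le> wt mu" if "i \<in> {1..n}" for i
      using \<gamma> that member_le_sum[of i "{1..n}" "expt \<gamma>"]
      by (simp add: mexps_def mdeg[symmetric] mdeg_superset[of "{1..n}"])
    then have "restrict (expt \<gamma>) {1..n} \<in> PiE {1..n} (\<lambda>_. {..wt mu})" by auto
    moreover have "expo n (restrict (expt \<gamma>) {1..n}) = \<gamma>"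
      using \<gamma> by (intro poly_mapping_eqI) (auto simp: lookup_expo mexps_def in_keys_iff subset_iff)
    ultimately show "\<gamma> \<in> expo n ` PiE {1..n} (\<lambda>_. {..wt mu})" by (metis imageI)
  qed
  then show ?thesis by (rule finite_subset) (intro finite_imageI finite_PiE; simp)
qed

lemma m_hat_mexps: "m_hat mu n = (\<Sum>\<alpha>\<in>mexps mu n. \<Prod>i\<in>{1..n}. yev i (psi avar 1 (expt \<alpha> i)))"
proof -
  have "{\<gamma>. Poly_Mapping.keys \<gamma> \<subseteq> {1..n} \<and> image_mset (expt \<gamma>) (mset_set (Poly_Mapping.keys \<gamma>)) = mset (parts mu)} = mexps mu n"
    by (simp add: mexps_def pm_inject[symmetric] pm_shape) (simp add: pm_def)
  then have "m_hat mu n = (\<Sum>\<alpha>\<in>mexps mu n. \<Prod>i\<in>Poly_Mapping.keys \<alpha>. yev i (psi avar 1 (expt \<alpha> i)))"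
    by (simp only: m_hat_def ypow_psi)
  also have "\<dots> = (\<Sum>\<alpha>\<in>mexps mu n. \<Prod>i\<in>{1..n}. yev i (psi avar 1 (expt \<alpha> i)))"
  proof (rule sum.cong[OF refl])
    fix \<alpha> assume "\<alpha> \<in> mexps mu n"
    then show "(\<Prod>i\<in>Poly_Mapping.keys \<alpha>. yev i (psi avar 1 (expt \<alpha> i))) = (\<Prod>i\<in>{1..n}. yev i (psi avar 1 (expt \<alpha> i)))"
      by (intro prod.mono_neutral_left) (auto simp: mexps_def in_keys_iff psi_1_0)
  qed
  finally show ?thesis .
qed

lemma extr_m_hat:
  assumes "len nu \<le> n" shows "extr avar 1 n (part nu) (m_hat mu n) = (if nu = mu then 1 else 0)"
proof -
  have "extr avar 1 n (part nu) (m_hat mu n)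
      = (\<Sum>\<alpha>\<in>mexps mu n. \<Prod>i\<in>{1..n}. if part nu i = expt \<alpha> i then 1 else 0)"
    using tau_psi[of avar 1] by (simp add: m_hat_mexps extr_sum extr_prod del: One_nat_def)
  also have "\<dots> = (\<Sum>\<alpha>\<in>mexps mu n. if \<alpha> = expo n (part nu) then 1 else 0)"
  proof (rule sum.cong[OF refl])
    fix \<alpha> assume \<alpha>: "\<alpha> \<in> mexps mu n"
    show "(\<Prod>i\<in>{1..n}. if part nu i = expt \<alpha> i then 1 else 0) = (if \<alpha> = expo n (part nu) then 1 else 0 :: coef)"
    proof (cases "\<alpha> = expo n (part nu)")
      case False
      then obtain i where i: "expt \<alpha> i \<noteq> expt (expo n (part nu)) i" by (metis poly_mapping_eqI)
      then have "i \<in> {1..n}" using \<alpha> by (auto simp: lookup_expo mexps_def in_keys_iff subset_iff split: if_splits)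
      then have "(\<Prod>i\<in>{1..n}. if part nu i = expt \<alpha> i then 1 else 0) = (0 :: coef)"
        using i by (intro prod_zero bexI[of _ i]) (auto simp: lookup_expo split: if_splits)
      then show ?thesis using False by simp
    qed (simp add: lookup_expo)
  qed
  also have "\<dots> = (if expo n (part nu) \<in> mexps mu n then 1 else 0)"
    using finite_mexps[of mu n] by simp
  also have "expo n (part nu) \<in> mexps mu n \<longleftrightarrow> nu = mu"
    using keys_expo by (simp add: mexps_def shape_expo sum_row_part[OF assms] del: One_nat_def)
  finally show ?thesis .
qed

lemma mcoeff_m_hat: "mcoeff (m_hat mu n) \<gamma> = (if Poly_Mapping.keys \<gamma> \<subseteq> {1..n}
    then \<Sum>\<alpha>\<in>mexps mu n. \<Prod>i\<in>{1..n}. fps_nth (psi avar 1 (expt \<alpha> i)) (expt \<gamma> i) else 0)"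
  unfolding m_hat_mexps mcoeff_sum by (subst mcoeff_prod_yev) auto

lemma shape_map_key:
  assumes \<pi>: "\<pi> permutes {1..n}" and \<gamma>: "Poly_Mapping.keys \<gamma> \<subseteq> {1..n}"
  shows "shape (Poly_Mapping.map_key \<pi> \<gamma>) = shape \<gamma>"
proof -
  have "shape (Poly_Mapping.map_key \<pi> \<gamma>) = (\<Sum>i\<in>{1..n}. row (expt \<gamma> (\<pi> i)))"
    using keys_map_key_subset[OF \<pi>] \<gamma> permutes_inj[OF \<pi>]
    by (subst shape_superset[of "{1..n}"]) (auto simp: lookup_map_key)
  also have "\<dots> = shape \<gamma>"
    using sum.permute[OF \<pi>, of "\<lambda>i. row (expt \<gamma> i)"] shape_superset[OF _ \<gamma>] by (simp add: o_def)
  finally show ?thesis .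
qed

lemma map_key_mexps:
  assumes "\<pi> permutes {1..n}" "\<alpha> \<in> mexps mu n" shows "Poly_Mapping.map_key \<pi> \<alpha> \<in> mexps mu n"
  using assms keys_map_key_subset[OF assms(1)] shape_map_key[OF assms(1)] by (auto simp: mexps_def)

lemma symser_m_hat: "symser n (m_hat mu n)"
  unfolding symser_def
proof (intro conjI allI impI)
  fix \<pi> and \<gamma> :: "nat \<Rightarrow>\<^sub>0 nat" assume \<pi>: "\<pi> permutes {1..n}"
  have inv: "inv_into UNIV \<pi> permutes {1..n}" using \<pi> by (rule permutes_inv)
  show "mcoeff (m_hat mu n) (Poly_Mapping.map_key \<pi> \<gamma>) = mcoeff (m_hat mu n) \<gamma>"
  proof (cases "Poly_Mapping.keys \<gamma> \<subseteq> {1..n}")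
    case True
    have "(\<Sum>\<alpha>\<in>mexps mu n. \<Prod>i\<in>{1..n}. fps_nth (psi avar 1 (expt \<alpha> i)) (expt (Poly_Mapping.map_key \<pi> \<gamma>) i))
       = (\<Sum>\<alpha>\<in>mexps mu n. \<Prod>i\<in>{1..n}. fps_nth (psi avar 1 (expt (Poly_Mapping.map_key \<pi> \<alpha>) i)) (expt (Poly_Mapping.map_key \<pi> \<gamma>) i))"
      by (rule sum.reindex_bij_witness[of _ "Poly_Mapping.map_key \<pi>" "Poly_Mapping.map_key (inv_into UNIV \<pi>)"])
         (simp_all add: map_key_inv[OF \<pi>] map_key_mexps[OF \<pi>] map_key_mexps[OF inv] del: One_nat_def)
    also have "\<dots> = (\<Sum>\<alpha>\<in>mexps mu n. \<Prod>i\<in>{1..n}. fps_nth (psi avar 1 (expt \<alpha> i)) (expt \<gamma> i))"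
    proof (rule sum.cong[OF refl])
      fix \<alpha>
      show "(\<Prod>i\<in>{1..n}. fps_nth (psi avar 1 (expt (Poly_Mapping.map_key \<pi> \<alpha>) i)) (expt (Poly_Mapping.map_key \<pi> \<gamma>) i))
        = (\<Prod>i\<in>{1..n}. fps_nth (psi avar 1 (expt \<alpha> i)) (expt \<gamma> i))"
        using prod.permute[OF \<pi>, of "\<lambda>i. fps_nth (psi avar 1 (expt \<alpha> i)) (expt \<gamma> i)"]
        by (simp add: lookup_map_key permutes_inj[OF \<pi>] o_def)
    qed
    finally show ?thesis using True keys_map_key_subset[OF \<pi>, of \<gamma>] by (simp only: mcoeff_m_hat if_True)
  next
    case False
    then show ?thesis using keys_map_key_subset[OF \<pi>, of \<gamma>] by (simp only: mcoeff_m_hat if_False)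
  qed
qed (simp add: mcoeff_m_hat)

definition mfun :: "partition \<Rightarrow> partition \<Rightarrow> coef" where
  "mfun mu = (SOME f. repr (m_hat mu) f)"

lemma repr_m_hat: "repr (m_hat mu) (mfun mu)"
proof -
  have "mcoeff (m_hat mu (Suc n)) \<gamma> = mcoeff (m_hat mu n) \<gamma>" if \<gamma>: "Poly_Mapping.keys \<gamma> \<subseteq> {1..n}" for n \<gamma>
  proof -
    let ?q = "\<lambda>\<alpha> i. fps_nth (psi avar 1 (expt \<alpha> i)) (expt \<gamma> i)"
    have \<gamma>0: "expt \<gamma> (Suc n) = 0" using \<gamma> by (auto simp: in_keys_iff subset_iff intro!: gr0I)
       (metis Suc_n_not_le_n gr0I)
    have iff: "\<alpha> \<in> mexps mu n \<longleftrightarrow> \<alpha> \<in> mexps mu (Suc n) \<and> expt \<alpha> (Suc n) = 0" for \<alpha>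
      by (auto simp: mexps_def in_keys_iff subset_iff le_Suc_eq) (metis Suc_n_not_le_n gr0I)
    have "mcoeff (m_hat mu (Suc n)) \<gamma> = (\<Sum>\<alpha>\<in>mexps mu (Suc n). ?q \<alpha> (Suc n) * (\<Prod>i\<in>{1..n}. ?q \<alpha> i))"
      using \<gamma> by (auto simp: mcoeff_m_hat subset_iff mult.commute)
    also have "\<dots> = (\<Sum>\<alpha>\<in>mexps mu n. \<Prod>i\<in>{1..n}. ?q \<alpha> i)"
    \<comment> \<open>Exponent vectors that involve y_{n+1} drop out: a twisted power of positive
      degree has no constant term.\<close>
    proof (rule sum.mono_neutral_cong_right[OF finite_mexps])
      show "mexps mu n \<subseteq> mexps mu (Suc n)" using iff by blast
      show "\<forall>\<alpha>\<in>mexps mu (Suc n) - mexps mu n. ?q \<alpha> (Suc n) * (\<Prod>i\<in>{1..n}. ?q \<alpha> i) = 0"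
        using iff by (auto simp: \<gamma>0 psi_nth_0)
      show "?q \<alpha> (Suc n) * (\<Prod>i\<in>{1..n}. ?q \<alpha> i) = (\<Prod>i\<in>{1..n}. ?q \<alpha> i)" if "\<alpha> \<in> mexps mu n" for \<alpha>
        using iff that by (simp add: \<gamma>0 psi_nth_0)
    qed
    finally show ?thesis using \<gamma> by (simp only: mcoeff_m_hat if_True)
  qed
  then have "\<exists>f. repr (m_hat mu) f"
    by (intro repr_exists symser_m_hat)
  then show ?thesis unfolding mfun_def by (rule someI_ex)
qed

lemma dual_family_m: "dual_family Hhat mfun"
proof
  show "wle (wt lam) (Hhat lam)" for lam by (rule wle_Hhat)
  show "pair (Hhat lam) (mfun mu) = (if lam = mu then 1 else 0)" for lam mu
    by (simp add: pair_Hhat[OF repr_m_hat order_refl] extr_m_hat)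
qed

section \<open>Expansion in dual families\<close>

text \<open>A sum over an infinite set would silently be 0. \<open>locality\<close> confines the
  members that meet a given monomial to a weight bound, so the sum in \<open>formal_sum\<close> is a
  genuine finite one.\<close>

lemma (in dual_family) mcoeff_formal_sum:
  assumes "\<And>lam. repr (G lam) (g lam)"
  shows "mcoeff (formal_sum c G n) \<gamma> = (if Poly_Mapping.keys \<gamma> \<subseteq> {1..n}
     then \<Sum>lam | wt lam \<le> wt (shape \<gamma>). c lam * g lam (shape \<gamma>) else 0)"
proof (cases "Poly_Mapping.keys \<gamma> \<subseteq> {1..n}")
  case True
  then have "mcoeff (formal_sum c G n) \<gamma> = (\<Sum>lam | g lam (shape \<gamma>) \<noteq> 0. c lam * g lam (shape \<gamma>))"
    using assms by (simp add: formal_sum_def repr_def del: One_nat_def)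
  also have "\<dots> = (\<Sum>lam | wt lam \<le> wt (shape \<gamma>). c lam * g lam (shape \<gamma>))"
    by (rule sum.mono_neutral_left[OF finite_wt_le]) (use locality not_le in \<open>auto simp: not_le[symmetric]\<close>)
  finally show ?thesis using True by simp
next
  case False
  then show ?thesis using assms by (simp add: formal_sum_def repr_def del: One_nat_def)
qed

text \<open>Existence is \<open>expand_upto\<close>; uniqueness follows by applying the functional
  of \<open>B lam\<close>, which sees only a finite truncation of the sum. The equivalence is what
  the \<open>THE\<close> in \<open>m_hat_coeffs\<close> calls for.\<close>

lemma (in dual_family) formal_sum_expansion:
  assumes G: "\<And>lam. repr (G lam) (g lam)" and F: "repr F f"
  shows "F = formal_sum c G \<longleftrightarrow> c = (\<lambda>lam. pair (B lam) f)"
proof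
  assume "c = (\<lambda>lam. pair (B lam) f)"
  then show "F = formal_sum c G"
    using F expand_upto by (auto intro!: mfps_eqI simp: mcoeff_formal_sum[OF G] repr_def)
next
  assume eq: "F = formal_sum c G"
  have f: "f nu = (\<Sum>lam | wt lam \<le> wt nu. c lam * g lam nu)" for nu
  proof -
    let ?\<gamma> = "expo (len nu) (part nu)"
    have "shape ?\<gamma> = nu" by (simp only: shape_expo sum_row_part[OF order_refl])
    then show ?thesis
      using F keys_expo[of "len nu" "part nu"] mcoeff_formal_sum[OF G, of c "len nu" ?\<gamma>]
      by (simp only: repr_def eq if_True)
  qed
  have f_upto: "f nu = (\<Sum>mu | wt mu \<le> d. c mu * g mu nu)" if "wt nu \<le> d" for nu d
    unfolding f by (rule sum.mono_neutral_left[OF finite_wt_le]) (use that locality in \<open>auto simp: not_le\<close>)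
  show "c = (\<lambda>lam. pair (B lam) f)"
  proof
    fix lam
    let ?D = "{nu. wt nu \<le> wt lam}"
    have "pair (B lam) f = (\<Sum>nu\<in>?D. Poly_Mapping.lookup (B lam) nu * (\<Sum>mu\<in>?D. c mu * g mu nu))"
      by (simp add: pair_B[OF order_refl] f_upto[of _ "wt lam"])
    also have "\<dots> = (\<Sum>nu\<in>?D. \<Sum>mu\<in>?D. c mu * (Poly_Mapping.lookup (B lam) nu * g mu nu))"
      by (simp add: sum_distrib_left mult.left_commute)
    also have "\<dots> = (\<Sum>mu\<in>?D. \<Sum>nu\<in>?D. c mu * (Poly_Mapping.lookup (B lam) nu * g mu nu))"
      by (rule sum.swap)
    also have "\<dots> = (\<Sum>mu\<in>?D. c mu * pair (B lam) (g mu))"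
      by (simp add: pair_B[OF order_refl] sum_distrib_left)
    also have "\<dots> = c lam"
      using finite_wt_le by (subst sum.remove[of _ lam]) (auto simp: dual intro!: sum.neutral split: if_splits)
    finally show "c lam = pair (B lam) f" ..
  qed
qed

text \<open>For c = 0 the dual family consists of the ordinary Schur functions, in which every
  stable symmetric family therefore expands.\<close>

lemma repr_Lambda_hat: assumes "repr F f" shows "F \<in> Lambda_hat"
proof -
  have "F = formal_sum (\<lambda>lam. pair (Sgen (\<lambda>_. 0) lam) f) (sgen (\<lambda>_. 0))"
    using dual_family.formal_sum_expansion[OF dual_family_S repr_sgen assms] by blast
  moreover have "schur_y = sgen (\<lambda>_. 0)" by (rule ext) (rule schur_y_sgen)
  ultimately show ?thesis unfolding Lambda_hat_def by auto
qed

lemma m_hat_coeffs_repr: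
  assumes "repr F f" shows "m_hat_coeffs F = (\<lambda>lam. pair (Hhat lam) f)"
  unfolding m_hat_coeffs_def
  using dual_family.formal_sum_expansion[OF dual_family_m repr_m_hat assms] by (intro the_equality) auto

section \<open>Duality for power sums\<close>

lemma mcoeff_pj_mult:
  "mcoeff ((\<Sum>i\<in>{1..n}. yvar i ^ j) * F) \<gamma>
     = (\<Sum>i\<in>{1..n}. if j \<le> expt \<gamma> i then mcoeff F (\<gamma> - Poly_Mapping.single i j) else 0)"
  by (simp only: sum_distrib_right mcoeff_sum yvar_power_mono mcoeff_mono_single_mult)

text \<open>Multiplication by y_i^j lowers the i-th exponent by j in the coefficient to be read.
  Summing over the variables is summing over the parts of the shape, since j > 0 discards variables
  with exponent 0.\<close>

lemma repr_Pop:
  assumes F: "repr F f" and "j > 0"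
  shows "repr (\<lambda>n. (\<Sum>i\<in>{1..n}. yvar i ^ j) * F n) (Pop j f)"
  unfolding repr_def
proof (intro allI)
  fix n and \<gamma> :: "nat \<Rightarrow>\<^sub>0 nat"
  have look: "expt (\<gamma> - Poly_Mapping.single i j) k = (if k = i then expt \<gamma> i - j else expt \<gamma> k)" for i k
    by (simp add: lookup_minus lookup_single)
  show "mcoeff ((\<Sum>i\<in>{1..n}. yvar i ^ j) * F n) \<gamma> = (if Poly_Mapping.keys \<gamma> \<subseteq> {1..n} then Pop j f (shape \<gamma>) else 0)"
  proof (cases "Poly_Mapping.keys \<gamma> \<subseteq> {1..n}")
    case True
    let ?K = "Poly_Mapping.keys \<gamma>"
    have sh: "shape (\<gamma> - Poly_Mapping.single i j) = of_pm (pm (shape \<gamma>) - {#expt \<gamma> i#}) + row (expt \<gamma> i - j)"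
      if i: "i \<in> ?K" for i
    proof -
      let ?rest = "\<Sum>k\<in>?K - {i}. row (expt \<gamma> k)"
      have keys: "Poly_Mapping.keys (\<gamma> - Poly_Mapping.single i j) \<subseteq> ?K"
        by (auto simp: in_keys_iff look split: if_splits)
      have "shape (\<gamma> - Poly_Mapping.single i j) = (\<Sum>k\<in>?K. row (expt (\<gamma> - Poly_Mapping.single i j) k))"
        by (rule shape_superset[OF _ keys]) simp
      also have "\<dots> = row (expt \<gamma> i - j) + ?rest"
        using i by (subst sum.remove[of _ i]) (auto simp: look intro!: sum.cong)
      finally have 1: "shape (\<gamma> - Poly_Mapping.single i j) = ?rest + row (expt \<gamma> i - j)" by (simp add: add.commute)
      have "shape \<gamma> = row (expt \<gamma> i) + ?rest"
        unfolding shape_def using i by (subst sum.remove[of _ i]) auto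
      then have "pm (shape \<gamma>) - {#expt \<gamma> i#} = pm ?rest"
        using i by (simp add: in_keys_iff)
      then show ?thesis by (simp only: 1 of_pm_pm)
    qed
    have keys': "Poly_Mapping.keys (\<gamma> - Poly_Mapping.single i j) \<subseteq> {1..n}" for i
      using True by (auto simp: in_keys_iff look subset_iff split: if_splits)
    have "mcoeff ((\<Sum>i\<in>{1..n}. yvar i ^ j) * F n) \<gamma>
        = (\<Sum>i\<in>{1..n}. if j \<le> expt \<gamma> i then f (shape (\<gamma> - Poly_Mapping.single i j)) else 0)"
      using F keys' unfolding mcoeff_pj_mult repr_def by (intro sum.cong refl) (simp del: One_nat_def)
    also have "\<dots> = (\<Sum>i\<in>?K. if j \<le> expt \<gamma> i then f (of_pm (pm (shape \<gamma>) - {#expt \<gamma> i#}) + row (expt \<gamma> i - j)) else 0)"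
      using True assms(2) by (intro sum.mono_neutral_cong_right) (auto simp: in_keys_iff sh)
    also have "\<dots> = Pop j f (shape \<gamma>)"
      by (simp add: Pop_def pm_shape sum_unfold_sum_mset image_mset.compositionality o_def)
    finally show ?thesis using True by simp
  next
    case False
    then obtain k where k: "k \<in> Poly_Mapping.keys \<gamma>" "k \<notin> {1..n}" by blast
    have "mcoeff (F n) (\<gamma> - Poly_Mapping.single i j) = 0" if "i \<in> {1..n}" for i
    proof -
      have "k \<in> Poly_Mapping.keys (\<gamma> - Poly_Mapping.single i j)"
        using k that by (auto simp: in_keys_iff look)
      then have "\<not> Poly_Mapping.keys (\<gamma> - Poly_Mapping.single i j) \<subseteq> {1..n}" using k by blast
      then show ?thesis using F by (simp only: repr_def if_False)
    qed
    then show ?thesis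
      unfolding mcoeff_pj_mult if_not_P[OF False] by (intro sum.neutral) (simp del: One_nat_def)
  qed
qed

lemma p_y_0: "p_y 0 n = 1"
  by (simp only: p_y_def prod_parts pm_zero) simp

lemma p_y_row: "j > 0 \<Longrightarrow> p_y (row j + mu) n = (\<Sum>i\<in>{1..n}. yvar i ^ j) * p_y mu n"
  by (simp only: p_y_def prod_parts pm_plus) simp

definition pfun :: "partition \<Rightarrow> partition \<Rightarrow> coef" where
  "pfun mu = (SOME f. repr (p_y mu) f)"

lemma repr_one: "repr (\<lambda>n. 1) (\<lambda>lam. if lam = 0 then 1 else 0)"
proof -
  have "shape \<gamma> = 0 \<longleftrightarrow> \<gamma> = 0" for \<gamma>
  proof
    assume "shape \<gamma> = 0"
    then have "pm (shape \<gamma>) = {#}" by simp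
    then show "\<gamma> = 0" by (simp add: pm_shape mset_set_empty_iff)
  qed (simp add: shape_def)
  then show ?thesis by (auto simp: repr_def mcoeff_1)
qed

lemma repr_p_y: "repr (p_y mu) (pfun mu)"
proof -
  have "\<exists>f. repr (p_y mu) f"
  proof (induction mu rule: partition_row_induct)
    case zero
    have "p_y 0 = (\<lambda>n. 1)" by (rule ext) (rule p_y_0)
    then show ?case using repr_one by auto
  next
    case (row j mu)
    then obtain f where "repr (p_y mu) f" by blast
    moreover have "p_y (row j + mu) = (\<lambda>n. (\<Sum>i\<in>{1..n}. yvar i ^ j) * p_y mu n)"
      using row(1) by (intro ext p_y_row)
    ultimately show ?case using repr_Pop[of "p_y mu" f j] row(1) by auto
  qed
  then show ?thesis unfolding pfun_def by (rule someI_ex)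
qed

lemma pfun_0: "pfun 0 = (\<lambda>lam. if lam = 0 then 1 else 0)"
proof -
  have "p_y 0 = (\<lambda>n. 1)" by (rule ext) (rule p_y_0)
  then show ?thesis using repr_unique[OF repr_p_y[of 0]] repr_one by simp
qed

lemma pfun_row: "j > 0 \<Longrightarrow> pfun (row j + mu) = Pop j (pfun mu)"
proof -
  assume j: "j > 0"
  have "p_y (row j + mu) = (\<lambda>n. (\<Sum>i\<in>{1..n}. yvar i ^ j) * p_y mu n)"
    using j by (intro ext p_y_row)
  then show ?thesis using repr_unique[OF repr_p_y[of "row j + mu"]] repr_Pop[OF repr_p_y j] by simp
qed

lemma act_Pgen_1:
  assumes "k > 0" shows "act (Pgen k) (\<lambda>lam. if lam = 0 then 1 else 0) nu = 0"
  using assms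
proof (induction k arbitrary: nu rule: less_induct)
  case (less k)
  have H: "act (Hgen r) (\<lambda>lam. if lam = 0 then 1 else 0) = (\<lambda>_. 0)" if "r > 0" for r
    using that by (auto simp: act_Hgen)
  have zero: "act b (\<lambda>_. 0) nu = 0" for b nu by (simp add: act_def)
  have "act (Pgen i * Hgen (k - i)) (\<lambda>lam. if lam = 0 then 1 else 0) nu = 0" if "i \<in> {1..<k}" for i
    using that by (simp add: act_mult H zero)
  then show ?case
    using less.prems by (subst Pgen.simps) (simp add: act_diff act_sum act_mult act_of_nat H zero)
qed

text \<open>The derivative k d/dp_k of a monomial in the power sums, computed factor by factor with
  \<open>act_Pgen_Pop\<close>. If k is not a part, the multiplicity 0 kills the right-hand
  side.\<close>

lemma act_Pgen_pfun:
  assumes "k > 0"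
  shows "act (Pgen k) (pfun mu) nu = of_nat (k * count (pm mu) k) * pfun (of_pm (pm mu - {#k#})) nu"
proof (induction mu arbitrary: nu rule: partition_row_induct)
  case zero
  then show ?case using assms by (simp add: pfun_0 act_Pgen_1)
next
  case (row j mu)
  have IH: "act (Pgen k) (pfun mu) = (\<lambda>nu. of_nat (k * count (pm mu) k) * pfun (of_pm (pm mu - {#k#})) nu)"
    using row.IH by blast
  have "act (Pgen k) (pfun (row j + mu)) nu = of_nat (k * count (pm mu) k) * Pop j (pfun (of_pm (pm mu - {#k#}))) nu
      + (if k = j then of_nat k * pfun mu nu else 0)"
    using row.hyps assms by (simp only: pfun_row act_Pgen_Pop IH Pop_scale)
  moreover have "of_pm (pm (row j + mu) - {#k#}) = row j + of_pm (pm mu - {#k#})" if "k \<in># pm mu"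
    using that row.hyps by (cases "j = k") (auto simp: pm_inject[symmetric] filter_diff_mset)
  ultimately show ?case
    using row.hyps by (cases "k \<in># pm mu"; cases "k = j")
      (auto simp: pfun_row[symmetric] row_part_split not_in_iff algebra_simps)
qed

definition Pprod :: "partition \<Rightarrow> alg" where
  "Pprod lam = (\<Prod>k\<in>#pm lam. Pgen k)"

lemma zee_superset:
  assumes "finite A" "set_mset (pm lam) \<subseteq> A"
  shows "zee lam = (\<Prod>i\<in>A. i ^ count (pm lam) i * fact (count (pm lam) i))"
proof -
  have "zee lam = (\<Prod>i\<in>set_mset (pm lam). i ^ count (pm lam) i * fact (count (pm lam) i))"
    by (simp add: zee_def pm_def count_mset)
  also have "\<dots> = (\<Prod>i\<in>A. i ^ count (pm lam) i * fact (count (pm lam) i))"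
    using assms by (intro prod.mono_neutral_left) (auto simp: not_in_iff)
  finally show ?thesis .
qed

lemma zee_row:
  assumes "k > 0" shows "zee (row k + lam) = k * Suc (count (pm lam) k) * zee lam"
proof -
  let ?A = "insert k (set_mset (pm lam))"
  let ?z = "\<lambda>lam i. i ^ count (pm lam) i * fact (count (pm lam) i)"
  have "zee (row k + lam) = ?z (row k + lam) k * (\<Prod>i\<in>?A - {k}. ?z (row k + lam) i)"
    using assms by (subst zee_superset[of ?A]) (auto simp: prod.remove[of _ k])
  also have "(\<Prod>i\<in>?A - {k}. ?z (row k + lam) i) = (\<Prod>i\<in>?A - {k}. ?z lam i)"
    using assms by (intro prod.cong) auto
  also have "?z (row k + lam) k = k * Suc (count (pm lam) k) * ?z lam k"
    using assms by (simp add: algebra_simps)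
  also have "k * Suc (count (pm lam) k) * ?z lam k * (\<Prod>i\<in>?A - {k}. ?z lam i) = k * Suc (count (pm lam) k) * zee lam"
    by (subst zee_superset[of ?A lam]) (auto simp: prod.remove[of ?A k] mult_ac)
  finally show ?thesis .
qed

lemma zee_0: "zee 0 = 1"
  by (subst zee_superset[of "{}"]) auto

text \<open>Each P_k strips one part k from mu at the price k m_k(mu), which is exactly the growth
  of \<open>zee\<close> in \<open>zee_row\<close>.\<close>

lemma pair_Pprod_pfun: "pair (Pprod lam) (pfun mu) = (if lam = mu then of_nat (zee lam) else 0)"
proof (induction lam arbitrary: mu rule: partition_row_induct)
  case zero
  have "pfun mu 0 = (if mu = 0 then 1 else 0)"
  proof (induction mu rule: partition_row_induct)
    case (row j nu)
    then show ?case by (simp add: pfun_row Pop_def)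
  qed (simp add: pfun_0)
  then show ?case by (auto simp: Pprod_def zee_0)
next
  case (row k lam)
  have P: "Pprod (row k + lam) = Pprod lam * Pgen k"
    using row.hyps by (simp add: Pprod_def mult.commute)
  have "act (Pgen k) (pfun mu) = (\<lambda>nu. of_nat (k * count (pm mu) k) * pfun (of_pm (pm mu - {#k#})) nu)"
    by (rule ext) (rule act_Pgen_pfun[OF row.hyps])
  then have eq: "pair (Pprod (row k + lam)) (pfun mu)
      = of_nat (k * count (pm mu) k) * (if lam = of_pm (pm mu - {#k#}) then of_nat (zee lam) else 0)"
    by (simp only: P act_mult act_fun_scale row.IH)
  show ?case
  proof (cases "k \<in># pm mu")
    case False
    then have "row k + lam \<noteq> mu" using row.hyps by auto
    then show ?thesis using False by (simp add: eq not_in_iff)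
  next
    case True
    define nu where "nu = of_pm (pm mu - {#k#})"
    have mu: "mu = row k + nu" using row_part_split[OF True] by (simp add: nu_def)
    have "count (pm mu) k = Suc (count (pm nu) k)" using row.hyps by (simp add: mu)
    moreover have "row k + lam = mu \<longleftrightarrow> lam = nu" by (simp add: mu)
    ultimately show ?thesis unfolding eq nu_def[symmetric] using row.hyps by (auto simp: zee_row)
  qed
qed

section \<open>Double symmetric polynomials as images of the algebra\<close>

lemma xconst_hom: "comm_ring_hom xconst"
  unfolding xconst_def[abs_def] by (rule single_hom)

abbreviation (input) xa :: "int \<Rightarrow> xpoly" where "xa k \<equiv> xconst (avar k)"

definition Hx :: "nat \<Rightarrow> nat \<Rightarrow> xpoly" where
  "Hx m k = fps_nth (kern xa m xvar) k"

definition theta :: "nat \<Rightarrow> alg \<Rightarrow> xpoly" where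
  "theta m = pm_eval xconst (\<lambda>lam. \<Prod>k\<in>#pm lam. Hx m k)"

lemma kern_nth_0 [simp]: "fps_nth (kern c m z) 0 = 1"
  by (simp add: kern_def fps_prod_nth_0)

lemma Hx_0 [simp]: "Hx m 0 = 1" by (simp add: Hx_def)

lemma theta_hom: "comm_ring_hom (theta m)"
  unfolding theta_def by (rule pm_eval_hom[OF xconst_hom]) auto

lemma theta_Hgen: "theta m (Hgen k) = Hx m k"
proof -
  interpret x: comm_ring_hom xconst by (rule xconst_hom)
  show ?thesis by (simp add: theta_def Hgen_def pm_eval_single[OF xconst_hom])
qed

lemma theta_aconst: "theta m (aconst c) = xconst c"
  by (simp add: theta_def aconst_def pm_eval_single[OF xconst_hom])

lemma theta_Hser: "fps_hom (theta m) Hser = kern xa m xvar"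
  by (rule fps_ext) (simp add: theta_Hgen Hx_def)

lemma kern_prod: "kern c m z = (\<Prod>k\<in>{1..m}. lin (c (int k)) * geo (z k))"
proof -
  have "efac c (int m + 1) = (\<Prod>k\<in>{1..m}. lin (c (int k)))"
    unfolding efac_def
    by (simp, rule prod.reindex_bij_witness[of _ int nat]) auto
  then show ?thesis by (simp add: kern_def prod.distrib)
qed

text \<open>At z_k = c_k numerator and denominator cancel. This yields the compatibility condition
  of \<open>Lambda\<close> and also handles partitions with more parts than variables.\<close>

lemma kern_extend:
  assumes "m \<le> n" shows "kern c n (\<lambda>k. if k \<le> m then z k else c (int k)) = kern c m z"
proof -
  have "(\<Prod>k\<in>{1..n}. lin (c (int k)) * geo (if k \<le> m then z k else c (int k)))
      = (\<Prod>k\<in>{1..m}. lin (c (int k)) * geo (z k))"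
    using assms by (intro prod.mono_neutral_cong_right) (auto simp: lin_geo)
  then show ?thesis by (simp add: kern_prod)
qed

lemma theta_Sdet:
  "theta m (Sdet avar n lam) = det1 n (\<lambda>i l. tau xa (int n) (part lam i + n - i) (fps_X ^ (n - l) * kern xa m xvar))"
proof -
  interpret f: comm_ring_hom "fps_hom (theta m)" by (rule fps_hom_hom[OF theta_hom])
  show ?thesis
    by (simp add: Sdet_def det1_hom[OF theta_hom] tau_hom[OF theta_hom] theta_aconst
        f.hom_mult f.hom_power fps_hom_lin_geo[OF theta_hom] theta_Hser)
qed

lemma avar_inject [simp]: "avar i = avar j \<longleftrightarrow> i = j"
proof
  assume "avar i = avar j"
  then have "Poly_Mapping.keys (avar i) = Poly_Mapping.keys (avar j)" by simp
  then have "Poly_Mapping.single i (1::nat) = Poly_Mapping.single j 1" by (simp add: avar_def)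
  from arg_cong[OF this, of Poly_Mapping.keys] show "i = j" by simp
qed simp

lemma xconst_inject [simp]: "xconst c = xconst d \<longleftrightarrow> c = d"
  by (metis lookup_single_eq xconst_def)

lemma xvar_inject [simp]: "xvar i = xvar j \<longleftrightarrow> i = j"
proof
  assume "xvar i = xvar j"
  then have "Poly_Mapping.keys (xvar i) = Poly_Mapping.keys (xvar j)" by simp
  then have "Poly_Mapping.single i (1::nat) = Poly_Mapping.single j 1" by (simp add: xvar_def)
  from arg_cong[OF this, of Poly_Mapping.keys] show "i = j" by simp
qed simp

lemma xvar_neq_xconst [simp]: "xvar i \<noteq> xconst c"
proof
  assume "xvar i = xconst c"
  then have "Poly_Mapping.lookup (xvar i) (Poly_Mapping.single i 1) = Poly_Mapping.lookup (xconst c) (Poly_Mapping.single i 1)" by simp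
  moreover have "(0 :: nat \<Rightarrow>\<^sub>0 nat) \<noteq> Poly_Mapping.single i 1"
    by (metis lookup_single_eq lookup_zero one_neq_zero)
  ultimately show False by (simp add: xvar_def xconst_def lookup_single when_def)
qed

lemma vandermonde_neq_0:
  fixes z :: "nat \<Rightarrow> 'a::idom"
  assumes "inj_on z {1..n}" shows "vandermonde n z \<noteq> 0"
proof -
  have "z i \<noteq> z j" if "j \<in> {1..n}" "i \<in> {1..<j}" for i j
    using that by (subst inj_on_eq_iff[OF assms]) auto
  then show ?thesis unfolding vandermonde_def by (simp add: prod_zero_iff)
qed

text \<open>For at most m parts this is \<open>det_factorial_powers\<close> divided by the
  Vandermonde product. For n > m parts, apply it in n variables at x_k = a_k for k > m: the kernel
  is unchanged, while every factorial power in row n contains a_n - a_n. The specialised Vandermonde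
  product is nonzero, so the image is 0, as the convention demands.\<close>

lemma theta_Sgen: "theta m (Sgen avar lam) = s_x lam m"
proof (cases "len lam \<le> m")
  case True
  have eq: "det1 m (\<lambda>i j. xpow m i (part lam j + m - j)) = vandermonde m xvar * theta m (Sgen avar lam)"
    unfolding xpow_def Sgen_def Sdet_stable[OF True, symmetric] theta_Sdet
    by (rule det_factorial_powers)
  have "vandermonde m (xvar :: nat \<Rightarrow> xpoly) \<noteq> 0"
    by (rule vandermonde_neq_0) (simp add: inj_on_def)
  then have "quot (det1 m (\<lambda>i j. xpow m i (part lam j + m - j))) (vandermonde m xvar) = theta m (Sgen avar lam)"
    by (intro quotI eq) simp
  then show ?thesis using True by (simp add: s_x_def)
next
  case False
  define n where "n = len lam"
  let ?z = "\<lambda>k. if k \<le> m then xvar k else xa (int k)"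
  let ?r = "\<lambda>j. part lam j + n - j"
  have mn: "m < n" using False by (simp add: n_def)
  have "theta m (Sgen avar lam) = det1 n (\<lambda>i l. tau xa (int n) (?r i) (fps_X ^ (n - l) * kern xa n ?z))"
    unfolding Sgen_def n_def[symmetric] theta_Sdet using mn by (subst kern_extend) auto
  then have "vandermonde n ?z * theta m (Sgen avar lam) = det1 n (\<lambda>i j. \<Prod>k<?r j. ?z i - xa (int n - int k))"
    using det_factorial_powers[of n ?z xa ?r] by simp
  also have "\<dots> = 0"
  proof (rule det1_zero_row[of n])
    fix j assume "j \<in> {1..n}"
    then have "?r j > 0" using part_pos[of j lam] by (simp add: n_def)
    then show "(\<Prod>k<?r j. ?z n - xa (int n - int k)) = 0"
      using mn by (intro prod_zero bexI[of _ 0]) auto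
  qed (use mn in simp)
  finally have "vandermonde n ?z * theta m (Sgen avar lam) = 0" .
  moreover have "vandermonde n ?z \<noteq> 0"
    by (rule vandermonde_neq_0) (auto simp: inj_on_def xvar_neq_xconst[symmetric] split: if_splits)
  ultimately show ?thesis using False by (simp add: s_x_def)
qed

lemma theta_Hhat: "theta n (Hhat lam) = h_x lam n"
proof -
  interpret t: comm_ring_hom "theta n" by (rule theta_hom)
  have S: "Sgen avar (row k) = tau (\<lambda>k. aconst (avar k)) 1 k Hser" if "k > 0" for k
  proof -
    have "part (row k) 1 = k"
      using sum_row_part[of "row k" 1] that by (simp add: len_row pm_inject[symmetric] split: if_splits)
    moreover have "det1 1 A = A 1 1" for A :: "nat \<Rightarrow> nat \<Rightarrow> alg"
      by (subst det1_upper_triangular) auto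
    ultimately show ?thesis using that by (simp add: Sgen_def len_row Sdet_def)
  qed
  have "theta n (\<Prod>k\<in>#M. tau (\<lambda>k. aconst (avar k)) 1 k Hser) = (\<Prod>k\<in>#M. s_x (row k) n)" if "0 \<notin># M" for M
    using that by (induction M) (simp_all add: t.hom_mult S[symmetric] theta_Sgen)
  then show ?thesis by (simp add: Hhat_def h_x_def prod_parts)
qed

section \<open>Newton's identities from the logarithmic derivative of the kernel\<close>

lemma X_deriv_mult: "fps_X * fps_deriv (F * G) = fps_X * fps_deriv F * G + F * (fps_X * fps_deriv G)"
  for F G :: "'a::comm_ring_1 fps"
  by (simp add: algebra_simps)

lemma X_deriv_lin: "fps_X * fps_deriv (lin c) = - (geo c - 1) * lin c"
  using geo_lin[of c] by (simp add: left_diff_distrib) (simp add: lin_def mult.commute flip: fps_const_neg)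

lemma X_deriv_geo: "fps_X * fps_deriv (geo c) = (geo c - 1) * geo c"
proof -
  have "0 = fps_X * fps_deriv (lin c * geo c)" by (simp add: lin_geo)
  also have "\<dots> = - (geo c - 1) * lin c * geo c + lin c * (fps_X * fps_deriv (geo c))"
    by (simp only: X_deriv_mult X_deriv_lin)
  finally have "1 - geo c + lin c * (fps_X * fps_deriv (geo c)) = 0"
    by (simp add: mult.assoc lin_geo)
  then have "geo c - 1 + (1 - geo c + lin c * (fps_X * fps_deriv (geo c))) = geo c - 1" by simp
  then have "lin c * (fps_X * fps_deriv (geo c)) = geo c - 1" by simp
  then have "geo c * (lin c * (fps_X * fps_deriv (geo c))) = geo c * (geo c - 1)" by simp
  then show ?thesis by (simp only: mult.assoc[symmetric] geo_lin mult_1_left mult.commute[of "geo c" "geo c - 1"])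
qed

text \<open>Logarithmic derivative cleared of denominators: each factor contributes
  \<open>geo (z k) - geo (c k)\<close>, whose coefficients are differences of powers, hence the
  summands of p_i(x||a).\<close>

lemma X_deriv_kern:
  "fps_X * fps_deriv (kern c m z) = (\<Sum>k\<in>{1..m}. geo (z k) - geo (c (int k))) * kern c m z"
proof -
  have "fps_X * fps_deriv (\<Prod>k\<in>A. lin (c (int k)) * geo (z k))
     = (\<Sum>k\<in>A. geo (z k) - geo (c (int k))) * (\<Prod>k\<in>A. lin (c (int k)) * geo (z k))" for A
  proof (induction A rule: infinite_finite_induct)
    case (insert k A)
    let ?f = "lin (c (int k)) * geo (z k)" and ?P = "\<Prod>k\<in>A. lin (c (int k)) * geo (z k)"
    have f: "fps_X * fps_deriv ?f = (geo (z k) - geo (c (int k))) * ?f"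
      unfolding X_deriv_mult X_deriv_lin X_deriv_geo by (simp add: algebra_simps)
    have "fps_X * fps_deriv (?f * ?P) = (geo (z k) - geo (c (int k))) * ?f * ?P + ?f * ((\<Sum>k\<in>A. geo (z k) - geo (c (int k))) * ?P)"
      unfolding X_deriv_mult[of ?f ?P] f insert.IH ..
    also have "\<dots> = (geo (z k) - geo (c (int k)) + (\<Sum>k\<in>A. geo (z k) - geo (c (int k)))) * (?f * ?P)"
      by (simp add: algebra_simps)
    finally show ?case by (simp only: prod.insert[OF insert(1,2)] sum.insert[OF insert(1,2)])
  qed auto
  then show ?thesis by (simp add: kern_prod)
qed

lemma Newton_Hx:
  assumes "k > 0"
  shows "of_nat k * Hx m k = (\<Sum>i\<in>{1..k}. (\<Sum>j\<in>{1..m}. xvar j ^ i - xa (int j) ^ i) * Hx m (k - i))"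
proof -
  let ?P = "\<Sum>j\<in>{1..m}. geo (xvar j) - geo (xa (int j))"
  obtain k' where k: "k = Suc k'" using assms by (cases k) auto
  have P: "fps_nth ?P i = (\<Sum>j\<in>{1..m}. xvar j ^ i - xa (int j) ^ i)" for i
    by (simp add: fps_sum_nth geo_def)
  have "of_nat k * Hx m k = fps_nth (fps_X * fps_deriv (kern xa m xvar)) k"
    by (simp add: k Hx_def del: of_nat_Suc)
  also have "\<dots> = (\<Sum>i=0..k. fps_nth ?P i * Hx m (k - i))"
    by (simp only: X_deriv_kern fps_mult_nth Hx_def)
  \<comment> \<open>The term i = 0 vanishes because its coefficient is a sum of 1 - 1.\<close>
  also have "\<dots> = (\<Sum>i\<in>{1..k}. fps_nth ?P i * Hx m (k - i))"
    by (rule sum.mono_neutral_right) (auto simp: fps_sum_nth not_less_eq_eq)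
  finally show ?thesis by (simp only: P)
qed

lemma theta_Pgen: "k > 0 \<Longrightarrow> theta m (Pgen k) = (\<Sum>j\<in>{1..m}. xvar j ^ k - xa (int j) ^ k)"
proof (induction k rule: less_induct)
  case (less k)
  interpret t: comm_ring_hom "theta m" by (rule theta_hom)
  let ?p = "\<lambda>k. \<Sum>j\<in>{1..m}. xvar j ^ k - xa (int j) ^ k"
  have "(\<Sum>i\<in>{1..<k}. theta m (Pgen i) * Hx m (k - i)) = (\<Sum>i\<in>{1..<k}. ?p i * Hx m (k - i))"
    by (rule sum.cong[OF refl]) (use less.IH in simp)
  moreover have "theta m (of_nat k) = of_nat k" for k
    by (induction k) (simp_all add: t.hom_add)
  ultimately have "theta m (Pgen k) = of_nat k * Hx m k - (\<Sum>i\<in>{1..<k}. ?p i * Hx m (k - i))"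
    by (subst Pgen.simps) (simp add: t.hom_minus t.hom_mult t.hom_sum theta_Hgen)
  also have "{1..k} = insert k {1..<k}" using less.prems by auto
  then have "of_nat k * Hx m k = ?p k + (\<Sum>i\<in>{1..<k}. ?p i * Hx m (k - i))"
    using Newton_Hx[OF less.prems, of m] by simp
  finally show ?case by simp
qed

lemma theta_Pprod: "theta n (Pprod lam) = p_x lam n"
proof -
  interpret t: comm_ring_hom "theta n" by (rule theta_hom)
  have "theta n (\<Prod>k\<in>#M. Pgen k) = (\<Prod>k\<in>#M. \<Sum>j\<in>{1..n}. xvar j ^ k - xa (int j) ^ k)" if "0 \<notin># M" for M
    using that by (induction M) (simp_all add: t.hom_mult theta_Pgen)
  then show ?thesis by (simp add: Pprod_def p_x_def prod_parts)
qed

section \<open>Membership in the ring of double symmetric functions\<close>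

lemma monomial_eval_hom:
  fixes f :: "nat \<Rightarrow> 'a::comm_ring_1"
  assumes "comm_ring_hom h"
  shows "comm_ring_hom (pm_eval h (\<lambda>m. \<Prod>i\<in>Poly_Mapping.keys m. f i ^ Poly_Mapping.lookup m i))"
proof -
  let ?g = "\<lambda>m. \<Prod>i\<in>Poly_Mapping.keys m. f i ^ Poly_Mapping.lookup m i"
  have sup: "?g m = (\<Prod>i\<in>A. f i ^ Poly_Mapping.lookup m i)" if "finite A" "Poly_Mapping.keys m \<subseteq> A" for m A
    using that by (intro prod.mono_neutral_left) (auto simp: in_keys_iff)
  have "?g (m + k) = ?g m * ?g k" for m k
  proof -
    let ?A = "Poly_Mapping.keys m \<union> Poly_Mapping.keys k"
    show ?thesis
      by (subst (1 2 3) sup[of ?A]) (auto simp: keys_add_nat lookup_add power_add prod.distrib)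
  qed
  then show ?thesis by (intro pm_eval_hom assms) auto
qed

lemma xsubst_hom: "comm_ring_hom (xsubst f)"
  using monomial_eval_hom[OF xconst_hom, of f] unfolding xsubst_def[abs_def] pm_eval_def[abs_def] .

lemma xsubst_xconst: "xsubst f (xconst c) = xconst c"
  by (cases "c = 0") (simp_all add: xsubst_def xconst_def)

lemma xsubst_xvar: "xsubst f (xvar i) = f i"
  by (simp add: xsubst_def xvar_def) (simp add: xconst_def)

text \<open>The image depends on the x-variables only through the kernel. Symmetry and the condition
  at x_n = a_n thereby reduce to two identities between kernels.\<close>

lemma hom_theta:
  assumes h: "comm_ring_hom h" and "\<And>c. h (xconst c) = xconst c"
    and kern: "kern xa m (\<lambda>i. h (xvar i)) = kern xa n xvar"
  shows "h (theta m b) = theta n b"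
proof -
  interpret h: comm_ring_hom h by fact
  interpret f: comm_ring_hom "fps_hom h" by (rule fps_hom_hom[OF h])
  have "fps_hom h (kern xa m xvar) = kern xa m (\<lambda>i. h (xvar i))"
    by (simp add: kern_prod f.hom_prod f.hom_mult fps_hom_lin_geo[OF h] assms(2))
  then have Hx: "h (Hx m k) = Hx n k" for k
    unfolding Hx_def using kern by (metis fps_hom_nth)
  have "h (\<Prod>k\<in>#M. Hx m k) = (\<Prod>k\<in>#M. Hx n k)" for M
    by (induction M) (simp_all add: h.hom_mult Hx)
  then show ?thesis
    by (simp add: theta_def pm_eval_def h.hom_sum h.hom_mult assms(2))
qed

definition xgood :: "nat \<Rightarrow> nat \<Rightarrow> xpoly \<Rightarrow> bool" where
  "xgood n d p \<longleftrightarrow> (\<forall>m\<in>Poly_Mapping.keys p. Poly_Mapping.keys m \<subseteq> {1..n} \<and> mdeg m \<le> d)"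

lemma xgood_0: "xgood n d 0" by (simp add: xgood_def)

lemma xgood_mono: "xgood n d p \<Longrightarrow> d \<le> e \<Longrightarrow> xgood n e p" by (auto simp: xgood_def)

lemma xgood_add: "xgood n d p \<Longrightarrow> xgood n d q \<Longrightarrow> xgood n d (p + q)"
  unfolding xgood_def using keys_add[of p q] by blast

lemma xgood_uminus: "xgood n d p \<Longrightarrow> xgood n d (- p)"
  by (simp add: xgood_def in_keys_iff)

lemma xgood_sum: "(\<And>i. i \<in> A \<Longrightarrow> xgood n d (p i)) \<Longrightarrow> xgood n d (\<Sum>i\<in>A. p i)"
  by (induction A rule: infinite_finite_induct) (auto intro: xgood_add simp: xgood_0)

lemma xgood_mult: assumes "xgood n d p" "xgood n e q" shows "xgood n (d + e) (p * q)"
  unfolding xgood_def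
proof
  fix m assume "m \<in> Poly_Mapping.keys (p * q)"
  then obtain x y where "m = x + y" "x \<in> Poly_Mapping.keys p" "y \<in> Poly_Mapping.keys q"
    using keys_mult[of p q] by blast
  then show "Poly_Mapping.keys m \<subseteq> {1..n} \<and> mdeg m \<le> d + e"
    using assms unfolding xgood_def mdeg_add[of x y] keys_add_nat[of x y]
    by (auto simp only: mdeg_add keys_add_nat intro!: add_mono)
qed

lemma xgood_xconst: "xgood n d (xconst c)"
  by (simp add: xgood_def xconst_def mdeg_def)

lemma xgood_1: "xgood n d 1"
  using xgood_xconst[of n d 1] by (simp add: xconst_def)

lemma xgood_xvar_power: "i \<in> {1..n} \<Longrightarrow> xgood n k (xvar i ^ k)"
proof (induction k)
  case (Suc k)
  have "xgood n 1 (xvar i)" using Suc.prems by (simp add: xgood_def xvar_def)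
  from xgood_mult[OF this Suc.IH[OF Suc.prems]] show ?case by simp
qed (simp add: xgood_1)

text \<open>Having x-degree at most k in the coefficient of X^k is inherited by products and holds
  for each factor of the kernel. The bound is independent of n, as \<open>Lambda\<close>
  requires.\<close>

lemma xgood_Hx: "xgood n k (Hx n k)"
proof -
  let ?good = "\<lambda>F. \<forall>k. xgood n k (fps_nth F k)"
  have mult: "?good (F * G)" if "?good F" "?good G" for F G
  proof
    fix k
    show "xgood n k (fps_nth (F * G) k)"
      unfolding fps_mult_nth
    proof (rule xgood_sum)
      fix i assume "i \<in> {0..k}"
      then show "xgood n k (fps_nth F i * fps_nth G (k - i))"
        using xgood_mult[of n i "fps_nth F i" "k - i" "fps_nth G (k - i)"] that by simp
    qed
  qed
  have lin: "?good (lin (xconst c))" for c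
  proof
    fix k
    show "xgood n k (fps_nth (lin (xconst c)) k)"
      by (auto simp: lin_def fps_X_nth xgood_0 xgood_1 intro: xgood_uminus xgood_xconst)
  qed
  have geo: "?good (geo (xvar i))" if "i \<in> {1..n}" for i
    using that by (simp add: geo_def xgood_xvar_power del: One_nat_def)
  have "?good (\<Prod>k\<in>A. lin (xa (int k)) * geo (xvar k))" if "A \<subseteq> {1..n}" for A
    using that
  proof (induction A rule: infinite_finite_induct)
    case (insert x A)
    then have "?good (lin (xa (int x)) * geo (xvar x))" "?good (\<Prod>k\<in>A. lin (xa (int k)) * geo (xvar k))"
      using mult[OF lin geo] by auto
    from mult[OF this] show ?case using insert(1,2) by simp
  qed (auto simp: xgood_0 xgood_1)
  from this[OF order_refl] show ?thesis by (simp add: Hx_def kern_prod)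
qed

lemma xgood_theta: assumes "wle d b" shows "xgood n d (theta n b)"
proof -
  have "xgood n (sum_mset M) (\<Prod>k\<in>#M. Hx n k)" for M
    by (induction M) (auto simp: xgood_1 intro: xgood_mult xgood_Hx)
  then have "xgood n (wt lam) (\<Prod>k\<in>#pm lam. Hx n k)" for lam
    by (simp add: wt_def)
  then have "xgood n d (xconst c * (\<Prod>k\<in>#pm lam. Hx n k))" if "wt lam \<le> d" for lam c
    using that xgood_mult[OF xgood_xconst[of n 0 c]] by (metis add_0 xgood_mono)
  then show ?thesis
    using assms unfolding theta_def pm_eval_def wle_def by (intro xgood_sum) auto
qed

lemma wle_exists: "\<exists>d. wle d b"
proof
  show "wle (\<Sum>lam\<in>Poly_Mapping.keys b. wt lam) b"
    unfolding wle_def by (intro ballI member_le_sum) auto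
qed

lemma theta_Lambda: "(\<lambda>n. theta n b) \<in> Lambda"
proof -
  obtain d where d: "wle d b" using wle_exists by blast
  have good: "xgood n d (theta n b)" for n using d by (rule xgood_theta)
  have "xsubst (\<lambda>i. xvar (\<pi> i)) (theta n b) = theta n b" if \<pi>: "\<pi> permutes {1..n}" for n \<pi>
  proof (rule hom_theta[OF xsubst_hom xsubst_xconst])
    have "(\<Prod>k\<in>{1..n}. geo (xvar (\<pi> k) :: xpoly)) = (\<Prod>k\<in>{1..n}. geo (xvar k))"
      using prod.permute[OF \<pi>, of "\<lambda>k. geo (xvar k)"] by (simp add: o_def)
    then show "kern xa n (\<lambda>i. xsubst (\<lambda>i. xvar (\<pi> i)) (xvar i)) = kern xa n xvar"
      by (simp add: kern_def xsubst_xvar)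
  qed
  moreover have "xsubst (xvar(n := xa (int n))) (theta n b) = theta (n - 1) b" if "n \<ge> 1" for n
  proof (rule hom_theta[OF xsubst_hom xsubst_xconst])
    have "kern xa n (xvar(n := xa (int n))) = kern xa n (\<lambda>k. if k \<le> n - 1 then xvar k else xa (int k))"
      unfolding kern_prod by (intro prod.cong refl) auto
    also have "\<dots> = kern xa (n - 1) xvar" by (rule kern_extend) simp
    finally show "kern xa n (\<lambda>i. xsubst (xvar(n := xa (int n))) (xvar i)) = kern xa (n - 1) xvar"
      by (simp only: xsubst_xvar)
  qed
  ultimately show ?thesis
    using good unfolding Lambda_def symmetric_in_def xgood_def by blast
qed

section \<open>Linear independence\<close>

text \<open>Double Schur polynomials are separated by the vanishing theorem: at
  \<open>x\<^sub>i = a\<^bsub>i - \<mu>\<^sub>i\<^esub>\<close> all those with \<open>\<bar>\<lambda>\<bar> \<ge> \<bar>\<mu>\<bar>\<close>, \<open>\<lambda> \<noteq> \<mu>\<close>, vanish.\<close>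

definition xeval :: "(nat \<Rightarrow> coef) \<Rightarrow> xpoly \<Rightarrow> coef" where
  "xeval v = pm_eval (\<lambda>c. c) (\<lambda>m. \<Prod>i\<in>Poly_Mapping.keys m. v i ^ Poly_Mapping.lookup m i)"

lemma xeval_hom: "comm_ring_hom (xeval v)"
  unfolding xeval_def by (rule monomial_eval_hom) (unfold_locales, auto)

lemma xeval_xconst: "xeval v (xconst c) = c"
  by (cases "c = 0") (simp_all add: xeval_def pm_eval_def xconst_def)

lemma xeval_xvar: "xeval v (xvar i) = v i"
  by (simp add: xeval_def pm_eval_def xvar_def)

text \<open>The numerator of the double Schur polynomial of lam at the point of mu: the index n -
  (mu_i + n - i) is i - mu_i. Working with numerators avoids dividing after the evaluation.\<close>

definition vdet :: "nat \<Rightarrow> partition \<Rightarrow> partition \<Rightarrow> coef" where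
  "vdet n lam mu = det1 n (\<lambda>i j. \<Prod>k<part lam j + n - j. avar (int n - int (part mu i + n - i)) - avar (int n - int k))"

lemma vdet_entry:
  "(\<Prod>k<r. avar (int n - int s) - avar (int n - int k)) = 0 \<longleftrightarrow> s < r"
  by (auto simp: prod_zero_iff)

lemma vdet_diag: "vdet n mu mu \<noteq> 0"
proof -
  let ?s = "\<lambda>i. part mu i + n - i"
  let ?A = "\<lambda>i j. \<Prod>k<?s j. avar (int n - int (?s i)) - avar (int n - int k)"
  have "vdet n mu mu = (\<Prod>i\<in>{1..n}. ?A i i)"
    unfolding vdet_def
  proof (rule det1_upper_triangular)
    fix i j assume "i \<in> {1..n}" "j \<in> {1..n}" "j < i"
    then show "?A i j = 0"
      using shifted_part_less[of j i n mu] unfolding vdet_entry by simp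
  qed
  also have "\<dots> \<noteq> 0"
  proof -
    have "?A i i \<noteq> 0" for i unfolding vdet_entry by simp
    then show ?thesis unfolding prod_zero_iff[OF finite_atLeastAtMost] by (simp del: prod_zero_iff)
  qed
  finally show ?thesis .
qed

text \<open>A permutation contributes only if each shifted part of mu is at least the shifted part
  of lam matched with it. As the total for lam is no smaller, all these inequalities are equalities,
  which forces lam = mu.\<close>

lemma vdet_vanish:
  assumes len: "len lam \<le> n" "len mu \<le> n" and wt: "wt mu \<le> wt lam" and neq: "lam \<noteq> mu"
  shows "vdet n lam mu = 0"
proof -
  let ?r = "\<lambda>i. part lam i + n - i" and ?s = "\<lambda>i. part mu i + n - i"
  have "(\<Prod>i\<in>{0..<n}. \<Prod>k<?r (Suc (p i)). avar (int n - int (?s (Suc i))) - avar (int n - int k)) = 0"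
    if p: "p permutes {0..<n}" for p
  proof -
    have "\<exists>i\<in>{0..<n}. ?s (Suc i) < ?r (Suc (p i))"
    proof (rule ccontr)
      assume "\<not> ?thesis"
      then have le: "?r (Suc (p i)) \<le> ?s (Suc i)" if "i \<in> {0..<n}" for i using that by (auto simp: not_less)
      have "(\<Sum>i\<in>{0..<n}. ?r (Suc (p i))) = (\<Sum>i\<in>{0..<n}. ?r (Suc i))"
        using sum.permute[OF p, of "\<lambda>i. ?r (Suc i)"] by (simp add: o_def)
      then have ge: "(\<Sum>i\<in>{0..<n}. ?s (Suc i)) \<le> (\<Sum>i\<in>{0..<n}. ?r (Suc (p i)))"
        using wt by (simp only: sum_shifted_parts[OF len(1)] sum_shifted_parts[OF len(2)])
      have eq: "?r (Suc (p i)) = ?s (Suc i)" if "i \<in> {0..<n}" for i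
      proof (rule ccontr)
        assume "?r (Suc (p i)) \<noteq> ?s (Suc i)"
        then have "?r (Suc (p i)) < ?s (Suc i)" using le[OF that] by simp
        then have "(\<Sum>i\<in>{0..<n}. ?r (Suc (p i))) < (\<Sum>i\<in>{0..<n}. ?s (Suc i))"
          using le that by (intro sum_strict_mono_ex1) auto
        then show False using ge by simp
      qed
      have "mu = lam"
      proof (rule shifted_parts_determine[OF len(2,1)])
        fix i assume "i \<in> {1..n}"
        then have i: "i - 1 \<in> {0..<n}" "Suc (i - 1) = i" by auto
        have "p (i - 1) \<in> {0..<n}" using i permutes_in_image[OF p] by blast
        then show "\<exists>j\<in>{1..n}. ?s i = ?r j"
          using eq[OF i(1)] i(2) by (intro bexI[of _ "Suc (p (i - 1))"]) auto
      qed
      then show False using neq by simp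
    qed
    then obtain i where i: "i \<in> {0..<n}" "?s (Suc i) < ?r (Suc (p i))" by blast
    have "(\<Prod>k<?r (Suc (p i)). avar (int n - int (?s (Suc i))) - avar (int n - int k)) = 0"
      using i(2) unfolding vdet_entry .
    then show ?thesis
      by (rule prod_zero[OF finite_atLeastLessThan bexI[OF _ i(1)]])
  qed
  then show ?thesis
    unfolding vdet_def det1_leibniz by (intro sum.neutral ballI) (simp only: mem_Collect_eq mult_zero_right)
qed

lemma len_le_wt: "len lam \<le> wt lam"
proof (induction lam rule: partition_row_induct)
  case (row k mu)
  then show ?case by (simp add: len_plus len_row)
qed simp

text \<open>A weight bound n of b also serves as the number of variables, because a partition has at
  most as many parts as its weight. Expanding b in the Schur determinants and evaluating the
  numerators gives a triangular linear system with nonzero diagonal, solved by induction on the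
  weight.\<close>

lemma theta_injective:
  assumes "\<And>n. theta n b = 0" shows "b = 0"
proof -
  interpret S: dual_family "Sgen avar" "sfun avar" by (rule dual_family_S)
  obtain n where n: "wle n b" using wle_exists by blast
  interpret t: comm_ring_hom "theta n" by (rule theta_hom)
  let ?c = "\<lambda>lam. pair b (sfun avar lam)"
  let ?D = "{lam. wt lam \<le> n}"
  have len: "len lam \<le> n" if "lam \<in> ?D" for lam
    using that len_le_wt[of lam] by simp
  have b: "b = (\<Sum>lam\<in>?D. aconst (?c lam) * Sgen avar lam)" by (rule S.expand_alg[OF n])
  have "theta n b = (\<Sum>lam\<in>?D. xconst (?c lam) * s_x lam n)"
    by (subst b) (simp add: t.hom_sum t.hom_mult theta_aconst theta_Sgen)
  then have zero: "(\<Sum>lam\<in>?D. xconst (?c lam) * s_x lam n) = 0" using assms by simp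
  have num: "s_x lam n * vandermonde n xvar = det1 n (\<lambda>i j. xpow n i (part lam j + n - j))" if "lam \<in> ?D" for lam
    unfolding theta_Sgen[symmetric] Sgen_def Sdet_stable[OF len[OF that], symmetric] theta_Sdet xpow_def
    by (subst det_factorial_powers) (rule mult.commute)
  have "(\<Sum>lam\<in>?D. xconst (?c lam) * (s_x lam n * vandermonde n xvar)) = 0"
    using arg_cong[OF zero, of "\<lambda>p. p * vandermonde n xvar"] by (simp add: sum_distrib_right mult.assoc)
  then have dets: "(\<Sum>lam\<in>?D. xconst (?c lam) * det1 n (\<lambda>i j. xpow n i (part lam j + n - j))) = 0"
    by (simp add: num)
  have vdets: "(\<Sum>lam\<in>?D. ?c lam * vdet n lam mu) = 0" for mu
  proof -
    let ?v = "\<lambda>i. avar (int n - int (part mu i + n - i))"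
    interpret x: comm_ring_hom "xeval ?v" by (rule xeval_hom)
    show ?thesis
      using arg_cong[OF dets, of "xeval ?v"]
      by (simp add: x.hom_sum x.hom_mult xeval_xconst det1_hom[OF xeval_hom] xpow_def x.hom_prod x.hom_minus xeval_xvar vdet_def)
  qed
  have "?c mu = 0" if "mu \<in> ?D" for mu
    using that
  proof (induction "wt mu" arbitrary: mu rule: less_induct)
    case less
    have "?c lam * vdet n lam mu = 0" if "lam \<in> ?D - {mu}" for lam
    proof (cases "wt lam < wt mu")
      case True
      then show ?thesis using less(1)[OF True] that by simp
    next
      case False
      then show ?thesis using vdet_vanish[of lam n mu] len that less.prems by simp
    qed
    then have "(\<Sum>lam\<in>?D - {mu}. ?c lam * vdet n lam mu) = 0" by (rule sum.neutral[OF ballI])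
    then have "?c mu * vdet n mu mu = 0"
      using vdets[of mu] less.prems finite_wt_le[of n] by (simp add: sum.remove[of ?D mu])
    then show "?c mu = 0" using vdet_diag by simp
  qed
  then have "(\<Sum>lam\<in>?D. aconst (?c lam) * Sgen avar lam) = 0"
    by (intro sum.neutral) (simp add: aconst_def)
  then show ?thesis using b by simp
qed

section \<open>The pairing\<close>

text \<open>The coordinates of b in the \<open>Hhat\<close> are its pairings with the dual monomial
  functions, and \<open>theta_injective\<close> carries their uniqueness over to the image, where
  \<open>h_coeffs\<close> is defined.\<close>

lemma h_coeffs_theta: "h_coeffs (\<lambda>n. theta n b) = (\<lambda>lam. pair b (mfun lam))"
    and finite_h_coeffs: "finite {lam. pair b (mfun lam) \<noteq> 0}"
    and expand_Hhat: "b = (\<Sum>lam | pair b (mfun lam) \<noteq> 0. aconst (pair b (mfun lam)) * Hhat lam)"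
proof -
  interpret M: dual_family Hhat mfun by (rule dual_family_m)
  obtain d where d: "wle d b" using wle_exists by blast
  let ?a = "\<lambda>lam. pair b (mfun lam)"
  have supp: "wt lam \<le> d" if "?a lam \<noteq> 0" for lam
  proof (rule ccontr)
    assume "\<not> wt lam \<le> d"
    then have "pair b (mfun lam) = 0"
      unfolding act_def using d M.locality[of _ lam] by (intro sum.neutral) (auto simp: wle_def)
    then show False using that by simp
  qed
  show fin: "finite {lam. ?a lam \<noteq> 0}"
    by (rule finite_subset[OF _ finite_wt_le[of d]]) (use supp in auto)
  have "(\<Sum>lam | wt lam \<le> d. aconst (?a lam) * Hhat lam) = (\<Sum>lam | ?a lam \<noteq> 0. aconst (?a lam) * Hhat lam)"
    by (rule sum.mono_neutral_right[OF finite_wt_le]) (use supp in \<open>auto simp: aconst_def\<close>)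
  then show b: "b = (\<Sum>lam | ?a lam \<noteq> 0. aconst (?a lam) * Hhat lam)"
    using M.expand_alg[OF d] by simp
  have theta_sum: "theta n (\<Sum>lam | c lam \<noteq> 0. aconst (c lam) * Hhat lam) = (\<Sum>lam | c lam \<noteq> 0. xconst (c lam) * h_x lam n)" for c n
  proof -
    interpret t: comm_ring_hom "theta n" by (rule theta_hom)
    show ?thesis by (simp add: t.hom_sum t.hom_mult theta_aconst theta_Hhat)
  qed
  show "h_coeffs (\<lambda>n. theta n b) = ?a"
    unfolding h_coeffs_def
  proof (rule the_equality)
    show "finite {lam. ?a lam \<noteq> 0} \<and> (\<lambda>n. theta n b) = (\<lambda>n. \<Sum>lam | ?a lam \<noteq> 0. xconst (?a lam) * h_x lam n)"
      using fin b theta_sum[of _ ?a] by simp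
  next
    fix c assume c: "finite {lam. c lam \<noteq> 0} \<and> (\<lambda>n. theta n b) = (\<lambda>n. \<Sum>lam | c lam \<noteq> 0. xconst (c lam) * h_x lam n)"
    let ?b = "\<Sum>lam | c lam \<noteq> 0. aconst (c lam) * Hhat lam"
    have "b - ?b = 0"
    proof (rule theta_injective)
      fix n
      interpret t: comm_ring_hom "theta n" by (rule theta_hom)
      have "theta n b = theta n ?b" unfolding theta_sum using c by metis
      then show "theta n (b - ?b) = 0" by (simp add: t.hom_minus)
    qed
    then have b: "b = ?b" by simp
    show "c = ?a"
    proof
      fix mu
      have "?a mu = (\<Sum>lam | c lam \<noteq> 0. if lam = mu then c lam else 0)"
        by (subst b) (auto simp: act_sum act_aconst_mult M.dual intro!: sum.cong)
      also have "\<dots> = c mu" using c by (simp add: sum.delta)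
      finally show "c mu = ?a mu" ..
    qed
  qed
qed

text \<open>The definition multiplies the \<open>Hhat\<close>-coordinates of b by the values of the
  \<open>Hhat\<close> on f; by linearity this is the value of b itself.\<close>

theorem pairing_theta:
  assumes "repr F f" shows "pairing (\<lambda>n. theta n b) F = pair b f"
proof -
  have "pairing (\<lambda>n. theta n b) F
      = (\<Sum>lam | pair b (mfun lam) \<noteq> 0. pair b (mfun lam) * pair (Hhat lam) f)"
    using theta_Lambda repr_Lambda_hat[OF assms]
    by (simp add: pairing_def h_coeffs_theta m_hat_coeffs_repr[OF assms])
  also have "\<dots> = pair b f"
    by (subst (3) expand_Hhat[of b]) (simp add: act_sum act_aconst_mult)
  finally show ?thesis .
qed

theorem corollary5p3:
  fixes lam mu :: partition
  shows "pairing (s_x lam) (s_hat mu) = (if lam = mu then 1 else 0) \<and>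
         pairing (p_x lam) (p_y mu) = (if lam = mu then of_nat (zee lam) else 0)"
proof
  have "s_x lam = (\<lambda>n. theta n (Sgen avar lam))" "s_hat mu = sgen avar mu"
    by (simp_all add: fun_eq_iff theta_Sgen s_hat_sgen)
  then show "pairing (s_x lam) (s_hat mu) = (if lam = mu then 1 else 0)"
    using pairing_theta[OF repr_sgen] dual_family.dual[OF dual_family_S] by simp
  have "p_x lam = (\<lambda>n. theta n (Pprod lam))"
    by (simp add: fun_eq_iff theta_Pprod)
  then show "pairing (p_x lam) (p_y mu) = (if lam = mu then of_nat (zee lam) else 0)"
    using pairing_theta[OF repr_p_y] pair_Pprod_pfun by simp
qed

end
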